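(* Let $(G,\tau)$ be an effectively locally compact computable topological group. Then $G$ is effectively compatible with an effectively proper right-c.e. metric space $(\{\alpha_i\}_{i\in\omega},d)$, where $d$ is a metric on $G$. Furthermore, $d$ is left-invariant.
   Context: All spaces and groups are Hausdorff and second countable. A computable topological space is a space with an indexed countable base $(B_i)$ of non-empty open sets and a c.e. set $W$ with $B_i\cap B_j=\bigcup\{B_k:(i,j,k)\in W\}$. The name of a point $x$ is $N^x=\{i:x\in B_i\}$. A name of an open set $U$ is any $S\subseteq\omega$ with $U=\bigcup_{i\in S}B_i$; a name of a closed set is a name of its complement. The (compact) name of a compact set $K$ is the set of all finite tuples $\langle i_0,\dots,i_k\rangle$ with $K\subseteq\bigcup_{j\le k}B_{i_j}$; $K$ is effectively compact if this set is c.e. A map is effectively continuous if an enumeration operator transforms any enumeration of a name of an open set into an enumeration of a name of its preimage. A computable topological group is a group on a computable topological space with effectively continuous multiplication and inversion. The space is effectively locally compact if there is an enumeration operator which, given (enumerations of) a name of a point $x$ and a name of an open set $U\ni x$, lists a name of an open set $V$ and a compact name of a compact set $K$ with $x\in V\subseteq K\subseteq U$. A countable metric space $(\{\alpha_i\},d)$ is right-c.e. if $\{r\in\mathbb{Q}:d(\alpha_i,\alpha_j)<r\}$ is uniformly c.e.; it is effectively proper if there is an enumeration operator which, given a name of a closed set $A$ and a basic ball $B_d(\alpha_i,r)\supseteq A$ ($r\in\mathbb{Q}^+$), lists a compact name of some compact $K\supseteq A$ (names taken with respect to the basic balls $B_d(\alpha_i,r)$). $G$ is effectively compatible with $\mathcal{M}=(\{\alpha_i\},d)$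 if $\mathcal{M}\subseteq G\subseteq\overline{\mathcal{M}}$ and the base of $\tau$ and the base of balls $B_d(\alpha_i,\varepsilon)$ restricted to $G$ are effectively compatible: each basic set of either base is effectively open with respect to the other base, uniformly in its index. *)

theory Defs
  imports "HOL-Analysis.Analysis" "HOL-Algebra.Group" "HOL-Library.Nat_Bijection"
    "HOL-Library.Countable"
begin

section \<open>Computably enumerable sets\<close>

datatype recf = Zero | Succ | Proj nat | Comp recf "recf list" | PrimRec recf recf | Mu recf

text \<open>The graph of the partial recursive function denoted by a term. In \<open>PrimRec\<close> the recursion
  variable is the first argument, and the step function receives the recursion variable, the
  previous value and the parameters.\<close>

inductive recf_eval :: "recf \<Rightarrow> nat list \<Rightarrow> nat \<Rightarrow> bool" where
  "recf_eval Zero xs 0"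
| "recf_eval Succ (x # xs) (Suc x)"
| "i < length xs \<Longrightarrow> recf_eval (Proj i) xs (xs ! i)"
| "list_all2 (\<lambda>g y. recf_eval g xs y) gs ys \<Longrightarrow> recf_eval f ys z
    \<Longrightarrow> recf_eval (Comp f gs) xs z"
| "recf_eval f xs y \<Longrightarrow> recf_eval (PrimRec f g) (0 # xs) y"
| "recf_eval (PrimRec f g) (n # xs) y \<Longrightarrow> recf_eval g (n # y # xs) z
    \<Longrightarrow> recf_eval (PrimRec f g) (Suc n # xs) z"
| "recf_eval f (n # xs) 0 \<Longrightarrow> (\<forall>m<n. \<exists>y. recf_eval f (m # xs) (Suc y))
    \<Longrightarrow> recf_eval (Mu f) xs n"

definition ce :: "nat set \<Rightarrow> bool" where
  "ce A \<longleftrightarrow> (\<exists>f. A = {n. \<exists>y. recf_eval f [n] y})"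

section \<open>Enumeration operators\<close>

text \<open>An enumeration of a set of natural numbers may pause, which is coded by the value \<open>0\<close>; so
  the empty set has an enumeration as well.\<close>

definition enumerates :: "(nat \<Rightarrow> nat) \<Rightarrow> nat set \<Rightarrow> bool" where
  "enumerates p A \<longleftrightarrow> A = {n. Suc n \<in> range p}"

text \<open>The set listed by the operator with program \<open>\<Phi>\<close> (a c.e. set of pairs of a finite string and a
  number) when it reads the infinite input \<open>p\<close>: the number \<open>n\<close> is listed as soon as an initial
  segment of \<open>p\<close> is paired with \<open>n\<close>. The output is a set listed from an
  \<^emph>\<open>enumeration\<close>, so different enumerations of one name may lead to different output names.
  This matters for effective local compactness: an operator whose output depended only on the input
  set would be monotone, and reading larger and larger names of open sets it would have to
  produce larger and larger \<open>V\<close> inside smaller and smaller \<open>K\<close>, which is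
  possible in discrete Hausdorff spaces only.\<close>

definition listed :: "nat set \<Rightarrow> (nat \<Rightarrow> nat) \<Rightarrow> nat set" where
  "listed \<Phi> p = {n. \<exists>k. prod_encode (list_encode (map p [0..<k]), n) \<in> \<Phi>}"

text \<open>Two inputs are interleaved, and two outputs are the even and the odd part of the set listed.\<close>

definition interleave :: "(nat \<Rightarrow> nat) \<Rightarrow> (nat \<Rightarrow> nat) \<Rightarrow> nat \<Rightarrow> nat" where
  "interleave p q n = (if even n then p (n div 2) else q (n div 2))"

definition even_part :: "nat set \<Rightarrow> nat set" where
  "even_part A = {n. 2 * n \<in> A}"

definition odd_part :: "nat set \<Rightarrow> nat set" where
  "odd_part A = {n. 2 * n + 1 \<in> A}"

section \<open>Computable topological spaces and groups\<close>

definition computable_space :: "'a topology \<Rightarrow> (nat \<Rightarrow> 'a set) \<Rightarrow> bool" where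
  "computable_space X B \<longleftrightarrow>
     Hausdorff_space X \<and>
     (\<forall>i. openin X (B i) \<and> B i \<noteq> {}) \<and>
     (\<forall>U x. openin X U \<and> x \<in> U \<longrightarrow> (\<exists>i. x \<in> B i \<and> B i \<subseteq> U)) \<and>
     (\<exists>W. ce W \<and> (\<forall>i j. B i \<inter> B j =
        \<Union> (B ` {k. prod_encode (i, prod_encode (j, k)) \<in> W})))"

definition point_name :: "(nat \<Rightarrow> 'a set) \<Rightarrow> 'a \<Rightarrow> nat set" where
  "point_name B x = {i. x \<in> B i}"

definition open_name :: "(nat \<Rightarrow> 'a set) \<Rightarrow> 'a set \<Rightarrow> nat set \<Rightarrow> bool" where
  "open_name B U S \<longleftrightarrow> U = \<Union> (B ` S)"

definition closed_name :: "'a topology \<Rightarrow> (nat \<Rightarrow> 'a set) \<Rightarrow> 'a set \<Rightarrow> nat set \<Rightarrow> bool" where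
  "closed_name X B A S \<longleftrightarrow> A \<subseteq> topspace X \<and> open_name B (topspace X - A) S"

definition compact_name :: "(nat \<Rightarrow> 'a set) \<Rightarrow> 'a set \<Rightarrow> nat set" where
  "compact_name B K = {list_encode js | js. js \<noteq> [] \<and> K \<subseteq> \<Union> (B ` set js)}"

definition effectively_continuous ::
  "'a topology \<Rightarrow> (nat \<Rightarrow> 'a set) \<Rightarrow> 'b topology \<Rightarrow> (nat \<Rightarrow> 'b set) \<Rightarrow> ('a \<Rightarrow> 'b) \<Rightarrow> bool" where
  "effectively_continuous X B Y C f \<longleftrightarrow>
     f \<in> topspace X \<rightarrow> topspace Y \<and>
     (\<exists>\<Phi>. ce \<Phi> \<and>
       (\<forall>U S p. openin Y U \<and> open_name C U S \<and> enumerates p S \<longrightarrow>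
          open_name B {x \<in> topspace X. f x \<in> U} (listed \<Phi> p)))"

definition prod_base :: "(nat \<Rightarrow> 'a set) \<Rightarrow> (nat \<Rightarrow> 'b set) \<Rightarrow> nat \<Rightarrow> ('a \<times> 'b) set" where
  "prod_base B C k = (case prod_decode k of (i, j) \<Rightarrow> B i \<times> C j)"

definition computable_topological_group ::
  "('a, 'm) monoid_scheme \<Rightarrow> 'a topology \<Rightarrow> (nat \<Rightarrow> 'a set) \<Rightarrow> bool" where
  "computable_topological_group G T B \<longleftrightarrow>
     group G \<and> topspace T = carrier G \<and> computable_space T B \<and>
     effectively_continuous (prod_topology T T) (prod_base B B) T B (\<lambda>(x, y). x \<otimes>\<^bsub>G\<^esub> y) \<and>
     effectively_continuous T B T B (\<lambda>x. inv\<^bsub>G\<^esub> x)"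

definition effectively_locally_compact :: "'a topology \<Rightarrow> (nat \<Rightarrow> 'a set) \<Rightarrow> bool" where
  "effectively_locally_compact X B \<longleftrightarrow>
     (\<exists>\<Phi>. ce \<Phi> \<and>
       (\<forall>x U S p q.
          openin X U \<and> x \<in> U \<and> open_name B U S \<and>
          enumerates p (point_name B x) \<and> enumerates q S \<longrightarrow>
          (\<exists>V K. openin X V \<and> compactin X K \<and> x \<in> V \<and> V \<subseteq> K \<and> K \<subseteq> U \<and>
             open_name B V (even_part (listed \<Phi> (interleave p q))) \<and>
             odd_part (listed \<Phi> (interleave p q)) = compact_name B K)))"

section \<open>Countable metric spaces\<close>

text \<open>Indices of positive rationals; the library's \<open>nat_to_rat_surj\<close> indexes all rationals.\<close>

definition pos_rat :: "nat \<Rightarrow> real" where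
  "pos_rat n = (case prod_decode n of (a, b) \<Rightarrow> real (Suc a) / real (Suc b))"

definition right_ce :: "(nat \<Rightarrow> 'a) \<Rightarrow> ('a \<Rightarrow> 'a \<Rightarrow> real) \<Rightarrow> bool" where
  "right_ce \<alpha> d \<longleftrightarrow>
     ce {prod_encode (i, prod_encode (j, n)) | i j n.
           d (\<alpha> i) (\<alpha> j) < real_of_rat (nat_to_rat_surj n)}"

text \<open>The basic ball \<open>B\<^sub>d(\<alpha>\<^sub>i, r)\<close> in the metric space \<open>(M, d)\<close>, indexed by the pair of
  \<open>i\<close> and an index of \<open>r\<close>.\<close>

definition basic_ball :: "'a set \<Rightarrow> ('a \<Rightarrow> 'a \<Rightarrow> real) \<Rightarrow> (nat \<Rightarrow> 'a) \<Rightarrow> nat \<Rightarrow> 'a set" where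
  "basic_ball M d \<alpha> k =
     (case prod_decode k of (i, n) \<Rightarrow> Metric_space.mball M d (\<alpha> i) (pos_rat n))"

text \<open>The points of the countable space are dense in \<open>M\<close>; equivalently, \<open>M\<close> lies (isometrically)
  between \<open>{\<alpha>\<^sub>i}\<close> and its completion.\<close>

definition metric_with_dense_seq :: "'a set \<Rightarrow> ('a \<Rightarrow> 'a \<Rightarrow> real) \<Rightarrow> (nat \<Rightarrow> 'a) \<Rightarrow> bool" where
  "metric_with_dense_seq M d \<alpha> \<longleftrightarrow>
     Metric_space M d \<and> range \<alpha> \<subseteq> M \<and> Metric_space.mtopology M d closure_of range \<alpha> = M"

text \<open>Closed and compact sets are taken in \<open>M\<close>. No generality is lost against the completion of
  \<open>{\<alpha>\<^sub>i}\<close>: the condition makes closed bounded subsets of \<open>M\<close> compact, so \<open>M\<close> is complete, see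
  \<open>effectively_proper_imp_mcomplete\<close> below. The operator is given the index of the ball as the
  first value of its input, followed by an enumeration of the name of \<open>A\<close>.\<close>

definition effectively_proper :: "'a set \<Rightarrow> ('a \<Rightarrow> 'a \<Rightarrow> real) \<Rightarrow> (nat \<Rightarrow> 'a) \<Rightarrow> bool" where
  "effectively_proper M d \<alpha> \<longleftrightarrow>
     (\<exists>\<Phi>. ce \<Phi> \<and>
       (\<forall>A S p k.
          closedin (Metric_space.mtopology M d) A \<and>
          closed_name (Metric_space.mtopology M d) (basic_ball M d \<alpha>) A S \<and>
          enumerates p S \<and> A \<subseteq> basic_ball M d \<alpha> k \<longrightarrow>
          (\<exists>K. compactin (Metric_space.mtopology M d) K \<and> A \<subseteq> K \<and>
             listed \<Phi> (case_nat k p) = compact_name (basic_ball M d \<alpha>) K)))"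

lemma pos_rat_less_witness:
  assumes "0 \<le> x" "x < y" shows "\<exists>n. x < pos_rat n \<and> pos_rat n < y"
proof -
  obtain q where q: "x < of_rat q" "of_rat q < y"
    using of_rat_dense assms by blast
  then have "0 < q" using assms by (metis order.strict_trans1 zero_less_of_rat_iff)
  obtain a b where ab: "quotient_of q = (a, b)" by fastforce
  have b: "b > 0" using quotient_of_denom_pos[OF ab] .
  have qab: "q = of_int a / of_int b" using quotient_of_div[OF ab] .
  have a: "a > 0" using \<open>0 < q\<close> b qab by (simp add: zero_less_divide_iff)
  have "pos_rat (prod_encode (nat (a - 1), nat (b - 1))) = of_rat q"
    using a b by (simp add: pos_rat_def qab of_rat_divide)
  then show ?thesis using q by metis
qed

lemma basic_balls_base:
  assumes dense: "metric_with_dense_seq M d \<alpha>"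
    and U: "openin (Metric_space.mtopology M d) U"
  shows "\<exists>S. open_name (basic_ball M d \<alpha>) U S"
proof -
  interpret Metric_space M d using dense by (simp add: metric_with_dense_seq_def)
  have "\<exists>k. x \<in> basic_ball M d \<alpha> k \<and> basic_ball M d \<alpha> k \<subseteq> U" if x: "x \<in> U" for x
  proof -
    have U': "U \<subseteq> M" "\<forall>x. x \<in> U \<longrightarrow> (\<exists>r>0. mball x r \<subseteq> U)"
      using U unfolding openin_mtopology by simp_all
    obtain r where r: "r > 0" "mball x r \<subseteq> U" using U'(2) x by metis
    have xM: "x \<in> M" using U'(1) x by (rule subsetD)
    obtain n where n: "0 < pos_rat n" "pos_rat n < r / 2"
      using pos_rat_less_witness[of 0 "r / 2"] r by auto
    have "x \<in> mtopology closure_of range \<alpha>" using dense xM by (simp add: metric_with_dense_seq_def)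
    then obtain i where i: "\<alpha> i \<in> mball x (pos_rat n)"
      using n by (auto simp: metric_closure_of)
    have ball: "basic_ball M d \<alpha> (prod_encode (i, n)) = mball (\<alpha> i) (pos_rat n)"
      by (simp add: basic_ball_def)
    have "d (\<alpha> i) x < pos_rat n" "\<alpha> i \<in> M" using i commute[of x "\<alpha> i"] by simp_all
    then have "x \<in> mball (\<alpha> i) (pos_rat n)" "mball (\<alpha> i) (pos_rat n) \<subseteq> mball x r"
      using xM n by (simp, intro mball_subset) simp_all
    then show ?thesis using ball r by blast
  qed
  then have "U = \<Union> (basic_ball M d \<alpha> ` {k. basic_ball M d \<alpha> k \<subseteq> U})" by blast
  then show ?thesis unfolding open_name_def by blast
qed

lemma effectively_proper_imp_mcomplete:
  assumes dense: "metric_with_dense_seq M d \<alpha>" and proper: "effectively_proper M d \<alpha>"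
  shows "Metric_space.mcomplete M d"
proof -
  interpret Metric_space M d using dense by (simp add: metric_with_dense_seq_def)
  have \<alpha>: "\<alpha> i \<in> M" for i using dense by (auto simp: metric_with_dense_seq_def)
  show ?thesis unfolding mcomplete_def
  proof (intro allI impI)
    fix \<sigma> assume \<sigma>: "MCauchy \<sigma>"
    then have "mbounded (range \<sigma>)" by (rule MCauchy_imp_mbounded)
    then have "mbounded (insert (\<alpha> 0) (range \<sigma>))" using \<alpha> by (simp add: mbounded_insert)
    then obtain R where "\<And>m. d (\<alpha> 0) (\<sigma> m) \<le> R" and "range \<sigma> \<subseteq> M"
      unfolding mbounded_alt by blast
    then have R: "range \<sigma> \<subseteq> mcball (\<alpha> 0) R" using \<alpha> by auto
    obtain n where n: "max R 0 < pos_rat n"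
      using pos_rat_less_witness[of "max R 0" "max R 0 + 1"] by auto
    define A where "A = mcball (\<alpha> 0) R"
    have "openin mtopology (M - A)" by (simp add: A_def openin_diff)
    then obtain S where S: "open_name (basic_ball M d \<alpha>) (M - A) S"
      using basic_balls_base[OF dense] by blast
    have enum: "enumerates (\<lambda>m. if m \<in> Suc ` S then m else 0) S"
      by (auto simp: enumerates_def image_iff split: if_splits)
    have sub: "A \<subseteq> basic_ball M d \<alpha> (prod_encode (0, n))"
      using n by (auto simp: A_def basic_ball_def)
    have cl: "closed_name mtopology (basic_ball M d \<alpha>) A S"
      using S by (auto simp: closed_name_def A_def)
    have clA: "closedin mtopology A" by (simp add: A_def)
    obtain K where K: "compactin mtopology K" "A \<subseteq> K"
      using proper cl enum sub clA unfolding effectively_proper_def by blast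
    have "range \<sigma> \<subseteq> K" using R K A_def by blast
    then obtain l and r :: "nat \<Rightarrow> nat" where "strict_mono r" "limitin mtopology (\<sigma> \<circ> r) l sequentially"
      using K(1) unfolding compactin_sequentially by blast
    then show "\<exists>x. limitin mtopology \<sigma> x sequentially"
      using MCauchy_convergent_subsequence[OF \<sigma>] by blast
  qed
qed

definition effectively_compatible_bases :: "(nat \<Rightarrow> 'a set) \<Rightarrow> (nat \<Rightarrow> 'a set) \<Rightarrow> bool" where
  "effectively_compatible_bases B C \<longleftrightarrow>
     (\<exists>W. ce W \<and> (\<forall>i. open_name C (B i) {k. prod_encode (i, k) \<in> W})) \<and>
     (\<exists>W. ce W \<and> (\<forall>k. open_name B (C k) {i. prod_encode (k, i) \<in> W}))"

definition effectively_compatible ::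
  "('a, 'm) monoid_scheme \<Rightarrow> (nat \<Rightarrow> 'a set) \<Rightarrow> (nat \<Rightarrow> 'a) \<Rightarrow> ('a \<Rightarrow> 'a \<Rightarrow> real) \<Rightarrow> bool" where
  "effectively_compatible G B \<alpha> d \<longleftrightarrow>
     metric_with_dense_seq (carrier G) d \<alpha> \<and>
     effectively_compatible_bases B (basic_ball (carrier G) d \<alpha>)"

definition left_invariant :: "('a, 'm) monoid_scheme \<Rightarrow> ('a \<Rightarrow> 'a \<Rightarrow> real) \<Rightarrow> bool" where
  "left_invariant G d \<longleftrightarrow>
     (\<forall>x\<in>carrier G. \<forall>y\<in>carrier G. \<forall>z\<in>carrier G. d (z \<otimes>\<^bsub>G\<^esub> x) (z \<otimes>\<^bsub>G\<^esub> y) = d x y)"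

end

theory Submission
  imports Defs
begin

text \<open>Effective local compactness is only used at the identity, whose name is c.e.: fixing one
  computable enumeration of it gives uniformly computable open sets inside compact sets shrinking to
  the identity. From these one chooses computably neighbourhoods \<open>A i \<subseteq> K i\<close>, \<open>i \<in> \<int>\<close>, with \<open>A i\<close>
  c.e. open, \<open>K i\<close> effectively compact and \<open>K (i + 1) K (i + 1) K (i + 1) \<subseteq> A i\<close>. For \<open>i \<ge> 0\<close> this is
  continuity of the group operations; for \<open>i < 0\<close> one covers a compact set by finitely many translates
  \<open>\<alpha> s A 0\<close>, where the \<open>\<alpha> s\<close> are dense computable points obtained as limits of small basic sets.

  The metric is the Birkhoff--Kakutani (Struble) one: \<open>d x y\<close> is the infimum of the weights
  \<open>\<Sum> 2 powi (- i\<^sub>l)\<close> of chains from \<open>x\<close> to \<open>y\<close> whose \<open>l\<close>-th link lies in \<open>A i\<^sub>l\<close>. As \<open>d x y < 2 powi (- i)\<close>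
  implies \<open>x\<inverse> y \<in> A i\<close>, balls lie in translates of the effectively compact \<open>K i\<close>; and as the \<open>A i\<close> are
  open, the intermediate points of a chain may be taken among the \<open>\<alpha> s\<close>, which makes \<open>d x y < q\<close> c.e.\<close>

section \<open>Recursive functions and semidecidable predicates\<close>

text \<open>Inclusion of an effectively compact set in a c.e. open set is semidecidable, whereas
  inclusion between open sets is in general not. So each scale step is posed as an inclusion of a
  product of compact sets in an open set, which is why every level carries a pair
  \<open>A i\<close>, \<open>K i\<close>: continuity or compactness guarantees classically that a
  suitable next level exists, and a search then finds one. The three factors come from cutting a
  chain at its midpoint in weight into two halves and one link; passing from \<open>i + 1\<close> to
  \<open>i\<close> doubles the weight, which is what the halves need. The scale runs over all
  integers because its ends serve different purposes: the levels towards plus infinity give the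
  topology, those towards minus infinity exhaust the group and place every ball, however large, in
  an effectively compact set. The distance is right-c.e. because every chain bounds it from above; a
  lower bound would have to refute memberships in open sets.\<close>

abbreviation pfst :: "nat \<Rightarrow> nat" where "pfst z \<equiv> fst (prod_decode z)"
abbreviation psnd :: "nat \<Rightarrow> nat" where "psnd z \<equiv> snd (prod_decode z)"

lemma recf_eval_Zero: "recf_eval Zero xs y \<longleftrightarrow> y = 0"
  by (subst recf_eval.simps) auto

lemma recf_eval_Succ: "recf_eval Succ xs y \<longleftrightarrow> (\<exists>x zs. xs = x # zs \<and> y = Suc x)"
  by (subst recf_eval.simps) auto

lemma recf_eval_Proj: "recf_eval (Proj i) xs y \<longleftrightarrow> i < length xs \<and> y = xs ! i"
  by (subst recf_eval.simps) auto

lemma recf_eval_Comp: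
  "recf_eval (Comp f gs) xs z \<longleftrightarrow> (\<exists>ys. list_all2 (\<lambda>g y. recf_eval g xs y) gs ys \<and> recf_eval f ys z)"
  by (subst recf_eval.simps) auto

lemma recf_eval_PrimRec_0: "recf_eval (PrimRec f g) (0 # xs) y \<longleftrightarrow> recf_eval f xs y"
  by (subst recf_eval.simps) auto

lemma recf_eval_PrimRec_Suc: "recf_eval (PrimRec f g) (Suc n # xs) z \<longleftrightarrow>
    (\<exists>y. recf_eval (PrimRec f g) (n # xs) y \<and> recf_eval g (n # y # xs) z)"
  by (subst recf_eval.simps) auto

lemma recf_eval_PrimRec_Nil: "\<not> recf_eval (PrimRec f g) [] y"
  by (subst recf_eval.simps) auto

lemma recf_eval_Mu: "recf_eval (Mu f) xs n \<longleftrightarrow>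
    recf_eval f (n # xs) 0 \<and> (\<forall>m<n. \<exists>y. recf_eval f (m # xs) (Suc y))"
  by (subst recf_eval.simps) auto

lemmas recf_eval_basic = recf_eval_Zero recf_eval_Succ recf_eval_Proj recf_eval_Comp list_all2_Cons1

text \<open>Evaluation is a relation, so that totality and the value are expressed together by an
  equivalence with an equation. Facts of this form compose by rewriting.\<close>

lemma recf_eval_PrimRec_total:
  assumes "\<And>y. recf_eval f xs y \<longleftrightarrow> y = a" and "\<And>n y z. recf_eval g (n # y # xs) z \<longleftrightarrow> z = h n y"
  shows "recf_eval (PrimRec f g) (n # xs) y \<longleftrightarrow> y = rec_nat a h n"
  by (induction n arbitrary: y) (auto simp: recf_eval_PrimRec_0 recf_eval_PrimRec_Suc assms)

lemma recf_eval_Mu_total: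
  assumes f: "\<And>n y. recf_eval f (n # xs) y \<longleftrightarrow> y = F n" and ex: "\<exists>n. F n = (0::nat)"
  shows "recf_eval (Mu f) xs n \<longleftrightarrow> n = (LEAST n. F n = 0)"
proof -
  have "recf_eval (Mu f) xs n \<longleftrightarrow> F n = 0 \<and> (\<forall>m<n. F m \<noteq> 0)"
    unfolding recf_eval_Mu f by (metis not0_implies_Suc nat.distinct(1))
  also have "\<dots> \<longleftrightarrow> n = (LEAST n. F n = 0)"
    by (metis (mono_tags, lifting) ex LeastI_ex Least_equality not_less not_less_Least)
  finally show ?thesis .
qed

section \<open>Total recursive functions\<close>

text \<open>Unary functions are enough because the closure rules act on terms in one variable:
  further arguments are either recursive functions of that variable or coded as pairs. The rules
  collected in \<open>computability\<close> then follow the syntax of a lambda term.\<close>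

definition recursive :: "(nat \<Rightarrow> nat) \<Rightarrow> bool" where
  "recursive f \<longleftrightarrow> (\<exists>r. \<forall>x y. recf_eval r [x] y \<longleftrightarrow> y = f x)"

definition recursive2 :: "(nat \<Rightarrow> nat \<Rightarrow> nat) \<Rightarrow> bool" where
  "recursive2 f \<longleftrightarrow> (\<exists>r. \<forall>x y z. recf_eval r [x, y] z \<longleftrightarrow> z = f x y)"

named_theorems computability

lemma recursive_id [computability]: "recursive (\<lambda>x. x)"
  unfolding recursive_def by (rule exI[of _ "Proj 0"]) (auto simp: recf_eval_basic)

lemma recursive_comp: assumes "recursive f" "recursive g" shows "recursive (\<lambda>x. f (g x))"
proof -
  obtain r s where "\<forall>x y. recf_eval r [x] y \<longleftrightarrow> y = f x" "\<forall>x y. recf_eval s [x] y \<longleftrightarrow> y = g x"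
    using assms unfolding recursive_def by blast
  then show ?thesis unfolding recursive_def
    by (intro exI[of _ "Comp r [s]"]) (auto simp: recf_eval_basic)
qed

lemma recursive2_comp:
  assumes "recursive2 f" "recursive g" "recursive h" shows "recursive (\<lambda>x. f (g x) (h x))"
proof -
  obtain r s t where "\<forall>x y z. recf_eval r [x, y] z \<longleftrightarrow> z = f x y"
      "\<forall>x y. recf_eval s [x] y \<longleftrightarrow> y = g x" "\<forall>x y. recf_eval t [x] y \<longleftrightarrow> y = h x"
    using assms unfolding recursive_def recursive2_def by blast
  then show ?thesis unfolding recursive_def
    by (intro exI[of _ "Comp r [s, t]"]) (auto simp: recf_eval_basic)
qed

lemma recursive_Suc [computability]: "recursive f \<Longrightarrow> recursive (\<lambda>x. Suc (f x))"
proof -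
  have "recursive Suc" unfolding recursive_def by (rule exI[of _ "Succ"]) (auto simp: recf_eval_basic)
  then show "recursive f \<Longrightarrow> recursive (\<lambda>x. Suc (f x))" by (rule recursive_comp)
qed

lemma recursive_const [computability]: "recursive (\<lambda>x. n)"
proof (induction n)
  case 0
  show ?case unfolding recursive_def by (rule exI[of _ "Zero"]) (auto simp: recf_eval_basic)
next
  case (Suc n)
  then show ?case by (rule recursive_Suc)
qed

lemma recursive2_add: "recursive2 (+)"
proof -
  have "recf_eval (PrimRec (Proj 0) (Comp Succ [Proj 1])) (x # [y]) z
      \<longleftrightarrow> z = rec_nat y (\<lambda>_. Suc) x" for x y z
    by (rule recf_eval_PrimRec_total) (auto simp: recf_eval_basic)
  moreover have "rec_nat y (\<lambda>_. Suc) x = x + y" for x y by (induction x) auto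
  ultimately show ?thesis unfolding recursive2_def by (metis)
qed

lemmas recursive_add [computability] = recursive2_comp[OF recursive2_add]

text \<open>Primitive recursion runs over the first argument, so the number of predecessor steps has
  to come first. The predecessor is itself a recursion, whose step returns the recursion
  variable.\<close>

lemma recursive2_diff_swap: "recursive2 (\<lambda>x y. y - x)"
proof -
  have p: "recf_eval (PrimRec Zero (Proj 0)) (x # []) z \<longleftrightarrow> z = rec_nat 0 (\<lambda>n _. n) x" for x z
    by (rule recf_eval_PrimRec_total) (auto simp: recf_eval_basic)
  have "recf_eval (PrimRec (Proj 0) (Comp (PrimRec Zero (Proj 0)) [Proj 1])) (x # [y]) z
      \<longleftrightarrow> z = rec_nat y (\<lambda>_ u. rec_nat 0 (\<lambda>n _. n) u) x" for x y z
    by (rule recf_eval_PrimRec_total) (auto simp: recf_eval_basic p)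
  moreover have "rec_nat 0 (\<lambda>n _. n) u = u - 1" for u :: nat by (cases u) auto
  then have "rec_nat y (\<lambda>_ u. rec_nat 0 (\<lambda>n _. n) u) x = y - x" for x y :: nat by (induction x) auto
  ultimately show ?thesis unfolding recursive2_def by metis
qed

lemma recursive_diff [computability]: "recursive f \<Longrightarrow> recursive g \<Longrightarrow> recursive (\<lambda>x. f x - g x)"
  using recursive2_comp[OF recursive2_diff_swap] .

lemma recursive2_mult: "recursive2 (*)"
proof -
  obtain a where a: "\<And>x y z. recf_eval a [x, y] z \<longleftrightarrow> z = x + y"
    using recursive2_add unfolding recursive2_def by blast
  have "recf_eval (PrimRec Zero (Comp a [Proj 2, Proj 1])) (x # [y]) z
      \<longleftrightarrow> z = rec_nat 0 (\<lambda>_ u. y + u) x" for x y z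
    by (rule recf_eval_PrimRec_total) (auto simp: recf_eval_basic a)
  moreover have "rec_nat 0 (\<lambda>_ u. y + u) x = x * y" for x y :: nat by (induction x) auto
  ultimately show ?thesis unfolding recursive2_def by metis
qed

lemmas recursive_mult [computability] = recursive2_comp[OF recursive2_mult]

lemma recursive_triangle: "recursive triangle"
proof -
  obtain a where a: "\<And>x y z. recf_eval a [x, y] z \<longleftrightarrow> z = x + y"
    using recursive2_add unfolding recursive2_def by blast
  have "recf_eval (PrimRec Zero (Comp Succ [Comp a [Proj 0, Proj 1]])) (x # []) z
      \<longleftrightarrow> z = rec_nat 0 (\<lambda>n u. Suc (n + u)) x" for x z
    by (rule recf_eval_PrimRec_total) (auto simp: recf_eval_basic a)
  moreover have "rec_nat 0 (\<lambda>n u. Suc (n + u)) x = triangle x" for x by (induction x) auto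
  ultimately show ?thesis unfolding recursive_def by metis
qed

lemma recursive2_prod_encode: "recursive2 (\<lambda>x y. prod_encode (x, y))"
proof -
  obtain a t where a: "\<And>x y z. recf_eval a [x, y] z \<longleftrightarrow> z = x + y"
      and t: "\<And>x y. recf_eval t [x] y \<longleftrightarrow> y = triangle x"
    using recursive2_add recursive_triangle unfolding recursive_def recursive2_def by blast
  show ?thesis unfolding recursive2_def
    by (rule exI[of _ "Comp a [Comp t [a], Proj 0]"]) (auto simp: recf_eval_basic a t prod_encode_def)
qed

lemmas recursive_prod_encode [computability] = recursive2_comp[OF recursive2_prod_encode]

lemma recursive2_Mu:
  assumes F: "recursive2 F" and ex: "\<And>x. \<exists>n. F n x = 0"
  shows "recursive (\<lambda>x. LEAST n. F n x = 0)"
proof -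
  obtain r where r: "\<And>x y z. recf_eval r [x, y] z \<longleftrightarrow> z = F x y"
    using F unfolding recursive2_def by blast
  have "recf_eval (Mu r) [x] y \<longleftrightarrow> y = (LEAST n. F n x = 0)" for x y
    by (rule recf_eval_Mu_total) (auto simp: r ex)
  then show ?thesis unfolding recursive_def by blast
qed

text \<open>Inverting the pairing \<open>triangle (a + b) + a\<close> amounts to finding
  \<open>a + b\<close>, which is the least \<open>k\<close> with
  \<open>z < triangle (Suc k)\<close>. Truncated subtraction turns this inequality into an equation
  with 0, as unbounded search requires.\<close>

lemma recursive_pfst_psnd: "recursive pfst" "recursive psnd"
proof -
  obtain t where t: "\<And>x y. recf_eval t [x] y \<longleftrightarrow> y = triangle x"
    using recursive_triangle unfolding recursive_def by blast
  obtain d where d: "\<And>x y z. recf_eval d [x, y] z \<longleftrightarrow> z = y - x"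
    using recursive2_diff_swap unfolding recursive2_def by blast
  have "recursive2 (\<lambda>k z. Suc z - triangle (Suc k))" unfolding recursive2_def
    by (rule exI[of _ "Comp d [Comp t [Comp Succ [Proj 0]], Comp Succ [Proj 1]]"])
       (auto simp: recf_eval_basic t d)
  moreover have "\<exists>k. Suc z - triangle (Suc k) = 0" for z
    by (rule exI[of _ z]) simp
  ultimately have root: "recursive (\<lambda>z. LEAST k. Suc z - triangle (Suc k) = 0)"
    by (rule recursive2_Mu)
  have mono: "triangle i \<le> triangle j" if "i \<le> j" for i j
    using that by (rule lift_Suc_mono_le[rotated]) simp
  have eq: "(LEAST k. Suc z - triangle (Suc k) = 0) = pfst z + psnd z" for z
  proof (rule Least_equality)
    obtain a b where ab: "prod_decode z = (a, b)" by fastforce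
    then have "prod_encode (a, b) = z" by (metis prod_decode_inverse)
    then have z: "z = triangle (a + b) + a" by (simp add: prod_encode_def)
    show "Suc z - triangle (Suc (pfst z + psnd z)) = 0" using ab z by simp
    fix k assume "Suc z - triangle (Suc k) = 0"
    then have "triangle (a + b) < triangle (Suc k)" using z by simp
    then have "\<not> Suc k \<le> a + b" using mono by (meson not_less)
    then show "pfst z + psnd z \<le> k" using ab by simp
  qed
  have "recursive (\<lambda>z. z - triangle (pfst z + psnd z))"
    using root unfolding eq by (intro recursive_diff recursive_id recursive_comp[OF recursive_triangle])
  moreover have "z - triangle (pfst z + psnd z) = pfst z" for z
  proof -
    have "prod_encode (pfst z, psnd z) = z" by simp
    then show ?thesis unfolding prod_encode_def case_prod_conv by (metis add_diff_cancel_left')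
  qed
  ultimately show 1: "recursive pfst" by simp
  have "recursive (\<lambda>z. (pfst z + psnd z) - pfst z)"
    using root 1 unfolding eq by (rule recursive_diff)
  then show "recursive psnd" by simp
qed

lemmas recursive_pfst [computability] = recursive_comp[OF recursive_pfst_psnd(1)]
lemmas recursive_psnd [computability] = recursive_comp[OF recursive_pfst_psnd(2)]

text \<open>The step may depend on the outer variable \<open>x\<close>; its arguments are therefore
  coded in the order \<open>x\<close>, recursion variable, previous value.\<close>

lemma recursive_rec_nat [computability]:
  assumes "recursive f" "recursive (\<lambda>z. g (pfst z) (pfst (psnd z)) (psnd (psnd z)))" "recursive h"
  shows "recursive (\<lambda>x. rec_nat (f x) (g x) (h x))"
proof -
  obtain p where p: "\<And>x y z. recf_eval p [x, y] z \<longleftrightarrow> z = prod_encode (x, y)"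
    using recursive2_prod_encode unfolding recursive2_def by blast
  obtain rf rg rh where r: "\<And>x y. recf_eval rf [x] y \<longleftrightarrow> y = f x" "\<And>x y. recf_eval rh [x] y \<longleftrightarrow> y = h x"
      "\<And>x y. recf_eval rg [x] y \<longleftrightarrow> y = g (pfst x) (pfst (psnd x)) (psnd (psnd x))"
    using assms unfolding recursive_def by blast
  have "recf_eval (PrimRec rf (Comp rg [Comp p [Proj 2, Comp p [Proj 0, Proj 1]]])) (n # [x]) y
      \<longleftrightarrow> y = rec_nat (f x) (g x) n" for n x y
    by (rule recf_eval_PrimRec_total) (auto simp: recf_eval_basic r p)
  then show ?thesis unfolding recursive_def
    by (intro exI[of _ "Comp (PrimRec rf (Comp rg [Comp p [Proj 2, Comp p [Proj 0, Proj 1]]])) [rh, Proj 0]"])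
       (auto simp: recf_eval_basic r)
qed

lemma recursive_Least_0:
  assumes F: "recursive (\<lambda>z. F (pfst z) (psnd z))" and ex: "\<And>x. \<exists>n. F x n = 0"
  shows "recursive (\<lambda>x. LEAST n. F x n = 0)"
proof -
  obtain p where p: "\<And>x y z. recf_eval p [x, y] z \<longleftrightarrow> z = prod_encode (x, y)"
    using recursive2_prod_encode unfolding recursive2_def by blast
  obtain r where r: "\<And>x y. recf_eval r [x] y \<longleftrightarrow> y = F (pfst x) (psnd x)"
    using F unfolding recursive_def by blast
  have "recursive2 (\<lambda>n x. F x n)" unfolding recursive2_def
    by (rule exI[of _ "Comp r [Comp p [Proj 1, Proj 0]]"]) (auto simp: recf_eval_basic r p)
  then show ?thesis using ex by (rule recursive2_Mu)
qed

section \<open>Decidable predicates\<close>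

text \<open>Truth is coded by 0: this is the value for which \<open>Mu\<close> searches, and the one
  at which \<open>rec_nat\<close> returns its base case, so that a case distinction is a recursion
  of length 0 or 1.\<close>

definition decidable :: "(nat \<Rightarrow> bool) \<Rightarrow> bool" where
  "decidable P \<longleftrightarrow> recursive (\<lambda>x. if P x then 0 else 1)"

lemma recursive_if [computability]:
  assumes "decidable P" "recursive f" "recursive g"
  shows "recursive (\<lambda>x. if P x then f x else g x)"
proof -
  have "recursive (\<lambda>x. rec_nat (f x) (\<lambda>_ _. g x) (if P x then 0 else 1))"
    using assms(1) unfolding decidable_def
    by (intro recursive_rec_nat assms(2) recursive_comp[OF assms(3)] recursive_pfst recursive_id)
  moreover have "rec_nat (f x) (\<lambda>_ _. g x) (if P x then 0 else 1) = (if P x then f x else g x)" for x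
    by simp
  ultimately show ?thesis by simp
qed

lemma decidable_const [computability]: "decidable (\<lambda>x. b)"
  unfolding decidable_def by (cases b) (auto intro: computability)

lemma decidable_not [computability]: assumes "decidable P" shows "decidable (\<lambda>x. \<not> P x)"
proof -
  have "recursive (\<lambda>x. if P x then 1 else 0)" by (intro computability assms)
  moreover have "(if P x then 1 else 0) = (if \<not> P x then 0 else 1::nat)" for x by simp
  ultimately show ?thesis unfolding decidable_def by simp
qed

lemma decidable_conj [computability]:
  assumes "decidable P" "decidable Q" shows "decidable (\<lambda>x. P x \<and> Q x)"
proof -
  have "recursive (\<lambda>x. if P x then (if Q x then 0 else 1) else 1)" by (intro computability assms)
  moreover have "(if P x then (if Q x then 0 else 1) else 1) = (if P x \<and> Q x then 0 else 1::nat)" for x by simp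
  ultimately show ?thesis unfolding decidable_def by simp
qed

lemma decidable_disj [computability]:
  assumes "decidable P" "decidable Q" shows "decidable (\<lambda>x. P x \<or> Q x)"
proof -
  have "decidable (\<lambda>x. \<not> (\<not> P x \<and> \<not> Q x))" by (intro computability assms)
  then show ?thesis by simp
qed

lemma decidable_le [computability]:
  assumes "recursive f" "recursive g" shows "decidable (\<lambda>x. f x \<le> g x)"
proof -
  have "recursive (\<lambda>x. 1 - (Suc (g x) - f x))" by (intro computability assms)
  moreover have "1 - (Suc (g x) - f x) = (if f x \<le> g x then 0 else 1)" for x by auto
  ultimately show ?thesis unfolding decidable_def by simp
qed

lemma decidable_less [computability]:
  assumes "recursive f" "recursive g" shows "decidable (\<lambda>x. f x < g x)"
  using decidable_le[OF recursive_Suc[OF assms(1)] assms(2)] by (simp add: Suc_le_eq)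

lemma decidable_eq [computability]:
  assumes "recursive f" "recursive g" shows "decidable (\<lambda>x. f x = g x)"
proof -
  have "decidable (\<lambda>x. f x \<le> g x \<and> g x \<le> f x)" by (intro computability assms)
  moreover have "(\<lambda>x. f x \<le> g x \<and> g x \<le> f x) = (\<lambda>x. f x = g x)" by (rule ext) auto
  ultimately show ?thesis by simp
qed

lemma decidable_comp: "decidable P \<Longrightarrow> recursive f \<Longrightarrow> decidable (\<lambda>x. P (f x))"
  unfolding decidable_def by (rule recursive_comp[of "\<lambda>x. if P x then 0 else 1"])

lemma decidable_all_less [computability]:
  assumes P: "decidable (\<lambda>z. P (pfst z) (psnd z))" and f: "recursive f"
  shows "decidable (\<lambda>x. \<forall>y<f x. P x y)"
proof -
  have 1: "decidable (\<lambda>z. P (pfst z) (pfst (psnd z)))"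
    using decidable_comp[OF P, of "\<lambda>z. prod_encode (pfst z, pfst (psnd z))"]
      recursive_prod_encode[OF recursive_pfst[OF recursive_id] recursive_pfst[OF recursive_psnd[OF recursive_id]]]
    by simp
  have "recursive (\<lambda>x. rec_nat 0 (\<lambda>y r. if P x y then r else 1) (f x))"
    by (intro computability f 1)
  moreover have "rec_nat 0 (\<lambda>y r. if P x y then r else 1) n = (if \<forall>y<n. P x y then 0 else 1::nat)" for x n
    by (induction n) (auto simp: less_Suc_eq)
  ultimately show ?thesis unfolding decidable_def by simp
qed

lemma recursive_Least:
  assumes P: "decidable (\<lambda>z. P (pfst z) (psnd z))" and ex: "\<And>x. \<exists>n. P x n"
  shows "recursive (\<lambda>x. LEAST n. P x n)"
proof -
  have "recursive (\<lambda>x. LEAST n. (if P x n then 0 else 1) = (0::nat))"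
  proof (rule recursive_Least_0)
    show "recursive (\<lambda>z. if P (pfst z) (psnd z) then 0 else 1)"
      using P unfolding decidable_def .
    show "\<exists>n. (if P x n then 0 else 1) = (0::nat)" for x
      using ex[of x] by (metis (full_types))
  qed
  moreover have "(if b then 0 else 1) = (0::nat) \<longleftrightarrow> b" for b by simp
  ultimately show ?thesis by (simp only:)
qed

lemma recursive_div2 [computability]: assumes "recursive f" shows "recursive (\<lambda>x. f x div 2)"
proof -
  have "recursive (\<lambda>x. LEAST k. f x < 2 * Suc k)"
  proof (rule recursive_Least)
    show "decidable (\<lambda>z. f (pfst z) < 2 * Suc (psnd z))"
      by (intro computability recursive_comp[OF assms])
    show "\<exists>n. f x < 2 * Suc n" for x by (rule exI[of _ "f x"]) simp
  qed
  moreover have "(LEAST k. f x < 2 * Suc k) = f x div 2" for x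
    by (rule Least_equality) auto
  ultimately show ?thesis by simp
qed

lemma decidable_even [computability]: assumes "recursive f" shows "decidable (\<lambda>x. even (f x))"
proof -
  have "decidable (\<lambda>x. 2 * (f x div 2) = f x)" by (intro computability assms)
  moreover have "2 * (n div 2) = n \<longleftrightarrow> even n" for n :: nat by presburger
  ultimately show ?thesis by simp
qed

lemma recursive_power [computability]: assumes "recursive f" "recursive g" shows "recursive (\<lambda>x. f x ^ g x)"
proof -
  have "recursive (\<lambda>x. rec_nat 1 (\<lambda>_ y. f x * y) (g x))"
    by (intro computability assms(2) recursive_comp[OF assms(1)])
  moreover have "rec_nat 1 (\<lambda>_ y. f x * y) n = f x ^ n" for x n by (induction n) auto
  ultimately show ?thesis by simp
qed

section \<open>Codes of finite lists\<close>

text \<open>The tail function on list codes sends the code \<open>0\<close> of the empty list to itself, so iterating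
  it past the end of a list is harmless.\<close>

definition code_nth :: "nat \<Rightarrow> nat \<Rightarrow> nat" where
  "code_nth c i = pfst (rec_nat c (\<lambda>_ y. psnd (y - 1)) i - 1)"

abbreviation code_set :: "nat \<Rightarrow> nat set" where "code_set c \<equiv> set (list_decode c)"
abbreviation code_length :: "nat \<Rightarrow> nat" where "code_length c \<equiv> length (list_decode c)"

lemma prod_decode_0 [simp]: "prod_decode 0 = (0, 0)"
  by (simp add: prod_decode_def prod_decode_aux.simps)

lemma psnd_code_tl: "psnd (c - 1) = list_encode (tl (list_decode c))"
  by (cases c) (auto simp: case_prod_beta list_decode.simps)

lemma code_drop: "rec_nat c (\<lambda>_ y. psnd (y - 1)) i = list_encode (drop i (list_decode c))"
  by (induction i) (auto simp: psnd_code_tl[simplified] tl_drop drop_Suc)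

text \<open>Beyond the end the remaining list has code 0; truncated subtraction and
  \<open>prod_decode_0\<close> then make the entry 0.\<close>

lemma code_nth_eq: "code_nth c i = (if i < code_length c then list_decode c ! i else 0)"
proof -
  have "pfst (list_encode xs - 1) = (if xs = [] then 0 else hd xs)" for xs by (cases xs) auto
  then show ?thesis unfolding code_nth_def code_drop by (simp add: hd_drop_conv_nth)
qed

lemma recursive_code_nth [computability]:
  assumes "recursive f" "recursive g" shows "recursive (\<lambda>x. code_nth (f x) (g x))"
  unfolding code_nth_def by (intro computability assms)

lemma recursive_code_length [computability]: assumes "recursive f" shows "recursive (\<lambda>x. code_length (f x))"
proof -
  have "recursive (\<lambda>x. LEAST i. rec_nat (f x) (\<lambda>_ y. psnd (y - 1)) i = 0)"
  proof (rule recursive_Least)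
    show "decidable (\<lambda>z. rec_nat (f (pfst z)) (\<lambda>_ y. psnd (y - 1)) (psnd z) = 0)"
      by (intro computability recursive_comp[OF assms])
    show "\<exists>n. rec_nat (f x) (\<lambda>_ y. psnd (y - 1)) n = 0" for x
      unfolding code_drop by (rule exI[of _ "code_length (f x)"]) simp
  qed
  moreover have "(LEAST i. rec_nat c (\<lambda>_ y. psnd (y - 1)) i = 0) = code_length c" for c
  proof (rule Least_equality)
    show "rec_nat c (\<lambda>_ y. psnd (y - 1)) (code_length c) = 0" unfolding code_drop by simp
    fix i assume "rec_nat c (\<lambda>_ y. psnd (y - 1)) i = 0"
    then have "drop i (list_decode c) = []"
      unfolding code_drop by (metis list_decode.simps(1) list_encode_inverse)
    then show "code_length c \<le> i" by simp
  qed
  ultimately show ?thesis by simp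
qed

text \<open>This is how a search for a finite sequence (witnesses below a bound, a path, the history
  of a recursion) becomes a search for a number.\<close>

lemma code_of_function: "\<exists>c. code_length c = n \<and> (\<forall>i<n. code_nth c i = f i)"
  by (rule exI[of _ "list_encode (map f [0..<n])"]) (auto simp: code_nth_eq)

lemma mem_code_set: "y \<in> code_set c \<longleftrightarrow> (\<exists>i<code_length c. code_nth c i = y)"
  by (auto simp: in_set_conv_nth code_nth_eq)

section \<open>Semidecidable predicates\<close>

definition semidecidable :: "(nat \<Rightarrow> bool) \<Rightarrow> bool" where
  "semidecidable P \<longleftrightarrow> (\<exists>R. decidable R \<and> (\<forall>x. P x \<longleftrightarrow> (\<exists>s. R (prod_encode (x, s)))))"

lemma semidecidable_Ex_decidable:
  assumes R: "decidable (\<lambda>z. R (pfst z) (psnd z))"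
  shows "semidecidable (\<lambda>x. \<exists>s. R x s)"
  unfolding semidecidable_def using R by (intro exI[of _ "\<lambda>z. R (pfst z) (psnd z)"]) simp

text \<open>The witness relation is handed over together with its closure under recursive
  substitution, so that it can serve as an introduction rule at whatever terms occur later.\<close>

lemma semidecidableE:
  assumes "semidecidable P"
  obtains R where "\<And>f g. recursive f \<Longrightarrow> recursive g \<Longrightarrow> decidable (\<lambda>x. R (f x) (g x))"
    "\<And>x. P x \<longleftrightarrow> (\<exists>s. R x s)"
proof -
  obtain R where R: "decidable R" "\<And>x. P x \<longleftrightarrow> (\<exists>s. R (prod_encode (x, s)))"
    using assms unfolding semidecidable_def by blast
  have "decidable (\<lambda>x. R (prod_encode (f x, g x)))" if "recursive f" "recursive g" for f g
    by (intro decidable_comp[OF R(1)] computability that)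
  then show ?thesis using R(2) by (intro that[of "\<lambda>x s. R (prod_encode (x, s))"]) auto
qed

lemma semidecidable_decidable: assumes "decidable P" shows "semidecidable P"
proof -
  have "semidecidable (\<lambda>x. \<exists>s::nat. P x)"
    by (intro semidecidable_Ex_decidable decidable_comp[OF assms] computability)
  then show ?thesis by simp
qed

lemmas semidecidable_basic [computability] =
  semidecidable_decidable[OF decidable_const] semidecidable_decidable[OF decidable_eq]
  semidecidable_decidable[OF decidable_le] semidecidable_decidable[OF decidable_less]
  semidecidable_decidable[OF decidable_even]

lemma semidecidable_comp: "semidecidable P \<Longrightarrow> recursive f \<Longrightarrow> semidecidable (\<lambda>x. P (f x))"
  by (elim semidecidableE) (simp, intro semidecidable_Ex_decidable, blast intro: recursive_comp recursive_pfst recursive_psnd recursive_id)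

lemma semidecidable_comp2:
  assumes "semidecidable (\<lambda>z. P (pfst z) (psnd z))" "recursive f" "recursive g"
  shows "semidecidable (\<lambda>x. P (f x) (g x))"
  using semidecidable_comp[OF assms(1) recursive_prod_encode[OF assms(2,3)]] by simp

lemma semidecidable_ex [computability]:
  assumes P: "semidecidable (\<lambda>z. P (pfst z) (psnd z))" shows "semidecidable (\<lambda>x. \<exists>y. P x y)"
proof -
  obtain R where R: "\<And>f g. recursive f \<Longrightarrow> recursive g \<Longrightarrow> decidable (\<lambda>x. R (f x) (g x))"
      "\<And>z. P (pfst z) (psnd z) \<longleftrightarrow> (\<exists>s. R z s)"
    using P by (rule semidecidableE) blast
  have "P x y \<longleftrightarrow> (\<exists>s. R (prod_encode (x, y)) s)" for x y using R(2)[of "prod_encode (x, y)"] by simp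
  then have "(\<exists>y. P x y) \<longleftrightarrow> (\<exists>s. R (prod_encode (x, pfst s)) (psnd s))" for x
    by (metis fst_conv prod_encode_inverse snd_conv)
  then show ?thesis by (simp, intro semidecidable_Ex_decidable R(1) computability)
qed

lemma semidecidable_conj [computability]:
  assumes "semidecidable P" "semidecidable Q" shows "semidecidable (\<lambda>x. P x \<and> Q x)"
proof -
  obtain R where R: "\<And>f g. recursive f \<Longrightarrow> recursive g \<Longrightarrow> decidable (\<lambda>x. R (f x) (g x))"
      "\<And>z. P z \<longleftrightarrow> (\<exists>s. R z s)" using assms(1) by (rule semidecidableE) blast
  obtain S where S: "\<And>f g. recursive f \<Longrightarrow> recursive g \<Longrightarrow> decidable (\<lambda>x. S (f x) (g x))"
      "\<And>z. Q z \<longleftrightarrow> (\<exists>s. S z s)" using assms(2) by (rule semidecidableE) blast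
  have "semidecidable (\<lambda>x. \<exists>s t. R x s \<and> S x t)"
    by (intro semidecidable_ex semidecidable_decidable decidable_conj R(1) S(1) computability)
  then show ?thesis by (simp add: R(2) S(2))
qed

lemma semidecidable_disj [computability]:
  assumes "semidecidable P" "semidecidable Q" shows "semidecidable (\<lambda>x. P x \<or> Q x)"
proof -
  obtain R where R: "\<And>f g. recursive f \<Longrightarrow> recursive g \<Longrightarrow> decidable (\<lambda>x. R (f x) (g x))"
      "\<And>z. P z \<longleftrightarrow> (\<exists>s. R z s)" using assms(1) by (rule semidecidableE) blast
  obtain S where S: "\<And>f g. recursive f \<Longrightarrow> recursive g \<Longrightarrow> decidable (\<lambda>x. S (f x) (g x))"
      "\<And>z. Q z \<longleftrightarrow> (\<exists>s. S z s)" using assms(2) by (rule semidecidableE) blast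
  have "semidecidable (\<lambda>x. \<exists>s. R x s \<or> S x s)"
    by (intro semidecidable_Ex_decidable decidable_disj R(1) S(1) computability)
  then show ?thesis by (simp add: R(2) S(2) ex_disj_distrib)
qed

lemma semidecidable_all_less [computability]:
  assumes P: "semidecidable (\<lambda>z. P (pfst z) (psnd z))" and f: "recursive f"
  shows "semidecidable (\<lambda>x. \<forall>y<f x. P x y)"
proof -
  obtain R where R: "\<And>f g. recursive f \<Longrightarrow> recursive g \<Longrightarrow> decidable (\<lambda>x. R (f x) (g x))"
      "\<And>z. P (pfst z) (psnd z) \<longleftrightarrow> (\<exists>s. R z s)"
    using P by (rule semidecidableE) blast
  have "P x y \<longleftrightarrow> (\<exists>s. R (prod_encode (x, y)) s)" for x y using R(2)[of "prod_encode (x, y)"] by simp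
  then have "(\<forall>y<f x. P x y) \<longleftrightarrow> (\<exists>c. \<forall>y<f x. R (prod_encode (x, y)) (code_nth c y))" for x
    using code_of_function by (metis (full_types))
  then show ?thesis
    by (simp, intro semidecidable_Ex_decidable decidable_all_less R(1) computability recursive_comp[OF f])
qed

lemma semidecidable_ball_code [computability]:
  assumes P: "semidecidable (\<lambda>z. P (pfst z) (psnd z))" and f: "recursive f"
  shows "semidecidable (\<lambda>x. \<forall>y\<in>code_set (f x). P x y)"
proof -
  have "semidecidable (\<lambda>x. \<forall>i<code_length (f x). P x (code_nth (f x) i))"
    by (intro computability f semidecidable_comp2[OF P] recursive_comp[OF f])
  moreover have "(\<forall>y\<in>code_set c. Q y) \<longleftrightarrow> (\<forall>i<code_length c. Q (code_nth c i))" for c Q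
    by (auto simp: Ball_def mem_code_set)
  ultimately show ?thesis by simp
qed

lemma semidecidable_bex_code [computability]:
  assumes P: "semidecidable (\<lambda>z. P (pfst z) (psnd z))" and f: "recursive f"
  shows "semidecidable (\<lambda>x. \<exists>y\<in>code_set (f x). P x y)"
proof -
  have "semidecidable (\<lambda>x. \<exists>i. i < code_length (f x) \<and> P x (code_nth (f x) i))"
    by (intro computability f semidecidable_comp2[OF P] recursive_comp[OF f])
  moreover have "(\<exists>y\<in>code_set c. Q y) \<longleftrightarrow> (\<exists>i. i < code_length c \<and> Q (code_nth c i))" for c Q
    by (auto simp: Bex_def mem_code_set)
  ultimately show ?thesis by simp
qed

lemma semidecidable_mem_code [computability]:
  assumes "recursive f" "recursive g" shows "semidecidable (\<lambda>x. f x \<in> code_set (g x))"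
proof -
  have "semidecidable (\<lambda>x. \<exists>y\<in>code_set (g x). y = f x)"
    by (intro computability assms recursive_comp[OF assms(1)])
  then show ?thesis by simp
qed

lemma semidecidable_rtranclp:
  assumes R: "semidecidable (\<lambda>z. R (pfst z) (psnd z))" and "recursive f" "recursive g"
  shows "semidecidable (\<lambda>x. R\<^sup>*\<^sup>* (f x) (g x))"
proof -
  have "semidecidable (\<lambda>x. \<exists>n c. code_nth c 0 = f x \<and> code_nth c n = g x \<and>
      (\<forall>i<n. R (code_nth c i) (code_nth c (Suc i))))"
    by (intro computability semidecidable_comp2[OF R] recursive_comp[OF assms(2)] recursive_comp[OF assms(3)])
  moreover have "R\<^sup>*\<^sup>* x y \<longleftrightarrow> (\<exists>n c. code_nth c 0 = x \<and> code_nth c n = y \<and>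
      (\<forall>i<n. R (code_nth c i) (code_nth c (Suc i))))" for x y
  proof
    assume "R\<^sup>*\<^sup>* x y"
    then obtain n f where f: "f 0 = x" "f n = y" "\<forall>i<n. R (f i) (f (Suc i))"
      unfolding rtranclp_power relpowp_fun_conv by blast
    obtain c where "\<forall>i<Suc n. code_nth c i = f i" using code_of_function by blast
    then show "\<exists>n c. code_nth c 0 = x \<and> code_nth c n = y \<and> (\<forall>i<n. R (code_nth c i) (code_nth c (Suc i)))"
      using f by (intro exI[of _ n] exI[of _ c]) auto
  next
    assume "\<exists>n c. code_nth c 0 = x \<and> code_nth c n = y \<and> (\<forall>i<n. R (code_nth c i) (code_nth c (Suc i)))"
    then show "R\<^sup>*\<^sup>* x y" unfolding rtranclp_power relpowp_fun_conv by metis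
  qed
  ultimately show ?thesis by simp
qed

section \<open>Semidecidability of the evaluation relation\<close>

text \<open>The list of programs is fixed outside the computation. The quantifier over its entries
  is therefore a finite conjunction, built by adding programs at the end so that the earlier
  positions do not shift.\<close>

lemma list_all2_code:
  assumes "\<And>g. g \<in> set gs \<Longrightarrow> semidecidable (\<lambda>z. R g (pfst z) (psnd z))"
  shows "semidecidable (\<lambda>z. list_all2 (\<lambda>g y. R g (pfst z) y) gs (list_decode (psnd z)))"
proof -
  have "semidecidable (\<lambda>z. \<forall>i<length gs. R (gs ! i) (pfst z) (code_nth (psnd z) i))"
    using assms
  proof (induction gs rule: rev_induct)
    case Nil
    show ?case by (simp, intro computability)
  next
    case (snoc g gs)
    have g: "semidecidable (\<lambda>z. R g (pfst z) (psnd z))" by (rule snoc.prems) simp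
    have gs: "semidecidable (\<lambda>z. \<forall>i<length gs. R (gs ! i) (pfst z) (code_nth (psnd z) i))"
      by (rule snoc.IH) (rule snoc.prems, simp)
    have "semidecidable (\<lambda>z. (\<forall>i<length gs. R (gs ! i) (pfst z) (code_nth (psnd z) i)) \<and>
        R g (pfst z) (code_nth (psnd z) (length gs)))"
      by (rule semidecidable_conj[OF gs]) (intro computability semidecidable_comp2[OF g])
    moreover have "(\<forall>i<length (gs @ [g]). R ((gs @ [g]) ! i) x (f i)) \<longleftrightarrow>
        (\<forall>i<length gs. R (gs ! i) x (f i)) \<and> R g x (f (length gs))" for x f
      by (auto simp: less_Suc_eq nth_append)
    ultimately show ?case by simp
  qed
  then have "semidecidable (\<lambda>z. code_length (psnd z) = length gs \<and>
      (\<forall>i<length gs. R (gs ! i) (pfst z) (code_nth (psnd z) i)))"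
    by (rule semidecidable_conj[rotated]) (intro computability)
  then show ?thesis by (rule back_subst[of semidecidable]) (auto simp: fun_eq_iff list_all2_conv_all_nth code_nth_eq)
qed

text \<open>Guessing all values \<open>h\<close> of the recursion at once replaces recursion on
  \<open>n\<close> by a bounded quantifier; the next lemma codes \<open>h\<close> by a
  number.\<close>

lemma recf_eval_PrimRec_iff: "recf_eval (PrimRec f g) (n # xs) y \<longleftrightarrow>
    (\<exists>h. recf_eval f xs (h 0) \<and> h n = y \<and> (\<forall>i<n. recf_eval g (i # h i # xs) (h (Suc i))))"
proof (induction n arbitrary: y)
  case 0
  show ?case by (auto simp: recf_eval_PrimRec_0 intro: exI[of _ "\<lambda>_. y"])
next
  case (Suc n)
  show ?case
  proof
    assume "recf_eval (PrimRec f g) (Suc n # xs) y"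
    then obtain h where h: "recf_eval f xs (h 0)" "\<forall>i<n. recf_eval g (i # h i # xs) (h (Suc i))"
        "recf_eval g (n # h n # xs) y"
      unfolding recf_eval_PrimRec_Suc Suc by blast
    then show "\<exists>h. recf_eval f xs (h 0) \<and> h (Suc n) = y \<and>
        (\<forall>i<Suc n. recf_eval g (i # h i # xs) (h (Suc i)))"
      by (intro exI[of _ "\<lambda>i. if i = Suc n then y else h i"]) (auto simp: less_Suc_eq)
  next
    assume "\<exists>h. recf_eval f xs (h 0) \<and> h (Suc n) = y \<and>
        (\<forall>i<Suc n. recf_eval g (i # h i # xs) (h (Suc i)))"
    then show "recf_eval (PrimRec f g) (Suc n # xs) y"
      unfolding recf_eval_PrimRec_Suc Suc by (metis less_Suc_eq)
  qed
qed

lemma recf_eval_PrimRec_code: "recf_eval (PrimRec f g) (n # xs) y \<longleftrightarrow>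
    (\<exists>c. recf_eval f xs (code_nth c 0) \<and> code_nth c n = y \<and>
      (\<forall>i<n. recf_eval g (i # code_nth c i # xs) (code_nth c (Suc i))))" (is "_ \<longleftrightarrow> ?R")
proof
  assume "recf_eval (PrimRec f g) (n # xs) y"
  then obtain h where h: "recf_eval f xs (h 0)" "h n = y" "\<forall>i<n. recf_eval g (i # h i # xs) (h (Suc i))"
    unfolding recf_eval_PrimRec_iff by blast
  obtain c where "\<forall>i<Suc n. code_nth c i = h i" using code_of_function by blast
  then show ?R using h by (intro exI[of _ c]) auto
next
  assume ?R
  then show "recf_eval (PrimRec f g) (n # xs) y" unfolding recf_eval_PrimRec_iff by blast
qed

lemma list_decode_split: "xs = list_decode c \<Longrightarrow> c \<noteq> 0 \<Longrightarrow>
    xs = code_nth c 0 # list_decode (psnd (c - 1))"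
  by (cases c) (auto simp: code_nth_eq case_prod_beta)

text \<open>The induction is over programs, with the whole argument list given as a code:
  \<open>Comp\<close> guesses the list of intermediate values, \<open>PrimRec\<close> the history of
  the recursion, and \<open>Mu\<close> positive values at all smaller arguments. Every universal
  quantifier that arises is bounded.\<close>

lemma semidecidable_recf_eval: "semidecidable (\<lambda>z. recf_eval r (list_decode (pfst z)) (psnd z))"
proof (induction r)
  case Zero
  show ?case unfolding recf_eval_Zero by (intro computability)
next
  case Succ
  have "semidecidable (\<lambda>z. 0 < code_length (pfst z) \<and> psnd z = Suc (code_nth (pfst z) 0))"
    by (intro computability)
  then show ?case
    by (rule back_subst[of semidecidable])
       (auto simp: fun_eq_iff recf_eval_Succ code_nth_eq length_Suc_conv gr0_conv_Suc)
next
  case (Proj i)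
  have "semidecidable (\<lambda>z. i < code_length (pfst z) \<and> psnd z = code_nth (pfst z) i)"
    by (intro computability)
  then show ?case
    by (rule back_subst[of semidecidable]) (auto simp: fun_eq_iff recf_eval_Proj code_nth_eq)
next
  case (Comp f gs)
  have gs: "semidecidable (\<lambda>z. list_all2 (\<lambda>g y. recf_eval g (list_decode (pfst z)) y) gs (list_decode (psnd z)))"
    by (rule list_all2_code) (rule Comp.IH(2))
  have "semidecidable (\<lambda>z. \<exists>c. list_all2 (\<lambda>g y. recf_eval g (list_decode (pfst z)) y) gs (list_decode c) \<and>
      recf_eval f (list_decode c) (psnd z))"
    by (intro computability semidecidable_comp2[OF gs] semidecidable_comp2[OF Comp.IH(1)])
  then show ?case unfolding recf_eval_Comp
    by (rule back_subst[of semidecidable]) (metis list_encode_inverse)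
next
  case (PrimRec f g)
  \<comment> \<open>\<open>Suc (prod_encode (a, c))\<close> is the code of the list with head
    \<open>a\<close> and tail coded by \<open>c\<close>, and \<open>psnd (pfst z - 1)\<close> is the
    code of the parameters after the recursion variable.\<close>
  have "semidecidable (\<lambda>z. pfst z \<noteq> 0 \<and> (\<exists>c. recf_eval f (list_decode (psnd (pfst z - 1))) (code_nth c 0) \<and>
      code_nth c (code_nth (pfst z) 0) = psnd z \<and>
      (\<forall>i<code_nth (pfst z) 0. recf_eval g (list_decode
        (Suc (prod_encode (i, Suc (prod_encode (code_nth c i, psnd (pfst z - 1))))))) (code_nth c (Suc i)))))"
    by (intro computability semidecidable_comp2[OF PrimRec(1)] semidecidable_comp2[OF PrimRec(2)]
        semidecidable_decidable[OF decidable_not])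
  then show ?case
  proof (rule back_subst[of semidecidable], intro ext)
    fix z
    show "(pfst z \<noteq> 0 \<and> (\<exists>c. recf_eval f (list_decode (psnd (pfst z - 1))) (code_nth c 0) \<and>
      code_nth c (code_nth (pfst z) 0) = psnd z \<and>
      (\<forall>i<code_nth (pfst z) 0. recf_eval g (list_decode
        (Suc (prod_encode (i, Suc (prod_encode (code_nth c i, psnd (pfst z - 1))))))) (code_nth c (Suc i)))))
      = recf_eval (PrimRec f g) (list_decode (pfst z)) (psnd z)"
    proof (cases "pfst z = 0")
      case True
      then show ?thesis by (simp add: recf_eval_PrimRec_Nil)
    next
      case False
      show ?thesis using False
        by (subst list_decode_split[OF refl False], subst recf_eval_PrimRec_code) simp
    qed
  qed
next
  case (Mu f)
  have "semidecidable (\<lambda>z. recf_eval f (list_decode (Suc (prod_encode (psnd z, pfst z)))) 0 \<and>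
      (\<forall>m<psnd z. \<exists>y. recf_eval f (list_decode (Suc (prod_encode (m, pfst z)))) (Suc y)))"
    by (intro computability semidecidable_comp2[OF Mu])
  then show ?case unfolding recf_eval_Mu by simp
qed

text \<open>Kleene's normal form, proved by induction on programs instead of through a universal one.\<close>

theorem ce_iff_semidecidable: "ce A \<longleftrightarrow> semidecidable (\<lambda>n. n \<in> A)"
proof
  assume "ce A"
  then obtain r where A: "A = {n. \<exists>y. recf_eval r [n] y}" unfolding ce_def by blast
  have "semidecidable (\<lambda>n. \<exists>y. recf_eval r (list_decode (Suc (prod_encode (n, 0)))) y)"
    by (intro computability semidecidable_comp2[OF semidecidable_recf_eval])
  then show "semidecidable (\<lambda>n. n \<in> A)" by (simp add: A)
next
  assume "semidecidable (\<lambda>n. n \<in> A)"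
  then obtain R where R: "decidable R" "\<And>n. n \<in> A \<longleftrightarrow> (\<exists>s. R (prod_encode (n, s)))"
    unfolding semidecidable_def by blast
  obtain p where p: "\<And>x y z. recf_eval p [x, y] z \<longleftrightarrow> z = prod_encode (x, y)"
    using recursive2_prod_encode unfolding recursive2_def by blast
  obtain r where r: "\<And>x y. recf_eval r [x] y \<longleftrightarrow> y = (if R x then 0 else 1)"
    using R(1) unfolding decidable_def recursive_def by blast
  \<comment> \<open>\<open>Mu\<close> puts the search variable in front of the input, hence the
    exchanged projections.\<close>
  have q: "recf_eval (Comp r [Comp p [Proj 1, Proj 0]]) [s, n] y \<longleftrightarrow>
      y = (if R (prod_encode (n, s)) then 0 else 1)" for n s y
    by (auto simp: recf_eval_basic p r)
  have "(\<exists>y. recf_eval (Mu (Comp r [Comp p [Proj 1, Proj 0]])) [n] y) \<longleftrightarrow> (\<exists>s. R (prod_encode (n, s)))" for n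
  proof
    assume "\<exists>s. R (prod_encode (n, s))"
    then have "recf_eval (Mu (Comp r [Comp p [Proj 1, Proj 0]])) [n] (LEAST s. R (prod_encode (n, s)))"
      unfolding recf_eval_Mu q by (auto dest: not_less_Least intro: LeastI_ex)
    then show "\<exists>y. recf_eval (Mu (Comp r [Comp p [Proj 1, Proj 0]])) [n] y" ..
  next
    assume "\<exists>y. recf_eval (Mu (Comp r [Comp p [Proj 1, Proj 0]])) [n] y"
    then obtain s where "0 = (if R (prod_encode (n, s)) then 0 else 1::nat)"
      unfolding recf_eval_Mu q by blast
    then show "\<exists>s. R (prod_encode (n, s))" by (auto split: if_splits)
  qed
  then show "ce A" unfolding ce_def using R(2) by blast
qed

section \<open>Computable enumeration and choice\<close>

lemma semidecidable_enumeration: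
  assumes P: "semidecidable P" and a: "P a"
  obtains f where "recursive f" "range f = {x. P x}"
proof -
  obtain R where R: "\<And>f g. recursive f \<Longrightarrow> recursive g \<Longrightarrow> decidable (\<lambda>x. R (f x) (g x))"
      "\<And>x. P x \<longleftrightarrow> (\<exists>s. R x s)" using P by (rule semidecidableE) blast
  \<comment> \<open>The given element \<open>a\<close> is the output at the stages where no witness
    is confirmed; it keeps \<open>f\<close> total.\<close>
  define f where "f = (\<lambda>z. if R (pfst z) (psnd z) then pfst z else a)"
  have "recursive f" unfolding f_def by (intro computability R(1))
  moreover have "range f = {x. P x}"
  proof (intro Set.set_eqI iffI)
    fix x assume "x \<in> {x. P x}"
    then obtain s where "R x s" using R(2) by blast
    then have "f (prod_encode (x, s)) = x" by (simp add: f_def)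
    then show "x \<in> range f" by (metis rangeI)
  qed (auto simp: f_def R(2) a[unfolded R(2)])
  ultimately show ?thesis by (rule that)
qed

text \<open>The search is for a value together with a witness that the value is correct; such pairs
  can be tested, while the value alone cannot.\<close>

lemma semidecidable_uniformization:
  assumes P: "semidecidable (\<lambda>z. P (pfst z) (psnd z))" and ex: "\<And>x. \<exists>y. P x y"
  obtains f where "recursive f" "\<And>x. P x (f x)"
proof -
  obtain R where R: "\<And>f g. recursive f \<Longrightarrow> recursive g \<Longrightarrow> decidable (\<lambda>x. R (f x) (g x))"
      "\<And>z. P (pfst z) (psnd z) \<longleftrightarrow> (\<exists>s. R z s)" using P by (rule semidecidableE) blast
  have R': "P x y \<longleftrightarrow> (\<exists>s. R (prod_encode (x, y)) s)" for x y using R(2)[of "prod_encode (x, y)"] by simp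
  let ?Q = "\<lambda>x n. R (prod_encode (x, pfst n)) (psnd n)"
  have exQ: "\<exists>n. ?Q x n" for x
  proof -
    obtain y s where "R (prod_encode (x, y)) s" using ex R' by blast
    then show ?thesis by (intro exI[of _ "prod_encode (y, s)"]) simp
  qed
  define f where "f = (\<lambda>x. pfst (LEAST n. ?Q x n))"
  have "recursive f" unfolding f_def
    by (intro recursive_pfst recursive_Least R(1) computability exQ)
  moreover have "P x (f x)" for x
    unfolding R' f_def using LeastI_ex[OF exQ[of x]] by blast
  ultimately show ?thesis by (rule that)
qed

text \<open>The relation is moved from \<open>S\<close> to the indices of an enumeration of
  \<open>S\<close>, where every index has a successor and uniformization applies. The sequences from
  all starting points are kept, uniformly in \<open>n\<close>: the dense points are indexed by them,
  while the two scales select a single one.\<close>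

lemma semidecidable_dependent_choice:
  assumes S: "semidecidable S" "S a" and R: "semidecidable (\<lambda>z. R (pfst z) (psnd z))"
    and ex: "\<And>x. S x \<Longrightarrow> \<exists>y. S y \<and> R x y"
  obtains F where "recursive (\<lambda>z. F (pfst z) (psnd z))" "\<And>n t. S (F n t)"
    "\<And>n t. R (F n t) (F n (Suc t))" "\<And>x. S x \<Longrightarrow> \<exists>n. F n 0 = x"
proof -
  obtain \<nu> where \<nu>: "recursive \<nu>" "range \<nu> = {x. S x}"
    using semidecidable_enumeration[OF S] .
  then have S\<nu>: "S (\<nu> n)" for n by blast
  obtain f where f: "recursive f" "\<And>n. R (\<nu> n) (\<nu> (f n))"
  proof (rule semidecidable_uniformization)
    show "semidecidable (\<lambda>z. R (\<nu> (pfst z)) (\<nu> (psnd z)))"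
      by (intro semidecidable_comp2[OF R] recursive_comp[OF \<nu>(1)] computability)
    show "\<exists>y. R (\<nu> x) (\<nu> y)" for x using ex[OF S\<nu>] \<nu>(2) by (metis (mono_tags, lifting) imageE mem_Collect_eq)
  qed blast
  define F where "F n t = \<nu> (rec_nat n (\<lambda>_. f) t)" for n t
  have "recursive (\<lambda>z. F (pfst z) (psnd z))" unfolding F_def
    by (intro recursive_comp[OF \<nu>(1)] computability recursive_comp[OF f(1)])
  moreover have "R (F n t) (F n (Suc t))" for n t using f(2) by (simp add: F_def)
  moreover have "\<exists>n. F n 0 = x" if "S x" for x
  proof -
    have "x \<in> range \<nu>" using that \<nu>(2) by simp
    then show ?thesis unfolding F_def by auto
  qed
  ultimately show ?thesis using S\<nu> by (intro that[of F]) (auto simp: F_def)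
qed

section \<open>Effective families in a computable group\<close>

text \<open>The prefix is guessed as a code and then compared with \<open>p\<close>, so that
  \<open>p\<close> occurs only below a bounded quantifier.\<close>

lemma listed_code: "n \<in> listed \<Phi> p \<longleftrightarrow>
    (\<exists>c. (\<forall>l<code_length c. code_nth c l = p l) \<and> prod_encode (c, n) \<in> \<Phi>)"
proof
  assume "n \<in> listed \<Phi> p"
  then obtain k where "prod_encode (list_encode (map p [0..<k]), n) \<in> \<Phi>" unfolding listed_def by blast
  then show "\<exists>c. (\<forall>l<code_length c. code_nth c l = p l) \<and> prod_encode (c, n) \<in> \<Phi>"
    by (intro exI[of _ "list_encode (map p [0..<k])"]) (auto simp: code_nth_eq)
next
  assume "\<exists>c. (\<forall>l<code_length c. code_nth c l = p l) \<and> prod_encode (c, n) \<in> \<Phi>"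
  then obtain c where c: "\<forall>l<code_length c. code_nth c l = p l" "prod_encode (c, n) \<in> \<Phi>" by blast
  have "list_decode c = map p [0..<code_length c]"
    by (rule nth_equalityI) (use c in \<open>auto simp: code_nth_eq\<close>)
  then have "c = list_encode (map p [0..<code_length c])" by (metis list_decode_inverse)
  then show "n \<in> listed \<Phi> p" using c(2) unfolding listed_def mem_Collect_eq by metis
qed

lemma semidecidable_listed:
  assumes "ce \<Phi>" "recursive (\<lambda>z. p (pfst z) (psnd z))" and f: "recursive f" and g: "recursive g"
  shows "semidecidable (\<lambda>x. g x \<in> listed \<Phi> (p (f x)))"
proof -
  have p: "recursive (\<lambda>x. p (u x) (v x))" if "recursive u" "recursive v" for u v
    using recursive_comp[OF assms(2) recursive_prod_encode[OF that]] by simp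
  show ?thesis unfolding listed_code
    by (intro computability p recursive_comp[OF f] recursive_comp[OF g]
        semidecidable_comp[OF assms(1)[unfolded ce_iff_semidecidable]])
qed

text \<open>The operator is run on the constant enumeration of the one-element name of a basic set.
  Preimages of arbitrary open sets are unions of the resulting sets, so a c.e. relation between base
  indices can take the place of the operator from here on.\<close>

lemma effectively_continuous_relation:
  assumes f: "effectively_continuous X C Y D f" and D: "\<And>i. openin Y (D i)"
  obtains R where "\<And>f g. recursive f \<Longrightarrow> recursive g \<Longrightarrow> semidecidable (\<lambda>x. R (f x) (g x))"
    "\<And>i x. x \<in> topspace X \<Longrightarrow> f x \<in> D i \<longleftrightarrow> (\<exists>k. R i k \<and> x \<in> C k)"
proof -
  obtain \<Phi> where \<Phi>: "ce \<Phi>" "\<And>U S p. openin Y U \<Longrightarrow> open_name D U S \<Longrightarrow> enumerates p S \<Longrightarrow>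
      open_name C {x \<in> topspace X. f x \<in> U} (listed \<Phi> p)"
    using f unfolding effectively_continuous_def by blast
  have "open_name D (D i) {i}" "enumerates (\<lambda>_. Suc i) {i}" for i
    by (auto simp: open_name_def enumerates_def)
  then have "open_name C {x \<in> topspace X. f x \<in> D i} (listed \<Phi> (\<lambda>_. Suc i))" for i
    using \<Phi>(2) D by blast
  then have *: "{x \<in> topspace X. f x \<in> D i} = \<Union> (C ` listed \<Phi> (\<lambda>_. Suc i))" for i
    unfolding open_name_def .
  show ?thesis
  proof (rule that[of "\<lambda>i k. k \<in> listed \<Phi> (\<lambda>_. Suc i)"])
    show "semidecidable (\<lambda>x. g x \<in> listed \<Phi> (\<lambda>_. Suc (f x)))" if "recursive f" "recursive g" for f g
      by (rule semidecidable_listed[OF \<Phi>(1) _ that]) (intro computability)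
    show "f x \<in> D i \<longleftrightarrow> (\<exists>k. k \<in> listed \<Phi> (\<lambda>_. Suc i) \<and> x \<in> C k)" if "x \<in> topspace X" for x i
      using *[of i] that by blast
  qed
qed

lemma (in group) quotient_mult:
  assumes "x \<in> carrier G" "y \<in> carrier G" "z \<in> carrier G"
  shows "(inv x \<otimes> y) \<otimes> (inv y \<otimes> z) = inv x \<otimes> z"
  using assms by (metis inv_closed inv_solve_left m_assoc m_closed)

section \<open>Computable groups and the relations between base indices\<close>

locale computable_group = group G for G (structure) +
  fixes T :: "'a topology" and B :: "nat \<Rightarrow> 'a set"
  assumes computable_group: "computable_topological_group G T B"
begin

lemma topspace_carrier [simp]: "topspace T = carrier G"
  using computable_group unfolding computable_topological_group_def by blast

lemma Hausdorff: "Hausdorff_space T"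
  and openin_base: "openin T (B i)"
  and base_nonempty: "B i \<noteq> {}"
  and base_refine: "openin T U \<Longrightarrow> x \<in> U \<Longrightarrow> \<exists>i. x \<in> B i \<and> B i \<subseteq> U"
  using computable_group unfolding computable_topological_group_def computable_space_def by blast+

lemma base_carrier: "x \<in> B i \<Longrightarrow> x \<in> carrier G"
  using openin_subset[OF openin_base] by auto

lemma inter_relation:
  obtains W where "\<And>f g h. recursive f \<Longrightarrow> recursive g \<Longrightarrow> recursive h \<Longrightarrow> semidecidable (\<lambda>x. W (f x) (g x) (h x))"
    "\<And>i j x. x \<in> B i \<Longrightarrow> x \<in> B j \<Longrightarrow> \<exists>k. W i j k \<and> x \<in> B k"
    "\<And>i j k x. W i j k \<Longrightarrow> x \<in> B k \<Longrightarrow> x \<in> B i \<and> x \<in> B j"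
proof -
  obtain W where W: "ce W" "\<And>i j. B i \<inter> B j = \<Union> (B ` {k. prod_encode (i, prod_encode (j, k)) \<in> W})"
    using computable_group unfolding computable_topological_group_def computable_space_def by blast
  show ?thesis
  proof (rule that[of "\<lambda>i j k. prod_encode (i, prod_encode (j, k)) \<in> W"])
    show "semidecidable (\<lambda>x. prod_encode (f x, prod_encode (g x, h x)) \<in> W)"
      if "recursive f" "recursive g" "recursive h" for f g h
      by (intro semidecidable_comp[OF W(1)[unfolded ce_iff_semidecidable]] computability that)
  qed (use W(2) in blast)+
qed

text \<open>\<open>M i a b\<close> guarantees that every product of a point of \<open>B a\<close>
  and a point of \<open>B b\<close> lies in \<open>B i\<close>, and these rectangles exhaust the
  preimage of \<open>B i\<close>.\<close>

lemma mult_relation: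
  obtains M where "\<And>f g h. recursive f \<Longrightarrow> recursive g \<Longrightarrow> recursive h \<Longrightarrow> semidecidable (\<lambda>x. M (f x) (g x) (h x))"
    "\<And>i x y. x \<in> carrier G \<Longrightarrow> y \<in> carrier G \<Longrightarrow> x \<otimes> y \<in> B i \<longleftrightarrow> (\<exists>a b. M i a b \<and> x \<in> B a \<and> y \<in> B b)"
proof -
  have "effectively_continuous (prod_topology T T) (prod_base B B) T B (\<lambda>(x, y). x \<otimes> y)"
    using computable_group unfolding computable_topological_group_def by blast
  then obtain R where R: "\<And>f g. recursive f \<Longrightarrow> recursive g \<Longrightarrow> semidecidable (\<lambda>x. R (f x) (g x))"
      "\<And>i z. z \<in> topspace (prod_topology T T) \<Longrightarrow>
        (case z of (x, y) \<Rightarrow> x \<otimes> y) \<in> B i \<longleftrightarrow> (\<exists>k. R i k \<and> z \<in> prod_base B B k)"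
    by (rule effectively_continuous_relation[OF _ openin_base]) blast
  show ?thesis
  proof (rule that[of "\<lambda>i a b. R i (prod_encode (a, b))"])
    fix f g h :: "nat \<Rightarrow> nat" assume "recursive f" "recursive g" "recursive h"
    then show "semidecidable (\<lambda>x. R (f x) (prod_encode (g x, h x)))" by (intro R(1) computability)
  next
    fix i x y assume xy: "x \<in> carrier G" "y \<in> carrier G"
    have "(\<exists>k. R i k \<and> (x, y) \<in> prod_base B B k) \<longleftrightarrow> (\<exists>a b. R i (prod_encode (a, b)) \<and> x \<in> B a \<and> y \<in> B b)"
    proof
      assume "\<exists>k. R i k \<and> (x, y) \<in> prod_base B B k"
      then obtain k where k: "R i k" "(x, y) \<in> prod_base B B k" by blast
      obtain a b where "prod_decode k = (a, b)" by fastforce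
      moreover from this have "k = prod_encode (a, b)" by (metis prod_decode_inverse)
      ultimately show "\<exists>a b. R i (prod_encode (a, b)) \<and> x \<in> B a \<and> y \<in> B b"
        using k by (auto simp: prod_base_def)
    next
      assume "\<exists>a b. R i (prod_encode (a, b)) \<and> x \<in> B a \<and> y \<in> B b"
      then show "\<exists>k. R i k \<and> (x, y) \<in> prod_base B B k"
        by (metis (no_types, lifting) case_prod_conv mem_Sigma_iff prod_base_def prod_encode_inverse)
    qed
    then show "x \<otimes> y \<in> B i \<longleftrightarrow> (\<exists>a b. R i (prod_encode (a, b)) \<and> x \<in> B a \<and> y \<in> B b)"
      using R(2)[of "(x, y)" i] xy by simp
  qed
qed

lemma inv_relation:
  obtains R where "\<And>f g. recursive f \<Longrightarrow> recursive g \<Longrightarrow> semidecidable (\<lambda>x. R (f x) (g x))"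
    "\<And>i x. x \<in> carrier G \<Longrightarrow> inv x \<in> B i \<longleftrightarrow> (\<exists>k. R i k \<and> x \<in> B k)"
proof -
  have "effectively_continuous T B T B (\<lambda>x. inv x)"
    using computable_group unfolding computable_topological_group_def by blast
  then show ?thesis
    by (rule effectively_continuous_relation[OF _ openin_base]) (rule that, simp_all)
qed

section \<open>Topological consequences of effective continuity\<close>

lemma open_union_base: "openin T U \<Longrightarrow> U = \<Union> (B ` {i. B i \<subseteq> U})"
  using base_refine by blast

lemma continuous_map_base:
  assumes "\<And>x. x \<in> topspace X \<Longrightarrow> f x \<in> carrier G" "\<And>i. openin X {x \<in> topspace X. f x \<in> B i}"
  shows "continuous_map X T f"
  unfolding continuous_map
proof (intro conjI allI impI)
  show "f ` topspace X \<subseteq> topspace T" using assms(1) by auto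
  fix U assume U: "openin T U"
  have "{x \<in> topspace X. f x \<in> U} = (\<Union>i\<in>{i. B i \<subseteq> U}. {x \<in> topspace X. f x \<in> B i})"
    using open_union_base[OF U] by blast
  then show "openin X {x \<in> topspace X. f x \<in> U}" using assms(2) by (auto intro!: openin_Union)
qed

lemma continuous_mult: "continuous_map (prod_topology T T) T (\<lambda>(x, y). x \<otimes> y)"
proof (rule continuous_map_base)
  fix i
  obtain M where M: "\<And>i x y. x \<in> carrier G \<Longrightarrow> y \<in> carrier G \<Longrightarrow>
      x \<otimes> y \<in> B i \<longleftrightarrow> (\<exists>a b. M i a b \<and> x \<in> B a \<and> y \<in> B b)"
    by (rule mult_relation) (rule that)
  have "{z \<in> topspace (prod_topology T T). (case z of (x, y) \<Rightarrow> x \<otimes> y) \<in> B i} =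
      (\<Union>(a, b)\<in>{(a, b). M i a b}. B a \<times> B b)"
    (is "?L = ?R")
  proof (rule Set.set_eqI)
    fix z show "z \<in> ?L \<longleftrightarrow> z \<in> ?R"
      by (cases "fst z \<in> carrier G \<and> snd z \<in> carrier G") (auto simp: M dest: base_carrier, blast)
  qed
  then show "openin (prod_topology T T) {z \<in> topspace (prod_topology T T). (case z of (x, y) \<Rightarrow> x \<otimes> y) \<in> B i}"
    by (auto intro!: openin_Union simp: openin_prod_Times_iff openin_base)
qed auto

lemma continuous_inv: "continuous_map T T (\<lambda>x. inv x)"
proof (rule continuous_map_base)
  fix i
  obtain R where R: "\<And>i x. x \<in> carrier G \<Longrightarrow> inv x \<in> B i \<longleftrightarrow> (\<exists>k. R i k \<and> x \<in> B k)"
    by (rule inv_relation) (rule that)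
  have "{x \<in> topspace T. inv x \<in> B i} = (\<Union>k\<in>{k. R i k}. B k)" (is "?L = ?R")
  proof (rule Set.set_eqI)
    fix x show "x \<in> ?L \<longleftrightarrow> x \<in> ?R"
      by (cases "x \<in> carrier G") (auto simp: R dest: base_carrier)
  qed
  then show "openin T {x \<in> topspace T. inv x \<in> B i}" by (auto intro!: openin_Union openin_base)
qed auto

lemma continuous_mult_maps:
  assumes "continuous_map X T f" "continuous_map X T g"
  shows "continuous_map X T (\<lambda>x. f x \<otimes> g x)"
proof -
  have "continuous_map X (prod_topology T T) (\<lambda>x. (f x, g x))"
    using assms by (simp add: continuous_map_paired)
  from continuous_map_compose[OF this continuous_mult] show ?thesis by (simp add: o_def)
qed

lemma continuous_left: "x \<in> carrier G \<Longrightarrow> continuous_map T T (\<lambda>y. x \<otimes> y)"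
  and continuous_right: "x \<in> carrier G \<Longrightarrow> continuous_map T T (\<lambda>y. y \<otimes> x)"
  by (auto intro!: continuous_mult_maps)

lemma openin_left: "x \<in> carrier G \<Longrightarrow> openin T U \<Longrightarrow> openin T {y \<in> carrier G. x \<otimes> y \<in> U}"
  and openin_right: "x \<in> carrier G \<Longrightarrow> openin T U \<Longrightarrow> openin T {y \<in> carrier G. y \<otimes> x \<in> U}"
  and openin_inv: "openin T U \<Longrightarrow> openin T {y \<in> carrier G. inv y \<in> U}"
  using openin_continuous_map_preimage[OF continuous_left] openin_continuous_map_preimage[OF continuous_right]
    openin_continuous_map_preimage[OF continuous_inv] by auto

lemma neighbourhood_square:
  assumes U: "openin T U" "\<one> \<in> U"
  obtains N where "openin T N" "\<one> \<in> N" "\<And>x y. x \<in> N \<Longrightarrow> y \<in> N \<Longrightarrow> x \<otimes> y \<in> U"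
proof -
  define S where "S = {z \<in> topspace (prod_topology T T). (case z of (x, y) \<Rightarrow> x \<otimes> y) \<in> U}"
  have "openin (prod_topology T T) S" unfolding S_def
    by (rule openin_continuous_map_preimage[OF continuous_mult U(1)])
  moreover have "(\<one>, \<one>) \<in> S" using U by (auto simp: S_def)
  ultimately have "\<exists>N1 N2. openin T N1 \<and> openin T N2 \<and> \<one> \<in> N1 \<and> \<one> \<in> N2 \<and> N1 \<times> N2 \<subseteq> S"
    by (rule openin_prod_topology_alt[THEN iffD1, THEN spec, THEN spec, THEN mp])
  then obtain N1 N2 where "openin T N1" "openin T N2" "\<one> \<in> N1" "\<one> \<in> N2" "N1 \<times> N2 \<subseteq> S"
    by (elim exE conjE)
  moreover have "x \<otimes> y \<in> U" if "(x, y) \<in> S" for x y using that by (simp add: S_def)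
  ultimately show ?thesis by (intro that[of "N1 \<inter> N2"]) auto
qed

lemma neighbourhood_cube:
  assumes U: "openin T U" "\<one> \<in> U"
  obtains N where "openin T N" "\<one> \<in> N" "\<And>x. x \<in> N \<Longrightarrow> inv x \<in> N"
    "\<And>x y z. x \<in> N \<Longrightarrow> y \<in> N \<Longrightarrow> z \<in> N \<Longrightarrow> x \<otimes> y \<otimes> z \<in> U"
proof -
  obtain N1 where N1: "openin T N1" "\<one> \<in> N1" "\<And>x y. x \<in> N1 \<Longrightarrow> y \<in> N1 \<Longrightarrow> x \<otimes> y \<in> U"
    using neighbourhood_square[OF U] by blast
  obtain N2 where N2: "openin T N2" "\<one> \<in> N2" "\<And>x y. x \<in> N2 \<Longrightarrow> y \<in> N2 \<Longrightarrow> x \<otimes> y \<in> N1"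
    using neighbourhood_square[OF N1(1,2)] by blast
  define N where "N = (N1 \<inter> N2) \<inter> {y \<in> carrier G. inv y \<in> N1 \<inter> N2}"
  have "openin T N" unfolding N_def using N1(1) N2(1) by (intro openin_Int openin_inv)
  moreover have "\<one> \<in> N" unfolding N_def using N1(2) N2(2) by auto
  moreover have "\<And>x. x \<in> N \<Longrightarrow> inv x \<in> N" "\<And>x y z. x \<in> N \<Longrightarrow> y \<in> N \<Longrightarrow> z \<in> N \<Longrightarrow> x \<otimes> y \<otimes> z \<in> U"
    unfolding N_def using N1(3) N2(3) by auto
  ultimately show ?thesis by (rule that)
qed

lemma compact_subcover:
  assumes K: "compactin T K" "K \<subseteq> (\<Union>i\<in>I. U i)" and U: "\<And>i. i \<in> I \<Longrightarrow> openin T (U i)"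
  obtains c where "code_set c \<subseteq> I" "K \<subseteq> (\<Union>i\<in>code_set c. U i)"
proof -
  have "\<exists>\<F>. finite \<F> \<and> \<F> \<subseteq> U ` I \<and> K \<subseteq> \<Union> \<F>"
    by (rule compactinD[OF K(1) _ K(2)]) (use U in auto)
  then obtain \<F> where "finite \<F>" "\<F> \<subseteq> U ` I" "K \<subseteq> \<Union> \<F>" by blast
  then obtain J where J: "finite J" "J \<subseteq> I" "\<F> = U ` J" by (meson finite_subset_image)
  obtain xs where "set xs = J" using finite_list[OF J(1)] by blast
  then show ?thesis using J \<open>K \<subseteq> \<Union> \<F>\<close> by (intro that[of "list_encode xs"]) auto
qed

section \<open>Uniformly c.e. open sets, computable points and effectively compact sets\<close>

text \<open>Families rather than single sets, because each construction below searches over indices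
  and needs its tests to be uniform in them.\<close>

definition open_family :: "(nat \<Rightarrow> 'a set) \<Rightarrow> bool" where
  "open_family U \<longleftrightarrow> (\<exists>R. semidecidable (\<lambda>z. R (pfst z) (psnd z)) \<and> (\<forall>n. U n = (\<Union>i\<in>{i. R n i}. B i)))"

definition point_family :: "(nat \<Rightarrow> 'a) \<Rightarrow> bool" where
  "point_family x \<longleftrightarrow> range x \<subseteq> carrier G \<and> semidecidable (\<lambda>z. x (pfst z) \<in> B (psnd z))"

definition compact_family :: "(nat \<Rightarrow> 'a set) \<Rightarrow> bool" where
  "compact_family K \<longleftrightarrow> (\<forall>n. compactin T (K n)) \<and>
    semidecidable (\<lambda>z. K (pfst z) \<subseteq> (\<Union>i\<in>code_set (psnd z). B i))"

lemma open_familyI: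
  assumes "semidecidable (\<lambda>z. R (pfst z) (psnd z))" "\<And>n x. x \<in> U n \<longleftrightarrow> (\<exists>i. R n i \<and> x \<in> B i)"
  shows "open_family U"
proof -
  have "\<forall>n. U n = (\<Union>i\<in>{i. R n i}. B i)" using assms(2) by auto
  then show ?thesis unfolding open_family_def using assms(1) by blast
qed

lemma open_familyE:
  assumes "open_family U"
  obtains R where "\<And>f g. recursive f \<Longrightarrow> recursive g \<Longrightarrow> semidecidable (\<lambda>x. R (f x) (g x))"
    "\<And>n x. x \<in> U n \<longleftrightarrow> (\<exists>i. R n i \<and> x \<in> B i)"
proof -
  obtain R where R: "semidecidable (\<lambda>z. R (pfst z) (psnd z))" "\<forall>n. U n = (\<Union>i\<in>{i. R n i}. B i)"
    using assms unfolding open_family_def by blast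
  show ?thesis
  proof (rule that[of R])
    show "semidecidable (\<lambda>x. R (f x) (g x))" if "recursive f" "recursive g" for f g
      by (rule semidecidable_comp2[OF R(1) that])
  qed (use R(2) in auto)
qed

lemma openin_open_family: "open_family U \<Longrightarrow> openin T (U n)"
  unfolding open_family_def using openin_base by (auto intro!: openin_Union)

lemma open_family_carrier: "open_family U \<Longrightarrow> x \<in> U n \<Longrightarrow> x \<in> carrier G"
  using openin_subset[OF openin_open_family] by fastforce

lemma open_family_base [computability]: assumes "recursive f" shows "open_family (\<lambda>n. B (f n))"
  by (rule open_familyI[where R="\<lambda>n i. i = f n"]) (auto intro!: computability recursive_comp[OF assms])

lemma open_family_comp: assumes "open_family U" "recursive f" shows "open_family (\<lambda>n. U (f n))"
  using assms(1)
proof (rule open_familyE)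
  fix R assume R: "\<And>f g. recursive f \<Longrightarrow> recursive g \<Longrightarrow> semidecidable (\<lambda>x. R (f x) (g x))"
      "\<And>n x. x \<in> U n \<longleftrightarrow> (\<exists>i. R n i \<and> x \<in> B i)"
  show ?thesis by (rule open_familyI[OF _ R(2)]) (intro R(1) computability recursive_comp[OF assms(2)])
qed

lemma open_family_Int [computability]:
  assumes "open_family U" "open_family V" shows "open_family (\<lambda>n. U n \<inter> V n)"
proof -
  obtain R where R: "\<And>f g. recursive f \<Longrightarrow> recursive g \<Longrightarrow> semidecidable (\<lambda>x. R (f x) (g x))"
      "\<And>n x. x \<in> U n \<longleftrightarrow> (\<exists>i. R n i \<and> x \<in> B i)" using assms(1) by (rule open_familyE) (rule that)
  obtain S where S: "\<And>f g. recursive f \<Longrightarrow> recursive g \<Longrightarrow> semidecidable (\<lambda>x. S (f x) (g x))"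
      "\<And>n x. x \<in> V n \<longleftrightarrow> (\<exists>i. S n i \<and> x \<in> B i)" using assms(2) by (rule open_familyE) (rule that)
  obtain W where W: "\<And>f g h. recursive f \<Longrightarrow> recursive g \<Longrightarrow> recursive h \<Longrightarrow> semidecidable (\<lambda>x. W (f x) (g x) (h x))"
    "\<And>i j x. x \<in> B i \<Longrightarrow> x \<in> B j \<Longrightarrow> \<exists>k. W i j k \<and> x \<in> B k"
    "\<And>i j k x. W i j k \<Longrightarrow> x \<in> B k \<Longrightarrow> x \<in> B i \<and> x \<in> B j" by (rule inter_relation) (rule that)
  show ?thesis
  proof (rule open_familyI[where R="\<lambda>n k. \<exists>i j. R n i \<and> S n j \<and> W i j k"])
    show "semidecidable (\<lambda>z. \<exists>i j. R (pfst z) i \<and> S (pfst z) j \<and> W i j (psnd z))"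
      by (intro computability R(1) S(1) W(1))
    show "x \<in> U n \<inter> V n \<longleftrightarrow> (\<exists>k. (\<exists>i j. R n i \<and> S n j \<and> W i j k) \<and> x \<in> B k)" for n x
      using W(2,3) by (auto simp: R(2) S(2)) metis+
  qed
qed

lemma open_family_UN [computability]:
  assumes "open_family (\<lambda>z. U (pfst z) (psnd z))" "semidecidable (\<lambda>z. P (pfst z) (psnd z))"
  shows "open_family (\<lambda>n. \<Union>y\<in>{y. P n y}. U n y)"
proof -
  obtain R where R: "\<And>f g. recursive f \<Longrightarrow> recursive g \<Longrightarrow> semidecidable (\<lambda>x. R (f x) (g x))"
      "\<And>n x. x \<in> U (pfst n) (psnd n) \<longleftrightarrow> (\<exists>i. R n i \<and> x \<in> B i)"
    using assms(1) by (rule open_familyE) (rule that)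
  have R2: "x \<in> U n m \<longleftrightarrow> (\<exists>i. R (prod_encode (n, m)) i \<and> x \<in> B i)" for x n m
    using R(2)[of x "prod_encode (n, m)"] by simp
  show ?thesis
  proof (rule open_familyI[where R="\<lambda>n i. \<exists>m. P n m \<and> R (prod_encode (n, m)) i"])
    show "semidecidable (\<lambda>z. \<exists>m. P (pfst z) m \<and> R (prod_encode (pfst z, m)) (psnd z))"
      by (intro computability R(1) semidecidable_comp2[OF assms(2)])
  qed (auto simp: R2)
qed

lemma open_family_Un [computability]:
  assumes "open_family U" "open_family V" shows "open_family (\<lambda>n. U n \<union> V n)"
proof -
  obtain R where R: "\<And>f g. recursive f \<Longrightarrow> recursive g \<Longrightarrow> semidecidable (\<lambda>x. R (f x) (g x))"
      "\<And>n x. x \<in> U n \<longleftrightarrow> (\<exists>i. R n i \<and> x \<in> B i)" using assms(1) by (rule open_familyE) (rule that)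
  obtain S where S: "\<And>f g. recursive f \<Longrightarrow> recursive g \<Longrightarrow> semidecidable (\<lambda>x. S (f x) (g x))"
      "\<And>n x. x \<in> V n \<longleftrightarrow> (\<exists>i. S n i \<and> x \<in> B i)" using assms(2) by (rule open_familyE) (rule that)
  have "semidecidable (\<lambda>z. R (pfst z) (psnd z) \<or> S (pfst z) (psnd z))" by (intro computability R(1) S(1))
  then show ?thesis by (rule open_familyI) (auto simp: R(2) S(2))
qed

lemma open_family_if [computability]:
  assumes P: "decidable P" and "open_family U" "open_family V"
  shows "open_family (\<lambda>n. if P n then U n else V n)"
proof -
  obtain R where R: "\<And>f g. recursive f \<Longrightarrow> recursive g \<Longrightarrow> semidecidable (\<lambda>x. R (f x) (g x))"
      "\<And>n x. x \<in> U n \<longleftrightarrow> (\<exists>i. R n i \<and> x \<in> B i)" using assms(2) by (rule open_familyE) (rule that)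
  obtain S where S: "\<And>f g. recursive f \<Longrightarrow> recursive g \<Longrightarrow> semidecidable (\<lambda>x. S (f x) (g x))"
      "\<And>n x. x \<in> V n \<longleftrightarrow> (\<exists>i. S n i \<and> x \<in> B i)" using assms(3) by (rule open_familyE) (rule that)
  have "semidecidable (\<lambda>z. P (pfst z) \<and> R (pfst z) (psnd z) \<or> \<not> P (pfst z) \<and> S (pfst z) (psnd z))"
    by (intro semidecidable_disj semidecidable_conj R(1) S(1) recursive_pfst recursive_psnd recursive_id
        semidecidable_decidable[OF decidable_comp[OF P]] semidecidable_decidable[OF decidable_comp[OF decidable_not[OF P]]])
  then show ?thesis by (rule open_familyI) (auto simp: R(2) S(2))
qed

lemma open_family_inv [computability]:
  assumes "open_family U" shows "open_family (\<lambda>n. {y \<in> carrier G. inv y \<in> U n})"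
proof -
  obtain R where R: "\<And>f g. recursive f \<Longrightarrow> recursive g \<Longrightarrow> semidecidable (\<lambda>x. R (f x) (g x))"
      "\<And>n x. x \<in> U n \<longleftrightarrow> (\<exists>i. R n i \<and> x \<in> B i)" using assms(1) by (rule open_familyE) (rule that)
  obtain I where I: "\<And>f g. recursive f \<Longrightarrow> recursive g \<Longrightarrow> semidecidable (\<lambda>x. I (f x) (g x))"
    "\<And>i x. x \<in> carrier G \<Longrightarrow> inv x \<in> B i \<longleftrightarrow> (\<exists>k. I i k \<and> x \<in> B k)" by (rule inv_relation) (rule that)
  have "semidecidable (\<lambda>z. \<exists>i. R (pfst z) i \<and> I i (psnd z))" by (intro computability R(1) I(1))
  then show ?thesis
  proof (rule open_familyI)
    show "x \<in> {y \<in> carrier G. inv y \<in> U n} \<longleftrightarrow> (\<exists>k. (\<exists>i. R n i \<and> I i k) \<and> x \<in> B k)" for n x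
      using base_carrier by (auto simp: R(2) I(2)) (metis I(2))+
  qed
qed

lemma point_familyD: "point_family x \<Longrightarrow> x n \<in> carrier G"
  unfolding point_family_def by blast

lemma semidecidable_point_base:
  "point_family x \<Longrightarrow> recursive f \<Longrightarrow> recursive g \<Longrightarrow> semidecidable (\<lambda>n. x (f n) \<in> B (g n))"
  unfolding point_family_def by (rule semidecidable_comp2[of "\<lambda>n i. x n \<in> B i"]) auto

lemma semidecidable_point_open [computability]:
  assumes x: "point_family x" and U: "open_family U"
  shows "semidecidable (\<lambda>n. x n \<in> U n)"
proof -
  obtain R where R: "\<And>f g. recursive f \<Longrightarrow> recursive g \<Longrightarrow> semidecidable (\<lambda>x. R (f x) (g x))"
      "\<And>n x. x \<in> U n \<longleftrightarrow> (\<exists>i. R n i \<and> x \<in> B i)" using U by (rule open_familyE) (rule that)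
  show ?thesis unfolding R(2) by (intro computability R(1) semidecidable_point_base[OF x])
qed

lemma point_family_comp: "point_family x \<Longrightarrow> recursive f \<Longrightarrow> point_family (\<lambda>n. x (f n))"
  unfolding point_family_def
  by (auto intro!: semidecidable_comp2[of "\<lambda>n i. x n \<in> B i"] recursive_psnd recursive_id
      intro: recursive_comp recursive_pfst)

text \<open>Basic sets are non-empty, so one listed index already certifies a point.\<close>

lemma semidecidable_nonempty [computability]:
  assumes "open_family U" shows "semidecidable (\<lambda>n. \<exists>y. y \<in> U n)"
proof -
  obtain R where R: "\<And>f g. recursive f \<Longrightarrow> recursive g \<Longrightarrow> semidecidable (\<lambda>x. R (f x) (g x))"
      "\<And>n x. x \<in> U n \<longleftrightarrow> (\<exists>i. R n i \<and> x \<in> B i)" using assms by (rule open_familyE) (rule that)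
  have "semidecidable (\<lambda>n. \<exists>i. R n i)" by (intro computability R(1))
  moreover have "(\<exists>y. y \<in> U n) \<longleftrightarrow> (\<exists>i. R n i)" for n using base_nonempty unfolding R(2) by blast
  ultimately show ?thesis by simp
qed

text \<open>A rectangle \<open>B a\<close>, \<open>B b\<close> of the multiplication contributes
  \<open>B b\<close> as soon as \<open>B a\<close> is recognised as a neighbourhood of the
  computable point \<open>x n\<close>.\<close>

lemma open_family_translate [computability]:
  assumes x: "point_family x" and U: "open_family U"
  shows "open_family (\<lambda>n. {y \<in> carrier G. x n \<otimes> y \<in> U n})"
proof -
  obtain R where R: "\<And>f g. recursive f \<Longrightarrow> recursive g \<Longrightarrow> semidecidable (\<lambda>x. R (f x) (g x))"
      "\<And>n x. x \<in> U n \<longleftrightarrow> (\<exists>i. R n i \<and> x \<in> B i)" using U by (rule open_familyE) (rule that)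
  obtain M where M: "\<And>f g h. recursive f \<Longrightarrow> recursive g \<Longrightarrow> recursive h \<Longrightarrow> semidecidable (\<lambda>x. M (f x) (g x) (h x))"
    "\<And>i x y. x \<in> carrier G \<Longrightarrow> y \<in> carrier G \<Longrightarrow> x \<otimes> y \<in> B i \<longleftrightarrow> (\<exists>a b. M i a b \<and> x \<in> B a \<and> y \<in> B b)"
    by (rule mult_relation) (rule that)
  have "semidecidable (\<lambda>z. \<exists>i a. R (pfst z) i \<and> M i a (psnd z) \<and> x (pfst z) \<in> B a)"
    by (intro computability R(1) M(1) semidecidable_point_base[OF x])
  then show ?thesis
  proof (rule open_familyI)
    show "y \<in> {y \<in> carrier G. x n \<otimes> y \<in> U n} \<longleftrightarrow> (\<exists>b. (\<exists>i a. R n i \<and> M i a b \<and> x n \<in> B a) \<and> y \<in> B b)" for n y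
      using base_carrier point_familyD[OF x, of n] by (simp add: R(2)) (metis M(2))
  qed
qed

lemma point_family_inv [computability]:
  assumes "point_family x" shows "point_family (\<lambda>n. inv (x n))"
proof -
  have "semidecidable (\<lambda>z. x (pfst z) \<in> {y \<in> carrier G. inv y \<in> B (psnd z)})"
    by (intro computability point_family_comp[OF assms])
  then show ?thesis unfolding point_family_def using point_familyD[OF assms] by auto
qed

section \<open>Tests and constructions with compact sets\<close>

lemma compact_familyD: "compact_family K \<Longrightarrow> compactin T (K n)"
  unfolding compact_family_def by blast

lemma compact_family_carrier: "compact_family K \<Longrightarrow> x \<in> K n \<Longrightarrow> x \<in> carrier G"
  using compactin_subset_topspace[OF compact_familyD] by fastforce

text \<open>A finite subcover turns inclusion in an infinite union into an existential statement
  over codes. This is the source of all the compactness tests below.\<close>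

lemma compact_subset_open_code:
  assumes K: "compactin T K" and R: "\<And>x. x \<in> U \<longleftrightarrow> (\<exists>i. R i \<and> x \<in> B i)"
  shows "K \<subseteq> U \<longleftrightarrow> (\<exists>c. K \<subseteq> (\<Union>i\<in>code_set c. B i) \<and> (\<forall>i\<in>code_set c. R i))"
proof
  assume "K \<subseteq> U"
  then have "K \<subseteq> (\<Union>i\<in>{i. R i}. B i)" using R by blast
  then show "\<exists>c. K \<subseteq> (\<Union>i\<in>code_set c. B i) \<and> (\<forall>i\<in>code_set c. R i)"
    by (rule compact_subcover[OF K _ openin_base]) blast
qed (use R in blast)

lemma semidecidable_compact_base:
  "compact_family K \<Longrightarrow> recursive f \<Longrightarrow> recursive g \<Longrightarrow> semidecidable (\<lambda>n. K (f n) \<subseteq> (\<Union>i\<in>code_set (g n). B i))"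
  unfolding compact_family_def by (rule semidecidable_comp2[of "\<lambda>n c. K n \<subseteq> (\<Union>i\<in>code_set c. B i)"]) auto

lemma semidecidable_compact_open [computability]:
  assumes K: "compact_family K" and U: "open_family U"
  shows "semidecidable (\<lambda>n. K n \<subseteq> U n)"
proof -
  obtain R where R: "\<And>f g. recursive f \<Longrightarrow> recursive g \<Longrightarrow> semidecidable (\<lambda>x. R (f x) (g x))"
      "\<And>n x. x \<in> U n \<longleftrightarrow> (\<exists>i. R n i \<and> x \<in> B i)" using U by (rule open_familyE) (rule that)
  have "semidecidable (\<lambda>n. \<exists>c. K n \<subseteq> (\<Union>i\<in>code_set c. B i) \<and> (\<forall>i\<in>code_set c. R n i))"
    by (intro computability R(1) semidecidable_compact_base[OF K])
  then show ?thesis using compact_subset_open_code[OF compact_familyD[OF K] R(2)] by simp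
qed

lemma compact_family_comp: "compact_family K \<Longrightarrow> recursive f \<Longrightarrow> compact_family (\<lambda>n. K (f n))"
  unfolding compact_family_def
  by (auto intro!: semidecidable_comp2[of "\<lambda>n c. K n \<subseteq> (\<Union>i\<in>code_set c. B i)"] recursive_psnd recursive_id
      intro: recursive_comp recursive_pfst)

lemma open_family_UN_code [computability]:
  assumes "open_family (\<lambda>z. U (pfst z) (psnd z))" "recursive f"
  shows "open_family (\<lambda>n. \<Union>y\<in>code_set (f n). U n y)"
proof -
  have "open_family (\<lambda>n. \<Union>y\<in>{y. y \<in> code_set (f n)}. U n y)"
    by (intro open_family_UN assms(1) computability recursive_comp[OF assms(2)])
  then show ?thesis by simp
qed

text \<open>A list of base indices is processed from left to right, carrying along a base set inside the
  intersection of those already seen.\<close>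

lemma open_family_finite_Inter: "open_family (\<lambda>c. {x \<in> carrier G. \<forall>a\<in>code_set c. x \<in> B a})"
proof -
  obtain W where W: "\<And>f g h. recursive f \<Longrightarrow> recursive g \<Longrightarrow> recursive h \<Longrightarrow> semidecidable (\<lambda>x. W (f x) (g x) (h x))"
    "\<And>i j x. x \<in> B i \<Longrightarrow> x \<in> B j \<Longrightarrow> \<exists>k. W i j k \<and> x \<in> B k"
    "\<And>i j k x. W i j k \<Longrightarrow> x \<in> B k \<Longrightarrow> x \<in> B i \<and> x \<in> B j" by (rule inter_relation) (rule that)
  \<comment> \<open>A state pairs the code of the remaining list with the index of the current base
    set; a step consumes the head.\<close>
  define S where "S u v \<longleftrightarrow> pfst u \<noteq> 0 \<and> pfst v = psnd (pfst u - 1) \<and> W (psnd u) (code_nth (pfst u) 0) (psnd v)" for u v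
  have S: "semidecidable (\<lambda>z. S (pfst z) (psnd z))" unfolding S_def
    by (intro computability W(1) semidecidable_decidable[OF decidable_not])
  have S_Nil: "S\<^sup>*\<^sup>* (prod_encode (0, k)) v \<longleftrightarrow> v = prod_encode (0, k)" for k v
    by (auto elim: converse_rtranclpE simp: S_def)
  have "(\<exists>k. S\<^sup>*\<^sup>* (prod_encode (list_encode xs, k0)) (prod_encode (0, k)) \<and> x \<in> B k) \<longleftrightarrow>
      x \<in> B k0 \<and> (\<forall>a\<in>set xs. x \<in> B a)" for x xs k0
  proof (induction xs arbitrary: k0)
    case Nil
    show ?case by (simp add: S_Nil)
  next
    case (Cons a xs)
    have step: "S (prod_encode (list_encode (a # xs), k0)) v \<longleftrightarrow>
        (\<exists>k1. v = prod_encode (list_encode xs, k1) \<and> W k0 a k1)" for v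
    proof -
      have "code_nth (list_encode (a # xs)) 0 = a" by (simp add: code_nth_eq del: list_encode.simps)
      then show ?thesis unfolding S_def
        by (auto intro: exI[of _ "psnd v"]) (metis prod.collapse prod_decode_inverse)
    qed
    have "S\<^sup>*\<^sup>* (prod_encode (list_encode (a # xs), k0)) (prod_encode (0, k)) \<longleftrightarrow>
        (\<exists>k1. W k0 a k1 \<and> S\<^sup>*\<^sup>* (prod_encode (list_encode xs, k1)) (prod_encode (0, k)))" (is "?L \<longleftrightarrow> ?R") for k
    proof
      assume ?L then show ?R
      proof (rule converse_rtranclpE)
        assume "prod_encode (list_encode (a # xs), k0) = prod_encode (0, k)"
        then show ?R by simp
      qed (unfold step, blast)
    next
      assume ?R
      then show ?L by (meson converse_rtranclp_into_rtranclp step)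
    qed
    then have "(\<exists>k. S\<^sup>*\<^sup>* (prod_encode (list_encode (a # xs), k0)) (prod_encode (0, k)) \<and> x \<in> B k) \<longleftrightarrow>
        (\<exists>k1. W k0 a k1 \<and> x \<in> B k1 \<and> (\<forall>a\<in>set xs. x \<in> B a))"
      using Cons by (simp del: list_encode.simps) blast
    also have "\<dots> \<longleftrightarrow> x \<in> B k0 \<and> (\<forall>a\<in>set (a # xs). x \<in> B a)" using W(2,3) by auto
    finally show ?case .
  qed
  from this[of "list_decode c" for c] have eq: "(\<exists>k. S\<^sup>*\<^sup>* (prod_encode (c, k0)) (prod_encode (0, k)) \<and> x \<in> B k) \<longleftrightarrow>
      x \<in> B k0 \<and> (\<forall>a\<in>code_set c. x \<in> B a)" for x c k0 by simp
  \<comment> \<open>The initial base set \<open>k0\<close> is guessed: any basic neighbourhood of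
    the point will do, and for the empty list this yields the whole carrier.\<close>
  have "semidecidable (\<lambda>z. \<exists>k0. S\<^sup>*\<^sup>* (prod_encode (pfst z, k0)) (prod_encode (0, psnd z)))"
    by (intro computability semidecidable_rtranclp[OF S])
  then show ?thesis
  proof (rule open_familyI)
    fix c x
    have "\<exists>k0. x \<in> B k0" if "x \<in> carrier G"
      using base_refine[of "carrier G" x] that openin_topspace[of T] by auto
    moreover have "(\<exists>k. (\<exists>k0. S\<^sup>*\<^sup>* (prod_encode (c, k0)) (prod_encode (0, k))) \<and> x \<in> B k) \<longleftrightarrow>
        (\<exists>k0. x \<in> B k0 \<and> (\<forall>a\<in>code_set c. x \<in> B a))"
      unfolding eq[symmetric] by blast
    ultimately show "x \<in> {x \<in> carrier G. \<forall>a\<in>code_set c. x \<in> B a} \<longleftrightarrow>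
        (\<exists>k. (\<exists>k0. S\<^sup>*\<^sup>* (prod_encode (c, k0)) (prod_encode (0, k))) \<and> x \<in> B k)"
      using base_carrier by auto
  qed
qed

text \<open>An effective tube lemma. If \<open>x\<close> carries the compact set into
  \<open>U n\<close>, finitely many rectangles \<open>B a\<close>, \<open>B b\<close> of the
  multiplication with \<open>x\<close> in every \<open>B a\<close> have their second sides covering
  the set; then the whole intersection of these \<open>B a\<close> carries the set into
  \<open>U n\<close>.\<close>

lemma open_family_all_compact [computability]:
  assumes L: "compact_family L" and U: "open_family U"
  shows "open_family (\<lambda>n. {x \<in> carrier G. \<forall>l\<in>L n. x \<otimes> l \<in> U n})"
proof -
  obtain R where R: "\<And>f g. recursive f \<Longrightarrow> recursive g \<Longrightarrow> semidecidable (\<lambda>x. R (f x) (g x))"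
      "\<And>n x. x \<in> U n \<longleftrightarrow> (\<exists>i. R n i \<and> x \<in> B i)" using U by (rule open_familyE) (rule that)
  obtain M where M: "\<And>f g h. recursive f \<Longrightarrow> recursive g \<Longrightarrow> recursive h \<Longrightarrow> semidecidable (\<lambda>x. M (f x) (g x) (h x))"
    "\<And>i x y. x \<in> carrier G \<Longrightarrow> y \<in> carrier G \<Longrightarrow> x \<otimes> y \<in> B i \<longleftrightarrow> (\<exists>a b. M i a b \<and> x \<in> B a \<and> y \<in> B b)"
    by (rule mult_relation) (rule that)
  \<comment> \<open>\<open>c\<close> lists the first sides of the rectangles and \<open>c'\<close>
    the second sides, which form the cover.\<close>
  define P where "P n c \<longleftrightarrow> (\<exists>c'. L n \<subseteq> (\<Union>b\<in>code_set c'. B b) \<and>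
      (\<forall>b\<in>code_set c'. \<exists>a\<in>code_set c. \<exists>i. R n i \<and> M i a b))" for n c
  have "semidecidable (\<lambda>z. P (pfst z) (psnd z))" unfolding P_def
    by (intro computability R(1) M(1) semidecidable_compact_base[OF L])
  then have "open_family (\<lambda>n. \<Union>c\<in>{c. P n c}. {x \<in> carrier G. \<forall>a\<in>code_set c. x \<in> B a})"
    by (intro open_family_UN open_family_comp[OF open_family_finite_Inter] computability)
  moreover have "(\<Union>c\<in>{c. P n c}. {x \<in> carrier G. \<forall>a\<in>code_set c. x \<in> B a}) =
      {x \<in> carrier G. \<forall>l\<in>L n. x \<otimes> l \<in> U n}" for n
  proof (intro subset_antisym subsetI)
    fix x assume "x \<in> (\<Union>c\<in>{c. P n c}. {x \<in> carrier G. \<forall>a\<in>code_set c. x \<in> B a})"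
    then obtain c c' where x: "x \<in> carrier G" "\<And>a. a \<in> code_set c \<Longrightarrow> x \<in> B a"
        and c: "L n \<subseteq> (\<Union>b\<in>code_set c'. B b)" "\<And>b. b \<in> code_set c' \<Longrightarrow> \<exists>a\<in>code_set c. \<exists>i. R n i \<and> M i a b"
      unfolding P_def by blast
    have "x \<otimes> l \<in> U n" if l: "l \<in> L n" for l
    proof -
      obtain b where b: "b \<in> code_set c'" "l \<in> B b" using c(1) l by blast
      then obtain a i where a: "a \<in> code_set c" "R n i" "M i a b" using c(2) by blast
      have "x \<otimes> l \<in> B i" using M(2)[OF x(1) base_carrier[OF b(2)]] a x(2) b(2) by blast
      then show ?thesis using R(2) a(2) by blast
    qed
    then show "x \<in> {x \<in> carrier G. \<forall>l\<in>L n. x \<otimes> l \<in> U n}" using x(1) by blast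
  next
    fix x assume "x \<in> {x \<in> carrier G. \<forall>l\<in>L n. x \<otimes> l \<in> U n}"
    then have x: "x \<in> carrier G" "\<And>l. l \<in> L n \<Longrightarrow> x \<otimes> l \<in> U n" by blast+
    define Q where "Q b a \<longleftrightarrow> (\<exists>i. R n i \<and> M i a b) \<and> x \<in> B a" for b a
    have "L n \<subseteq> (\<Union>b\<in>{b. \<exists>a. Q b a}. B b)"
    proof
      fix l assume l: "l \<in> L n"
      obtain i where i: "R n i" "x \<otimes> l \<in> B i" using x(2)[OF l] R(2) by blast
      then obtain a b where "M i a b" "x \<in> B a" "l \<in> B b"
        using M(2)[OF x(1) compact_family_carrier[OF L l]] by blast
      then show "l \<in> (\<Union>b\<in>{b. \<exists>a. Q b a}. B b)" unfolding Q_def using i(1) by blast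
    qed
    then obtain c' where c': "code_set c' \<subseteq> {b. \<exists>a. Q b a}" "L n \<subseteq> (\<Union>b\<in>code_set c'. B b)"
      by (rule compact_subcover[OF compact_familyD[OF L] _ openin_base])
    define g where "g b = (SOME a. Q b a)" for b
    have g: "Q b (g b)" if "b \<in> code_set c'" for b
      unfolding g_def by (rule someI_ex) (use c'(1) that in blast)
    define c where "c = list_encode (map g (list_decode c'))"
    have "\<exists>a\<in>code_set c. \<exists>i. R n i \<and> M i a b" if "b \<in> code_set c'" for b
      using g[OF that] that by (intro bexI[of _ "g b"]) (auto simp: c_def Q_def)
    then have "P n c" unfolding P_def using c'(2) by (intro exI[of _ c']) blast
    moreover have "\<forall>a\<in>code_set c. x \<in> B a" using g by (auto simp: c_def Q_def)
    ultimately show "x \<in> (\<Union>c\<in>{c. P n c}. {x \<in> carrier G. \<forall>a\<in>code_set c. x \<in> B a})" using x(1) by blast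
  qed
  ultimately show ?thesis by simp
qed

text \<open>The quantifiers are removed from the inside: for \<open>z\<close> and then for
  \<open>y\<close> the tube lemma gives an open condition, and for \<open>x\<close> an inclusion of
  a compact set in an open one remains.\<close>

lemma semidecidable_compact_cube:
  assumes K: "compact_family K" and U: "open_family U"
  shows "semidecidable (\<lambda>n. \<forall>x\<in>K n. \<forall>y\<in>K n. \<forall>z\<in>K n. x \<otimes> y \<otimes> z \<in> U n)"
proof -
  have "semidecidable (\<lambda>n. K n \<subseteq> {x \<in> carrier G. \<forall>y\<in>K n. x \<otimes> y \<in> {w \<in> carrier G. \<forall>z\<in>K n. w \<otimes> z \<in> U n}})"
    by (intro computability K U)
  moreover have "K n \<subseteq> {x \<in> carrier G. \<forall>y\<in>K n. x \<otimes> y \<in> {w \<in> carrier G. \<forall>z\<in>K n. w \<otimes> z \<in> U n}} \<longleftrightarrow>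
      (\<forall>x\<in>K n. \<forall>y\<in>K n. \<forall>z\<in>K n. x \<otimes> y \<otimes> z \<in> U n)" for n
    using compact_family_carrier[OF K] by auto
  ultimately show ?thesis by simp
qed

text \<open>Since \<open>U\<close> may be any open family, the test for the image of a compact set
  can be replaced by one for a preimage of \<open>U\<close>. The parameter \<open>z\<close> carries
  the index of the compact set along with the index of the open one.\<close>

lemma compact_familyI:
  assumes "\<And>n. compactin T (K n)" "\<And>U. open_family U \<Longrightarrow> semidecidable (\<lambda>z. K (pfst z) \<subseteq> U z)"
  shows "compact_family K"
  unfolding compact_family_def using assms(1)
  by (auto intro!: assms(2) open_family_UN_code open_family_base recursive_psnd recursive_id)

lemma compact_family_Un [computability]:
  assumes K: "compact_family K" and L: "compact_family L" shows "compact_family (\<lambda>n. K n \<union> L n)"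
proof (rule compact_familyI)
  show "compactin T (K n \<union> L n)" for n by (intro compactin_Un compact_familyD K L)
  show "semidecidable (\<lambda>z. K (pfst z) \<union> L (pfst z) \<subseteq> U z)" if "open_family U" for U
    unfolding Un_subset_iff by (intro computability compact_family_comp[OF K] compact_family_comp[OF L] that)
qed

lemma compact_family_inv [computability]:
  assumes K: "compact_family K" shows "compact_family (\<lambda>n. (\<lambda>x. inv x) ` K n)"
proof (rule compact_familyI)
  show "compactin T ((\<lambda>x. inv x) ` K n)" for n
    by (rule image_compactin[OF compact_familyD[OF K] continuous_inv])
  fix U assume U: "open_family U"
  have "semidecidable (\<lambda>z. K (pfst z) \<subseteq> {y \<in> carrier G. inv y \<in> U z})"
    by (intro computability compact_family_comp[OF K] U)
  moreover have "K m \<subseteq> {y \<in> carrier G. inv y \<in> V} \<longleftrightarrow> (\<lambda>x. inv x) ` K m \<subseteq> V" for m V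
    using compact_family_carrier[OF K] by auto
  ultimately show "semidecidable (\<lambda>z. (\<lambda>x. inv x) ` K (pfst z) \<subseteq> U z)" by simp
qed

lemma compact_family_translate [computability]:
  assumes x: "point_family x" and K: "compact_family K"
  shows "compact_family (\<lambda>n. (\<lambda>y. x n \<otimes> y) ` K n)"
proof (rule compact_familyI)
  show "compactin T ((\<lambda>y. x n \<otimes> y) ` K n)" for n
    by (rule image_compactin[OF compact_familyD[OF K] continuous_left[OF point_familyD[OF x]]])
  fix U assume U: "open_family U"
  have "semidecidable (\<lambda>z. K (pfst z) \<subseteq> {y \<in> carrier G. x (pfst z) \<otimes> y \<in> U z})"
    by (intro computability compact_family_comp[OF K] point_family_comp[OF x] U)
  moreover have "K m \<subseteq> {y \<in> carrier G. x m \<otimes> y \<in> V} \<longleftrightarrow> (\<lambda>y. x m \<otimes> y) ` K m \<subseteq> V" for m V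
    using compact_family_carrier[OF K] by auto
  ultimately show "semidecidable (\<lambda>z. (\<lambda>y. x (pfst z) \<otimes> y) ` K (pfst z) \<subseteq> U z)" by simp
qed

lemma compact_family_UN_code [computability]:
  assumes K: "compact_family (\<lambda>z. K (pfst z) (psnd z))" and f: "recursive f"
  shows "compact_family (\<lambda>n. \<Union>y\<in>code_set (f n). K n y)"
proof (rule compact_familyI)
  have "compactin T (K n y)" for n y using compact_familyD[OF K, of "prod_encode (n, y)"] by simp
  then show "compactin T (\<Union>y\<in>code_set (f n). K n y)" for n by (intro compactin_Union) auto
  fix U assume U: "open_family U"
  have K2: "compact_family (\<lambda>z. K (g z) (h z))" if "recursive g" "recursive h" for g h
    using compact_family_comp[OF K recursive_prod_encode[OF that]] by simp
  have "semidecidable (\<lambda>z. \<forall>y\<in>code_set (f (pfst z)). K (pfst z) y \<subseteq> U z)"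
    by (intro computability recursive_comp[OF f] K2 open_family_comp[OF U])
  then show "semidecidable (\<lambda>z. (\<Union>y\<in>code_set (f (pfst z)). K (pfst z) y) \<subseteq> U z)"
    by (simp add: UN_subset_iff)
qed

lemma compact_family_if [computability]:
  assumes P: "decidable P" and K: "compact_family K" and L: "compact_family L"
  shows "compact_family (\<lambda>n. if P n then K n else L n)"
proof (rule compact_familyI)
  show "compactin T (if P n then K n else L n)" for n using compact_familyD[OF K] compact_familyD[OF L] by simp
  fix U assume U: "open_family U"
  have "semidecidable (\<lambda>z. P (pfst z) \<and> K (pfst z) \<subseteq> U z \<or> \<not> P (pfst z) \<and> L (pfst z) \<subseteq> U z)"
    by (intro semidecidable_disj semidecidable_conj semidecidable_compact_open compact_family_comp[OF K]
        compact_family_comp[OF L] U recursive_pfst recursive_id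
        semidecidable_decidable[OF decidable_comp[OF P]] semidecidable_decidable[OF decidable_comp[OF decidable_not[OF P]]])
  then show "semidecidable (\<lambda>z. (if P (pfst z) then K (pfst z) else L (pfst z)) \<subseteq> U z)"
    by (rule back_subst[of semidecidable]) auto
qed

text \<open>The identity is \<open>x \<otimes> inv x\<close> for every \<open>x\<close>, so no
  computable point has to be known in advance: a basic set \<open>B k\<close> inside both
  \<open>B a\<close> and \<open>B c\<close> is non-empty and provides such an \<open>x\<close>. For
  the converse one takes \<open>x\<close> to be the identity.\<close>

lemma point_family_one [computability]: "point_family (\<lambda>n. \<one>)"
proof -
  obtain W where W: "\<And>f g h. recursive f \<Longrightarrow> recursive g \<Longrightarrow> recursive h \<Longrightarrow> semidecidable (\<lambda>x. W (f x) (g x) (h x))"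
    "\<And>i j x. x \<in> B i \<Longrightarrow> x \<in> B j \<Longrightarrow> \<exists>k. W i j k \<and> x \<in> B k"
    "\<And>i j k x. W i j k \<Longrightarrow> x \<in> B k \<Longrightarrow> x \<in> B i \<and> x \<in> B j" by (rule inter_relation) (rule that)
  obtain M where M: "\<And>f g h. recursive f \<Longrightarrow> recursive g \<Longrightarrow> recursive h \<Longrightarrow> semidecidable (\<lambda>x. M (f x) (g x) (h x))"
    "\<And>i x y. x \<in> carrier G \<Longrightarrow> y \<in> carrier G \<Longrightarrow> x \<otimes> y \<in> B i \<longleftrightarrow> (\<exists>a b. M i a b \<and> x \<in> B a \<and> y \<in> B b)"
    by (rule mult_relation) (rule that)
  obtain I where I: "\<And>f g. recursive f \<Longrightarrow> recursive g \<Longrightarrow> semidecidable (\<lambda>x. I (f x) (g x))"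
    "\<And>i x. x \<in> carrier G \<Longrightarrow> inv x \<in> B i \<longleftrightarrow> (\<exists>k. I i k \<and> x \<in> B k)" by (rule inv_relation) (rule that)
  have "\<one> \<in> B i \<longleftrightarrow> (\<exists>a b c k. M i a b \<and> I b c \<and> W a c k)" for i
  proof
    assume "\<one> \<in> B i"
    then obtain a b where ab: "M i a b" "\<one> \<in> B a" "\<one> \<in> B b" using M(2)[of \<one> \<one> i] by auto
    then obtain c where c: "I b c" "\<one> \<in> B c" using I(2)[of \<one> b] by auto
    then show "\<exists>a b c k. M i a b \<and> I b c \<and> W a c k" using ab W(2) by blast
  next
    assume "\<exists>a b c k. M i a b \<and> I b c \<and> W a c k"
    then obtain a b c k where *: "M i a b" "I b c" "W a c k" by blast
    obtain x where "x \<in> B k" using base_nonempty by blast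
    then have x: "x \<in> B a" "x \<in> B c" "x \<in> carrier G" using W(3)[OF *(3)] base_carrier by blast+
    then have "inv x \<in> B b" using I(2) *(2) by blast
    then have "x \<otimes> inv x \<in> B i" using M(2)[of x "inv x" i] x *(1) by auto
    then show "\<one> \<in> B i" using x by simp
  qed
  moreover have "semidecidable (\<lambda>z. \<exists>a b c k. M (psnd z) a b \<and> I b c \<and> W a c k)"
    by (intro computability M(1) I(1) W(1))
  ultimately show ?thesis unfolding point_family_def by simp
qed

end

section \<open>Small neighbourhoods of the identity\<close>

locale locally_compact_computable_group = computable_group +
  assumes effectively_locally_compact: "effectively_locally_compact T B"
begin

text \<open>The enumeration \<nu> of the basic neighbourhoods of the identity is used twice: shifted
  by one, since 0 codes a pause, as the name of the point, and unshifted as the list of the target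
  sets. With the first input fixed, the operator's output depends on \<open>n\<close> alone.\<close>

lemma compact_neighbourhoods:
  obtains V K where "open_family V" "compact_family K" "\<And>n. \<one> \<in> V n" "\<And>n. V n \<subseteq> K n"
    "\<And>U. openin T U \<Longrightarrow> \<one> \<in> U \<Longrightarrow> \<exists>n. K n \<subseteq> U"
proof -
  obtain \<Phi> where \<Phi>: "ce \<Phi>" "\<forall>x U S p q. openin T U \<and> x \<in> U \<and> open_name B U S \<and>
      enumerates p (point_name B x) \<and> enumerates q S \<longrightarrow>
      (\<exists>V K. openin T V \<and> compactin T K \<and> x \<in> V \<and> V \<subseteq> K \<and> K \<subseteq> U \<and>
             open_name B V (even_part (listed \<Phi> (interleave p q))) \<and>
             odd_part (listed \<Phi> (interleave p q)) = compact_name B K)"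
    using effectively_locally_compact unfolding effectively_locally_compact_def by (elim exE conjE)
  obtain i0 where i0: "\<one> \<in> B i0" using base_refine[OF openin_topspace, of \<one>] by auto
  have "semidecidable (\<lambda>i. \<one> \<in> B i)" by (intro computability)
  then obtain \<nu> where \<nu>: "recursive \<nu>" "range \<nu> = {i. \<one> \<in> B i}"
    using i0 by (rule semidecidable_enumeration)
  define p where "p i = Suc (\<nu> i)" for i
  have p: "enumerates p (point_name B \<one>)"
    using \<nu>(2) unfolding enumerates_def point_name_def p_def by (auto simp: image_iff)
  define L where "L n = listed \<Phi> (interleave p (\<lambda>_. Suc (\<nu> n)))" for n
  have "\<exists>V K. openin T V \<and> compactin T K \<and> \<one> \<in> V \<and> V \<subseteq> K \<and> K \<subseteq> B (\<nu> n) \<and>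
      open_name B V (even_part (L n)) \<and> odd_part (L n) = compact_name B K" for n
    unfolding L_def
  proof (rule \<Phi>(2)[rule_format], intro conjI openin_base p)
    show "\<one> \<in> B (\<nu> n)" using \<nu>(2) by blast
    show "open_name B (B (\<nu> n)) {\<nu> n}" by (simp add: open_name_def)
    show "enumerates (\<lambda>_. Suc (\<nu> n)) {\<nu> n}" by (auto simp: enumerates_def)
  qed
  then obtain V K where VK: "\<And>n. openin T (V n)" "\<And>n. compactin T (K n)" "\<And>n. \<one> \<in> V n" "\<And>n. V n \<subseteq> K n"
      "\<And>n. K n \<subseteq> B (\<nu> n)" "\<And>n. open_name B (V n) (even_part (L n))" "\<And>n. odd_part (L n) = compact_name B (K n)"
    by metis
  have rec: "recursive (\<lambda>z. interleave p (\<lambda>_. Suc (\<nu> (pfst z))) (psnd z))"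
    unfolding interleave_def p_def by (intro computability recursive_comp[OF \<nu>(1)])
  have L: "semidecidable (\<lambda>z. g z \<in> L (pfst z))" if "recursive g" for g
    unfolding L_def by (rule semidecidable_listed[OF \<Phi>(1) rec _ that]) (intro computability)
  show ?thesis
  proof
    show "open_family V"
    proof (rule open_familyI)
      show "semidecidable (\<lambda>z. 2 * psnd z \<in> L (pfst z))" by (intro L computability)
      show "x \<in> V n \<longleftrightarrow> (\<exists>i. 2 * i \<in> L n \<and> x \<in> B i)" for n x
        using VK(6)[of n] unfolding open_name_def even_part_def by auto
    qed
    \<comment> \<open>Names of compact sets contain non-empty tuples only; the empty one, of code 0,
      covers no \<open>K n\<close>, as the identity lies in \<open>K n\<close>.\<close>
    have "K n \<subseteq> (\<Union>i\<in>code_set c. B i) \<longleftrightarrow> c \<noteq> 0 \<and> 2 * c + 1 \<in> L n" for n c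
    proof (cases "c = 0")
      case True
      then show ?thesis using VK(3,4) by auto
    next
      case False
      then have ne: "list_decode c \<noteq> []" by (metis list_decode_inverse list_encode.simps(1))
      have "2 * c + 1 \<in> L n \<longleftrightarrow> c \<in> compact_name B (K n)"
        using VK(7)[of n] unfolding odd_part_def by blast
      also have "\<dots> \<longleftrightarrow> K n \<subseteq> (\<Union>i\<in>code_set c. B i)"
      proof
        assume "c \<in> compact_name B (K n)"
        then obtain js where "c = list_encode js" "K n \<subseteq> \<Union> (B ` set js)"
          unfolding compact_name_def by blast
        then show "K n \<subseteq> (\<Union>i\<in>code_set c. B i)" by simp
      next
        assume "K n \<subseteq> (\<Union>i\<in>code_set c. B i)"
        then show "c \<in> compact_name B (K n)"
          unfolding compact_name_def mem_Collect_eq using ne by (intro exI[of _ "list_decode c"]) simp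
      qed
      finally show ?thesis using False by simp
    qed
    then show "compact_family K" unfolding compact_family_def using VK(2)
      by (auto intro!: semidecidable_conj L semidecidable_decidable[OF decidable_not] computability)
    show "\<exists>n. K n \<subseteq> U" if U: "openin T U" "\<one> \<in> U" for U
    proof -
      obtain i where i: "\<one> \<in> B i" "B i \<subseteq> U" using base_refine[OF U] by blast
      then obtain n where "\<nu> n = i" using \<nu>(2) by (metis mem_Collect_eq rangeE)
      then show ?thesis using VK(5)[of n] i(2) by blast
    qed
  qed (use VK(3,4) in auto)
qed

text \<open>Symmetrising by unions keeps the sets effectively compact, and a symmetric classical
  neighbourhood \<open>N\<close> bounds the union. In the choice of level \<open>t + 1\<close>,
  landing in the preceding \<open>V\<close> is the cube condition; landing also in
  \<open>V t\<close>, with \<open>t\<close> counted in the first component of the state, makes the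
  chosen sets shrink to the identity.\<close>

lemma small_neighbourhoods:
  obtains U C where "open_family U" "compact_family C" "\<And>t. \<one> \<in> U t" "\<And>t. U t \<subseteq> C t"
    "\<And>t x. x \<in> U t \<Longrightarrow> inv x \<in> U t" "\<And>t x. x \<in> C t \<Longrightarrow> inv x \<in> C t"
    "\<And>t x y z. x \<in> C (Suc t) \<Longrightarrow> y \<in> C (Suc t) \<Longrightarrow> z \<in> C (Suc t) \<Longrightarrow> x \<otimes> y \<otimes> z \<in> U t"
    "\<And>N. openin T N \<Longrightarrow> \<one> \<in> N \<Longrightarrow> \<exists>t. C t \<subseteq> N"
proof -
  obtain V K where VK: "open_family V" "compact_family K" "\<And>n. \<one> \<in> V n" "\<And>n. V n \<subseteq> K n"
    "\<And>U. openin T U \<Longrightarrow> \<one> \<in> U \<Longrightarrow> \<exists>n. K n \<subseteq> U" by (rule compact_neighbourhoods) (rule that)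
  define C where "C s = K s \<union> (\<lambda>x. inv x) ` K s" for s
  define U where "U s = V s \<union> {y \<in> carrier G. inv y \<in> V s}" for s
  have C: "compact_family C" unfolding C_def by (intro computability VK)
  have U: "open_family U" unfolding U_def by (intro computability VK)
  have invC: "inv x \<in> C s" if "x \<in> C s" for x s
    using that compact_family_carrier[OF VK(2)] unfolding C_def by auto
  have invU: "inv x \<in> U s" if "x \<in> U s" for x s
    using that open_family_carrier[OF VK(1)] unfolding U_def by auto
  have VU: "V s \<subseteq> U s" for s unfolding U_def by blast
  have UC: "U s \<subseteq> C s" for s
  proof
    fix x assume "x \<in> U s"
    then consider "x \<in> V s" | "x \<in> carrier G" "inv x \<in> V s" unfolding U_def by blast
    then show "x \<in> C s"
    proof cases
      case 2
      then have "inv (inv x) \<in> C s" using VK(4)[of s] by (rule_tac invC) (auto simp: C_def)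
      then show ?thesis using 2 by simp
    qed (use VK(4)[of s] in \<open>auto simp: C_def\<close>)
  qed
  have oneC: "\<one> \<in> C s" for s using VK(3,4) by (auto simp: C_def)
  define R where "R u v \<longleftrightarrow> pfst v = Suc (pfst u) \<and>
      (\<forall>x\<in>C (psnd v). \<forall>y\<in>C (psnd v). \<forall>z\<in>C (psnd v). x \<otimes> y \<otimes> z \<in> V (psnd u) \<inter> V (pfst u))" for u v
  have R_semi: "semidecidable (\<lambda>z. R (pfst z) (psnd z))" unfolding R_def
    by (intro semidecidable_conj semidecidable_compact_cube compact_family_comp[OF C] open_family_Int
        open_family_comp[OF VK(1)] computability)
  have R_ex: "\<exists>v. True \<and> R u v" for u
  proof -
    have "openin T (V (psnd u) \<inter> V (pfst u))" "\<one> \<in> V (psnd u) \<inter> V (pfst u)"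
      using VK(3) by (auto intro: openin_open_family[OF VK(1)])
    then obtain N where N: "openin T N" "\<one> \<in> N" "\<And>x. x \<in> N \<Longrightarrow> inv x \<in> N"
        "\<And>x y z. x \<in> N \<Longrightarrow> y \<in> N \<Longrightarrow> z \<in> N \<Longrightarrow> x \<otimes> y \<otimes> z \<in> V (psnd u) \<inter> V (pfst u)"
      by (rule neighbourhood_cube) (rule that)
    obtain s where "K s \<subseteq> N" using VK(5)[OF N(1,2)] by blast
    then have "C s \<subseteq> N" using N(3) by (auto simp: C_def)
    then have "\<forall>x\<in>C s. \<forall>y\<in>C s. \<forall>z\<in>C s. x \<otimes> y \<otimes> z \<in> V (psnd u) \<inter> V (pfst u)"
      using N(4) by blast
    then have "R u (prod_encode (Suc (pfst u), s))" unfolding R_def by simp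
    then show ?thesis by blast
  qed
  obtain F where F: "recursive (\<lambda>z. F (pfst z) (psnd z))" "\<And>n t. True" "\<And>n t. R (F n t) (F n (Suc t))"
      "\<And>x. True \<Longrightarrow> \<exists>n. F n 0 = x"
    by (rule semidecidable_dependent_choice[of "\<lambda>_. True" 0 R, OF semidecidable_basic(1) TrueI R_semi R_ex])
       (rule that)
  obtain m where m: "F m 0 = prod_encode (0, 0)" using F(4)[OF TrueI] by blast
  have pf: "pfst (F m t) = t" for t
    by (induction t) (use m F(3) in \<open>auto simp: R_def\<close>)
  have "recursive (F m)"
    using recursive_comp[OF F(1) recursive_prod_encode[OF recursive_const[of m] recursive_id]] by simp
  then have rec: "recursive (\<lambda>t. psnd (F m t))" by (rule recursive_psnd)
  have cube: "x \<otimes> y \<otimes> z \<in> V (psnd (F m t)) \<inter> V t"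
    if "x \<in> C (psnd (F m (Suc t)))" "y \<in> C (psnd (F m (Suc t)))" "z \<in> C (psnd (F m (Suc t)))" for t x y z
    using F(3)[of m t] that unfolding R_def pf by blast
  show ?thesis
  proof (rule that[of "\<lambda>t. U (psnd (F m t))" "\<lambda>t. C (psnd (F m t))"])
    show "\<exists>t. C (psnd (F m t)) \<subseteq> N" if N: "openin T N" "\<one> \<in> N" for N
    proof -
      obtain n where n: "K n \<subseteq> N" using VK(5)[OF N] by blast
      have "x \<in> N" if "x \<in> C (psnd (F m (Suc n)))" for x
      proof -
        have "x \<otimes> \<one> \<otimes> \<one> \<in> V n" using cube[OF that oneC oneC] by blast
        then show ?thesis using n VK(4)[of n] compact_family_carrier[OF C that] by auto
      qed
      then show ?thesis by blast
    qed
    show "open_family (\<lambda>t. U (psnd (F m t)))" by (rule open_family_comp[OF U rec])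
    show "compact_family (\<lambda>t. C (psnd (F m t)))" by (rule compact_family_comp[OF C rec])
    show "\<one> \<in> U (psnd (F m t))" for t using VU VK(3) by blast
    show "U (psnd (F m t)) \<subseteq> C (psnd (F m t))" for t by (rule UC)
    show "inv x \<in> U (psnd (F m t))" if "x \<in> U (psnd (F m t))" for t x using that by (rule invU)
    show "inv x \<in> C (psnd (F m t))" if "x \<in> C (psnd (F m t))" for t x using that by (rule invC)
    show "x \<otimes> y \<otimes> z \<in> U (psnd (F m t))" if "x \<in> C (psnd (F m (Suc t)))" "y \<in> C (psnd (F m (Suc t)))"
        "z \<in> C (psnd (F m (Suc t)))" for t x y z using cube[OF that] VU by blast
  qed
qed

end

section \<open>Quotients and dense computable points\<close>

context computable_group
begin

lemma quotient_relation:
  obtains D where "\<And>f g h. recursive f \<Longrightarrow> recursive g \<Longrightarrow> recursive h \<Longrightarrow> semidecidable (\<lambda>x. D (f x) (g x) (h x))"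
    "\<And>i x y. x \<in> carrier G \<Longrightarrow> y \<in> carrier G \<Longrightarrow> inv x \<otimes> y \<in> B i \<longleftrightarrow> (\<exists>a b. D i a b \<and> x \<in> B a \<and> y \<in> B b)"
proof -
  obtain M where M: "\<And>f g h. recursive f \<Longrightarrow> recursive g \<Longrightarrow> recursive h \<Longrightarrow> semidecidable (\<lambda>x. M (f x) (g x) (h x))"
    "\<And>i x y. x \<in> carrier G \<Longrightarrow> y \<in> carrier G \<Longrightarrow> x \<otimes> y \<in> B i \<longleftrightarrow> (\<exists>a b. M i a b \<and> x \<in> B a \<and> y \<in> B b)"
    by (rule mult_relation) (rule that)
  obtain I where I: "\<And>f g. recursive f \<Longrightarrow> recursive g \<Longrightarrow> semidecidable (\<lambda>x. I (f x) (g x))"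
    "\<And>i x. x \<in> carrier G \<Longrightarrow> inv x \<in> B i \<longleftrightarrow> (\<exists>k. I i k \<and> x \<in> B k)" by (rule inv_relation) (rule that)
  show ?thesis
  proof (rule that[of "\<lambda>i a b. \<exists>c. M i c b \<and> I c a"])
    fix f g h :: "nat \<Rightarrow> nat" assume fgh: "recursive f" "recursive g" "recursive h"
    show "semidecidable (\<lambda>x. \<exists>c. M (f x) c (h x) \<and> I c (g x))"
      by (intro computability M(1) I(1) recursive_comp[OF fgh(1)] recursive_comp[OF fgh(2)] recursive_comp[OF fgh(3)])
  next
    fix i x y assume xy: "x \<in> carrier G" "y \<in> carrier G"
    show "inv x \<otimes> y \<in> B i \<longleftrightarrow> (\<exists>a b. (\<exists>c. M i c b \<and> I c a) \<and> x \<in> B a \<and> y \<in> B b)"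
      unfolding M(2)[OF inv_closed[OF xy(1)] xy(2)] I(2)[OF xy(1)] by blast
  qed
qed

lemma openin_quotient: "y \<in> carrier G \<Longrightarrow> openin T V \<Longrightarrow> openin T {a \<in> carrier G. inv a \<otimes> y \<in> V}"
  using openin_inv[OF openin_right[of y V]] by (rule back_subst[of "openin T"]) auto

end

locale neighbourhood_sequence = computable_group +
  fixes U C :: "nat \<Rightarrow> 'a set"
  assumes open_U: "open_family U" and compact_C: "compact_family C"
    and one_U: "\<one> \<in> U t" and U_subset_C: "U t \<subseteq> C t"
    and inv_C: "x \<in> C t \<Longrightarrow> inv x \<in> C t"
    and cube: "x \<in> C (Suc t) \<Longrightarrow> y \<in> C (Suc t) \<Longrightarrow> z \<in> C (Suc t) \<Longrightarrow> x \<otimes> y \<otimes> z \<in> U t"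
    and neighbourhood_base: "openin T N \<Longrightarrow> \<one> \<in> N \<Longrightarrow> \<exists>t. C t \<subseteq> N"
begin

lemma C_carrier: "x \<in> C t \<Longrightarrow> x \<in> carrier G"
  by (rule compact_family_carrier[OF compact_C])

lemma U_carrier: "x \<in> U t \<Longrightarrow> x \<in> carrier G"
  by (rule open_family_carrier[OF open_U])

lemma one_C: "\<one> \<in> C t"
  using one_U U_subset_C by blast

lemma square: "x \<in> C (Suc t) \<Longrightarrow> y \<in> C (Suc t) \<Longrightarrow> x \<otimes> y \<in> U t"
  using cube[OF _ _ one_C] C_carrier by fastforce

lemma C_Suc_subset: "C (Suc t) \<subseteq> U t"
  using square[OF _ one_C] C_carrier by fastforce

lemma C_antimono: "s \<le> t \<Longrightarrow> C t \<subseteq> C s"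
  by (rule lift_Suc_antimono_le[of C]) (rule subset_trans[OF C_Suc_subset U_subset_C])

lemma neighbourhood_base_at:
  assumes "openin T N" "x \<in> N" obtains t where "\<And>c. c \<in> C t \<Longrightarrow> x \<otimes> c \<in> N"
proof -
  have x: "x \<in> carrier G" using openin_subset[OF assms(1)] assms(2) by auto
  obtain t where "C t \<subseteq> {y \<in> carrier G. x \<otimes> y \<in> N}"
    using neighbourhood_base[OF openin_left[OF x assms(1)]] assms(2) x by auto
  then show ?thesis by (intro that) blast
qed

text \<open>Compactness plays the role of completeness. Telescoping with \<open>square\<close>,
  which costs one level, shows that all later \<open>z n\<close> lie in the compact set of
  translates \<open>z m \<otimes> c\<close> with \<open>c\<close> in \<open>C (t + m)\<close>; these
  sets have the finite intersection property, and a common point is the limit.\<close>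

lemma limit_point:
  assumes z: "\<And>m. z m \<in> carrier G" "\<And>m. inv (z m) \<otimes> z (Suc m) \<in> C (t + Suc m)"
  obtains x where "x \<in> carrier G" "\<And>m. inv (z m) \<otimes> x \<in> C (t + m)"
proof -
  have tail: "inv (z m) \<otimes> z (m + k) \<in> C (t + m)" for m k
  proof (induction k arbitrary: m)
    case 0
    show ?case using z(1) one_C by simp
  next
    case (Suc k)
    have "inv (z (Suc m)) \<otimes> z (Suc m + k) \<in> C (Suc (t + m))" using Suc[of "Suc m"] by simp
    moreover have "inv (z m) \<otimes> z (Suc m) \<in> C (Suc (t + m))" using z(2)[of m] by simp
    ultimately have "(inv (z m) \<otimes> z (Suc m)) \<otimes> (inv (z (Suc m)) \<otimes> z (Suc m + k)) \<in> U (t + m)"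
      by (intro square)
    then show ?case using U_subset_C z(1) by (auto simp: quotient_mult)
  qed
  define K where "K m = (\<lambda>c. z m \<otimes> c) ` C (t + m)" for m
  have K: "compactin T (K m)" for m unfolding K_def
    by (rule image_compactin[OF compact_familyD[OF compact_C] continuous_left[OF z(1)]])
  have mem: "z n \<in> K m" if "m \<le> n" for m n
  proof -
    have "z n = z m \<otimes> (inv (z m) \<otimes> z (m + (n - m)))"
      using z(1) that by (simp add: m_assoc[symmetric])
    then show ?thesis unfolding K_def using tail by blast
  qed
  have "K 0 \<inter> \<Inter> (range K) \<noteq> {}"
  proof -
    have closed: "\<forall>A\<in>range K. closedin T A" using compactin_imp_closedin[OF Hausdorff K] by blast
    have fip: "\<forall>\<F>. finite \<F> \<and> \<F> \<subseteq> range K \<longrightarrow> K 0 \<inter> \<Inter> \<F> \<noteq> {}"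
    proof (intro allI impI)
      fix \<F> assume "finite \<F> \<and> \<F> \<subseteq> range K"
      then obtain J where J: "finite J" "\<F> = K ` J" by (meson finite_subset_image)
      obtain n where "\<forall>j\<in>J. j \<le> n" using finite_nat_set_iff_bounded_le J(1) by blast
      then have "z n \<in> K 0 \<inter> \<Inter> \<F>" using J(2) mem by auto
      then show "K 0 \<inter> \<Inter> \<F> \<noteq> {}" by blast
    qed
    show ?thesis
      by (rule compactin_fip[THEN iffD1, OF K, THEN conjunct2, THEN spec, THEN mp, OF conjI[OF closed fip]])
  qed
  then obtain x where x: "\<And>m. x \<in> K m" by blast
  have xc: "x \<in> carrier G" using x[of 0] z(1) C_carrier by (auto simp: K_def)
  have "inv (z m) \<otimes> x \<in> C (t + m)" for m
  proof -
    obtain c where c: "x = z m \<otimes> c" "c \<in> C (t + m)" using x[of m] unfolding K_def by blast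
    then have "inv (z m) \<otimes> x = c" using z(1)[of m] C_carrier[OF c(2)] by (simp add: m_assoc[symmetric])
    then show ?thesis using c(2) by simp
  qed
  with xc show ?thesis by (rule that)
qed

text \<open>Computable points arise as limits of sequences of small basic sets, consecutive ones of which
  meet. No nesting of the sets is needed, and the limit lies in \<open>B j\<close> iff some point \<open>y\<close> of one of
  the sets has a compact neighbourhood \<open>y C\<close> in \<open>B j\<close>, where \<open>C\<close> is coarser than the set.\<close>

lemma dense_points:
  obtains \<alpha> where "point_family \<alpha>" "\<And>N. openin T N \<Longrightarrow> N \<noteq> {} \<Longrightarrow> \<exists>n. \<alpha> n \<in> N"
proof -
  obtain R where R: "\<And>f g. recursive f \<Longrightarrow> recursive g \<Longrightarrow> semidecidable (\<lambda>x. R (f x) (g x))"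
      "\<And>n x. x \<in> U n \<longleftrightarrow> (\<exists>i. R n i \<and> x \<in> B i)" using open_U by (rule open_familyE) (rule that)
  obtain D where D: "\<And>f g h. recursive f \<Longrightarrow> recursive g \<Longrightarrow> recursive h \<Longrightarrow> semidecidable (\<lambda>x. D (f x) (g x) (h x))"
    "\<And>i x y. x \<in> carrier G \<Longrightarrow> y \<in> carrier G \<Longrightarrow> inv x \<otimes> y \<in> B i \<longleftrightarrow> (\<exists>a b. D i a b \<and> x \<in> B a \<and> y \<in> B b)"
    by (rule quotient_relation) (rule that)
  define small where "small t u \<longleftrightarrow> (\<exists>i. R t i \<and> D i (pfst u) (psnd u))" for t u
  \<comment> \<open>\<open>D\<close> controls the quotient of a point of the first basic set and a
    point of the second; on the intersection it controls all quotients.\<close>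
  define P where "P u = B (pfst u) \<inter> B (psnd u)" for u
  have P: "open_family P" unfolding P_def by (intro computability)
  have P_carrier: "x \<in> carrier G" if "x \<in> P u" for x u using that base_carrier by (auto simp: P_def)
  have small_quotient: "inv x \<otimes> y \<in> U t" if "small t u" "x \<in> P u" "y \<in> P u" for t u x y
    using that D(2)[OF P_carrier[OF that(2)] P_carrier[OF that(3)]] R(2) unfolding small_def P_def by blast
  have small_ex: "\<exists>u. small t u \<and> y \<in> P u" if y: "y \<in> carrier G" for t y
  proof -
    obtain i where i: "R t i" "\<one> \<in> B i" using one_U R(2) by blast
    then have "inv y \<otimes> y \<in> B i" using y by simp
    then obtain a b where "D i a b" "y \<in> B a" "y \<in> B b" using D(2)[OF y y] by blast
    then show ?thesis using i(1) by (intro exI[of _ "prod_encode (a, b)"]) (auto simp: small_def P_def)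
  qed
  \<comment> \<open>A state is a level with the code of a small pair. Non-emptiness is demanded
    because two basic sets may be disjoint.\<close>
  define S where "S v \<longleftrightarrow> small (pfst v) (psnd v) \<and> (\<exists>y. y \<in> P (psnd v))" for v
  define E where "E v w \<longleftrightarrow> pfst w = Suc (pfst v) \<and> (\<exists>y. y \<in> P (psnd v) \<inter> P (psnd w))" for v w
  have S_semi: "semidecidable S" unfolding S_def small_def
    by (intro computability R(1) D(1) open_family_comp[OF P])
  have E_semi: "semidecidable (\<lambda>z. E (pfst z) (psnd z))" unfolding E_def
    by (intro semidecidable_conj semidecidable_nonempty open_family_Int open_family_comp[OF P] computability)
  obtain u0 where "small 0 u0" "\<one> \<in> P u0" using small_ex[of \<one> 0] by auto
  then have S0: "S (prod_encode (0, u0))" unfolding S_def by auto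
  have E_ex: "\<exists>w. S w \<and> E v w" if Sv: "S v" for v
  proof -
    obtain y where y: "y \<in> P (psnd v)" using Sv unfolding S_def by blast
    obtain u where "small (Suc (pfst v)) u" "y \<in> P u" using small_ex[OF P_carrier[OF y]] by blast
    then show ?thesis using y by (intro exI[of _ "prod_encode (Suc (pfst v), u)"]) (auto simp: S_def E_def)
  qed
  obtain F where F: "recursive (\<lambda>z. F (pfst z) (psnd z))" "\<And>n t. S (F n t)" "\<And>n t. E (F n t) (F n (Suc t))"
      "\<And>x. S x \<Longrightarrow> \<exists>n. F n 0 = x"
    by (rule semidecidable_dependent_choice[OF S_semi S0 E_semi E_ex]) (assumption, rule that)
  have rF: "recursive (\<lambda>x. F (f x) (g x))" if "recursive f" "recursive g" for f g
    using recursive_comp[OF F(1) recursive_prod_encode[OF that]] by simp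
  define T0 where "T0 n = pfst (F n 0)" for n
  define u where "u n m = psnd (F n m)" for n m
  have level: "pfst (F n m) = T0 n + m" for n m
    by (induction m) (use F(3) in \<open>auto simp: T0_def E_def\<close>)
  have small_u: "small (T0 n + m) (u n m)" for n m
    using F(2)[of n m] unfolding S_def level u_def by blast
  have "\<exists>y. y \<in> P (u n m) \<inter> P (u n (Suc m))" for n m using F(3)[of n m] unfolding E_def u_def by blast
  \<comment> \<open>These points only witness that consecutive sets meet and are not computed; the
    names of the limits come from \<open>mem\<close> below.\<close>
  then obtain z where z: "\<And>n m. z n m \<in> P (u n m) \<inter> P (u n (Suc m))" by metis
  have zc: "z n m \<in> carrier G" for n m using z P_carrier by blast
  have close: "inv (z n m) \<otimes> z n (Suc m) \<in> C (T0 n + Suc m)" for n m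
    using small_quotient[OF small_u[of n "Suc m"], of "z n m" "z n (Suc m)"] z[of n m] z[of n "Suc m"] U_subset_C by blast
  have "\<exists>x. x \<in> carrier G \<and> (\<forall>m. inv (z n m) \<otimes> x \<in> C (T0 n + m))" for n
    by (rule limit_point[of "z n" "T0 n", OF zc close]) blast
  then obtain \<alpha> where \<alpha>: "\<And>n. \<alpha> n \<in> carrier G" "\<And>n m. inv (z n m) \<otimes> \<alpha> n \<in> C (T0 n + m)" by metis
  \<comment> \<open>One level is lost in joining the quotient inside the small set to the quotient
    from \<open>z n m\<close> to the limit.\<close>
  have near: "inv y \<otimes> \<alpha> n \<in> C t" if "y \<in> P (u n m)" "Suc t \<le> T0 n + m" for n m y t
  proof -
    have "inv y \<otimes> z n m \<in> C (T0 n + m)"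
      using small_quotient[OF small_u that(1)] z[of n m] U_subset_C by blast
    then have "inv y \<otimes> z n m \<in> C (Suc t)" "inv (z n m) \<otimes> \<alpha> n \<in> C (Suc t)"
      using C_antimono[OF that(2)] \<alpha>(2)[of n m] by blast+
    from square[OF this] show ?thesis
      using P_carrier[OF that(1)] zc \<alpha>(1) U_subset_C[of t] by (auto simp: quotient_mult)
  qed
  \<comment> \<open>The set with index \<open>Suc m\<close> is one level finer than
    \<open>C (T0 n + m)\<close>, which is the level that \<open>near\<close> loses. The right-hand
    side asks for a point in a c.e. open set, by the tube lemma.\<close>
  have mem: "\<alpha> n \<in> B j \<longleftrightarrow> (\<exists>m y. y \<in> P (u n (Suc m)) \<inter> {y \<in> carrier G. \<forall>c\<in>C (T0 n + m). y \<otimes> c \<in> B j})" for n j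
  proof
    assume "\<exists>m y. y \<in> P (u n (Suc m)) \<inter> {y \<in> carrier G. \<forall>c\<in>C (T0 n + m). y \<otimes> c \<in> B j}"
    then obtain m y where y: "y \<in> P (u n (Suc m))" "y \<in> carrier G" "\<forall>c\<in>C (T0 n + m). y \<otimes> c \<in> B j" by blast
    have "y \<otimes> (inv y \<otimes> \<alpha> n) \<in> B j" using y(3) near[OF y(1), of "T0 n + m"] by simp
    then show "\<alpha> n \<in> B j" using y(2) \<alpha>(1) by (simp add: m_assoc[symmetric])
  next
    assume "\<alpha> n \<in> B j"
    then obtain t where t: "\<And>c. c \<in> C t \<Longrightarrow> \<alpha> n \<otimes> c \<in> B j" by (rule neighbourhood_base_at[OF openin_base]) (rule that)
    \<comment> \<open>Two levels beyond \<open>t\<close>: one is lost in \<open>near\<close> and one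
      in \<open>square\<close>.\<close>
    define y where "y = z n (Suc (Suc t))"
    have y: "y \<in> P (u n (Suc (Suc t)))" "y \<in> carrier G" using z zc by (auto simp: y_def)
    have "y \<otimes> c \<in> B j" if c: "c \<in> C (T0 n + Suc t)" for c
    proof -
      have "inv y \<otimes> \<alpha> n \<in> C (Suc t)" by (rule near[OF y(1)]) simp
      then have "inv (inv y \<otimes> \<alpha> n) \<in> C (Suc t)" by (rule inv_C)
      moreover have "c \<in> C (Suc t)" using C_antimono[of "Suc t" "T0 n + Suc t"] c by auto
      ultimately have "inv (inv y \<otimes> \<alpha> n) \<otimes> c \<in> C t" using square U_subset_C by blast
      then have "\<alpha> n \<otimes> (inv (inv y \<otimes> \<alpha> n) \<otimes> c) \<in> B j" by (rule t)
      moreover have "\<alpha> n \<otimes> (inv (inv y \<otimes> \<alpha> n) \<otimes> c) = y \<otimes> c"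
        using y(2) \<alpha>(1)[of n] C_carrier[OF c] by (simp add: inv_mult_group m_assoc[symmetric])
      ultimately show ?thesis by simp
    qed
    then have "y \<in> P (u n (Suc (Suc t))) \<inter> {y \<in> carrier G. \<forall>c\<in>C (T0 n + Suc t). y \<otimes> c \<in> B j}" using y by blast
    then show "\<exists>m y. y \<in> P (u n (Suc m)) \<inter> {y \<in> carrier G. \<forall>c\<in>C (T0 n + m). y \<otimes> c \<in> B j}" by blast
  qed
  have "semidecidable (\<lambda>v. \<exists>m y. y \<in> P (u (pfst v) (Suc m)) \<inter>
      {y \<in> carrier G. \<forall>c\<in>C (T0 (pfst v) + m). y \<otimes> c \<in> B (psnd v)})"
    unfolding u_def T0_def
    by (intro semidecidable_ex semidecidable_nonempty open_family_Int open_family_all_compact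
        open_family_comp[OF P] compact_family_comp[OF compact_C] rF computability)
  then have "point_family \<alpha>" unfolding point_family_def using mem \<alpha>(1) by auto
  moreover have "\<exists>n. \<alpha> n \<in> N" if N: "openin T N" "N \<noteq> {}" for N
  proof -
    obtain y where y: "y \<in> N" using N(2) by blast
    have yc: "y \<in> carrier G" using openin_subset[OF N(1)] y by auto
    obtain t where t: "\<And>c. c \<in> C t \<Longrightarrow> y \<otimes> c \<in> N" using N(1) y by (rule neighbourhood_base_at) (rule that)
    \<comment> \<open>Every small non-empty set starts one of the sequences, in particular this one
      around \<open>y\<close>, which is one level finer than \<open>t\<close>.\<close>
    obtain w where w: "small (Suc t) w" "y \<in> P w" using small_ex[OF yc] by blast
    then have "S (prod_encode (Suc t, w))" by (auto simp: S_def)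
    then obtain n where n: "F n 0 = prod_encode (Suc t, w)" using F(4) by blast
    have "inv y \<otimes> \<alpha> n \<in> C t" by (rule near[of y n 0]) (use n w(2) in \<open>auto simp: u_def T0_def\<close>)
    then have "y \<otimes> (inv y \<otimes> \<alpha> n) \<in> N" by (rule t)
    then show ?thesis using yc \<alpha>(1)[of n] by (auto simp: m_assoc[symmetric])
  qed
  ultimately show ?thesis by (rule that)
qed

end

section \<open>Large neighbourhoods exhausting the group\<close>

locale dense_sequence = neighbourhood_sequence +
  fixes \<alpha> :: "nat \<Rightarrow> 'a"
  assumes points: "point_family \<alpha>" and dense: "openin T N \<Longrightarrow> N \<noteq> {} \<Longrightarrow> \<exists>n. \<alpha> n \<in> N"
begin

lemma point_carrier [simp]: "\<alpha> n \<in> carrier G"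
  by (rule point_familyD[OF points])

lemma compact_cube:
  assumes K: "compactin T K"
  shows "compactin T ((\<lambda>(x, y). x \<otimes> y) ` (((\<lambda>(x, y). x \<otimes> y) ` (K \<times> K)) \<times> K))"
  by (intro image_compactin[OF _ continuous_mult]) (simp add: compactin_Times K image_compactin[OF _ continuous_mult])

lemma translates_cover:
  assumes "y \<in> carrier G" shows "\<exists>s. inv (\<alpha> s) \<otimes> y \<in> U t"
proof -
  have "y \<in> {a \<in> carrier G. inv a \<otimes> y \<in> U t}" using assms one_U by simp
  then show ?thesis using dense[OF openin_quotient[OF assms openin_open_family[OF open_U]], of t] by blast
qed

text \<open>Here the sets grow with \<open>t\<close>: the cube of the present compact set is
  compact, so finitely many translates of \<open>U 0\<close> cover it, and a search finds such a
  list. Each list also gives a compact set, the union of the corresponding translates of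
  \<open>C 0\<close>, for the next step.\<close>

lemma large_neighbourhoods:
  obtains V H where "open_family V" "compact_family H" "\<And>t. V t \<subseteq> H t"
    "\<And>t x. x \<in> V t \<Longrightarrow> inv x \<in> V t"
    "\<And>t x y z. x \<in> H t \<Longrightarrow> y \<in> H t \<Longrightarrow> z \<in> H t \<Longrightarrow> x \<otimes> y \<otimes> z \<in> V (Suc t)"
    "\<And>x y z. x \<in> C 0 \<Longrightarrow> y \<in> C 0 \<Longrightarrow> z \<in> C 0 \<Longrightarrow> x \<otimes> y \<otimes> z \<in> V 0"
    "\<And>x. x \<in> carrier G \<Longrightarrow> \<exists>t. x \<in> V t"
proof -
  define Y where "Y c = (\<Union>s\<in>code_set c. {y \<in> carrier G. inv (\<alpha> s) \<otimes> y \<in> U 0})" for c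
  define Z where "Z c = (\<Union>s\<in>code_set c. (\<lambda>y. \<alpha> s \<otimes> y) ` C 0)" for c
  define V where "V c = Y c \<union> {y \<in> carrier G. inv y \<in> Y c}" for c
  define H where "H c = Z c \<union> (\<lambda>x. inv x) ` Z c" for c
  have V: "open_family V" unfolding V_def Y_def
    by (intro computability point_family_comp[OF points] open_family_comp[OF open_U])
  have H: "compact_family H" unfolding H_def Z_def
    by (intro computability point_family_comp[OF points] compact_family_comp[OF compact_C])
  have Yc: "x \<in> carrier G" if "x \<in> Y c" for x c using that by (auto simp: Y_def)
  have YZ: "x \<in> Z c" if x: "x \<in> Y c" for x c
  proof -
    obtain s where s: "s \<in> code_set c" "x \<in> carrier G" "inv (\<alpha> s) \<otimes> x \<in> C 0"
      using x U_subset_C[of 0] by (auto simp: Y_def)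
    have "x = \<alpha> s \<otimes> (inv (\<alpha> s) \<otimes> x)" using s(2) by (simp add: m_assoc[symmetric])
    then show ?thesis using s unfolding Z_def by blast
  qed
  have VH: "V c \<subseteq> H c" for c
  proof
    fix x assume "x \<in> V c"
    then consider "x \<in> Z c" | "x \<in> carrier G" "inv x \<in> Z c" using YZ by (auto simp: V_def)
    then show "x \<in> H c"
    proof cases
      case 2
      then have "inv (inv x) \<in> H c" unfolding H_def by blast
      then show ?thesis using 2 by simp
    qed (simp add: H_def)
  qed
  have V_inv: "inv x \<in> V c" if "x \<in> V c" for x c using that Yc by (auto simp: V_def)
  \<comment> \<open>The additional index \<open>m\<close> can be prescribed because a further
    translate only enlarges the cover.\<close>
  have V_cover: "\<exists>c. L \<subseteq> V c \<and> m \<in> code_set c" if L: "compactin T L" for L m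
  proof -
    have "L \<subseteq> (\<Union>s\<in>UNIV. {y \<in> carrier G. inv (\<alpha> s) \<otimes> y \<in> U 0})"
      using compactin_subset_topspace[OF L] translates_cover by auto
    then obtain c where "L \<subseteq> Y c" unfolding Y_def
      by (rule compact_subcover[OF L]) (intro openin_left openin_open_family[OF open_U] inv_closed point_carrier)
    then have "L \<subseteq> V (list_encode (m # list_decode c))" by (auto simp: V_def Y_def simp del: list_encode.simps)
    then show ?thesis by (intro exI[of _ "list_encode (m # list_decode c)"]) (simp del: list_encode.simps)
  qed
  have cube_cover: "\<exists>c. (\<forall>x\<in>L. \<forall>y\<in>L. \<forall>z\<in>L. x \<otimes> y \<otimes> z \<in> V c) \<and> m \<in> code_set c" if L: "compactin T L" for L m
  proof -
    obtain c where c: "(\<lambda>(x, y). x \<otimes> y) ` (((\<lambda>(x, y). x \<otimes> y) ` (L \<times> L)) \<times> L) \<subseteq> V c" "m \<in> code_set c"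
      using V_cover[OF compact_cube[OF L]] by blast
    have "x \<otimes> y \<otimes> z \<in> V c" if "x \<in> L" "y \<in> L" "z \<in> L" for x y z
      by (rule subsetD[OF c(1)]) (use that in force)
    then show ?thesis using c(2) by blast
  qed
  \<comment> \<open>The last conjunct puts the translate of \<open>U 0\<close> by the point of index
    \<open>t\<close> into level \<open>t + 1\<close>; by density the levels then exhaust the
    group.\<close>
  define R where "R u v \<longleftrightarrow> pfst v = Suc (pfst u) \<and>
      (\<forall>x\<in>H (psnd u). \<forall>y\<in>H (psnd u). \<forall>z\<in>H (psnd u). x \<otimes> y \<otimes> z \<in> V (psnd v)) \<and> pfst u \<in> code_set (psnd v)" for u v
  have R_semi: "semidecidable (\<lambda>z. R (pfst z) (psnd z))" unfolding R_def
    by (intro semidecidable_conj semidecidable_compact_cube compact_family_comp[OF H]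
        open_family_comp[OF V] computability)
  have R_ex: "\<exists>v. True \<and> R u v" for u
  proof -
    obtain c where "\<forall>x\<in>H (psnd u). \<forall>y\<in>H (psnd u). \<forall>z\<in>H (psnd u). x \<otimes> y \<otimes> z \<in> V c" "pfst u \<in> code_set c"
      using cube_cover[OF compact_familyD[OF H]] by blast
    then have "R u (prod_encode (Suc (pfst u), c))" unfolding R_def by simp
    then show ?thesis by blast
  qed
  obtain F where F: "recursive (\<lambda>z. F (pfst z) (psnd z))" "\<And>n t. True" "\<And>n t. R (F n t) (F n (Suc t))"
      "\<And>x. True \<Longrightarrow> \<exists>n. F n 0 = x"
    by (rule semidecidable_dependent_choice[of "\<lambda>_. True" 0 R, OF semidecidable_basic(1) TrueI R_semi R_ex])
       (rule that)
  \<comment> \<open>The first list covers the cube of \<open>C 0\<close>, which glues the large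
    neighbourhoods to the small ones.\<close>
  obtain c0 where c0: "\<forall>x\<in>C 0. \<forall>y\<in>C 0. \<forall>z\<in>C 0. x \<otimes> y \<otimes> z \<in> V c0"
    using cube_cover[OF compact_familyD[OF compact_C]] by blast
  obtain m where m: "F m 0 = prod_encode (0, c0)" using F(4)[OF TrueI] by blast
  have pf: "pfst (F m t) = t" for t
    by (induction t) (use m F(3) in \<open>auto simp: R_def\<close>)
  have "recursive (F m)"
    using recursive_comp[OF F(1) recursive_prod_encode[OF recursive_const[of m] recursive_id]] by simp
  then have rec: "recursive (\<lambda>t. psnd (F m t))" by (rule recursive_psnd)
  have step: "\<forall>x\<in>H (psnd (F m t)). \<forall>y\<in>H (psnd (F m t)). \<forall>z\<in>H (psnd (F m t)). x \<otimes> y \<otimes> z \<in> V (psnd (F m (Suc t)))"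
      "t \<in> code_set (psnd (F m (Suc t)))" for t
    using F(3)[of m t] unfolding R_def pf by blast+
  show ?thesis
  proof (rule that[of "\<lambda>t. V (psnd (F m t))" "\<lambda>t. H (psnd (F m t))"])
    show "open_family (\<lambda>t. V (psnd (F m t)))" by (rule open_family_comp[OF V rec])
    show "compact_family (\<lambda>t. H (psnd (F m t)))" by (rule compact_family_comp[OF H rec])
    show "V (psnd (F m t)) \<subseteq> H (psnd (F m t))" for t by (rule VH)
    show "inv x \<in> V (psnd (F m t))" if "x \<in> V (psnd (F m t))" for t x using that by (rule V_inv)
    show "x \<otimes> y \<otimes> z \<in> V (psnd (F m (Suc t)))" if "x \<in> H (psnd (F m t))" "y \<in> H (psnd (F m t))"
        "z \<in> H (psnd (F m t))" for t x y z using step(1) that by blast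
    show "x \<otimes> y \<otimes> z \<in> V (psnd (F m 0))" if "x \<in> C 0" "y \<in> C 0" "z \<in> C 0" for x y z
      using c0 that m by simp
    show "\<exists>t. x \<in> V (psnd (F m t))" if x: "x \<in> carrier G" for x
    proof -
      obtain s where "inv (\<alpha> s) \<otimes> x \<in> U 0" using translates_cover[OF x] by blast
      then have "x \<in> V (psnd (F m (Suc s)))" using step(2)[of s] x by (auto simp: V_def Y_def)
      then show ?thesis by blast
    qed
  qed
qed

end

section \<open>The metric of a scale of neighbourhoods\<close>

text \<open>This part of the argument is pure group theory. \<open>A_cover\<close> makes the
  distance finite, \<open>A_separated\<close> makes it positive between distinct points, and
  \<open>cube_A\<close> links it back to the sets.\<close>

locale neighbourhood_scale = group G for G (structure) +
  fixes A :: "int \<Rightarrow> 'a set"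
  assumes A_carrier: "x \<in> A i \<Longrightarrow> x \<in> carrier G"
    and one_A: "\<one> \<in> A i" and inv_A: "x \<in> A i \<Longrightarrow> inv x \<in> A i"
    and cube_A: "x \<in> A (i + 1) \<Longrightarrow> y \<in> A (i + 1) \<Longrightarrow> z \<in> A (i + 1) \<Longrightarrow> x \<otimes> y \<otimes> z \<in> A i"
    and A_cover: "x \<in> carrier G \<Longrightarrow> \<exists>i. x \<in> A i"
    and A_separated: "x \<in> carrier G \<Longrightarrow> (\<And>i. x \<in> A i) \<Longrightarrow> x = \<one>"
begin

definition weight :: "int \<Rightarrow> real" where "weight i = 2 powi (- i)"

lemma weight_pos [simp]: "0 < weight i"
  by (simp add: weight_def)

lemma weight_Suc: "weight (i + 1) = weight i / 2"
proof -
  have "(2::real) powi (- i) = 2 powi (- (i + 1)) * 2" using power_int_add_1[of "2::real" "- (i + 1)"] by simp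
  then show ?thesis by (simp add: weight_def)
qed

lemma weight_less_iff: "weight i < weight j \<longleftrightarrow> j < i"
proof -
  have "weight i < weight j" if "j < i" for i j
    using that unfolding weight_def by (intro power_int_strict_increasing) auto
  then show ?thesis by (metis linorder_less_linear order_less_asym)
qed

lemma A_antimono: assumes "i \<le> j" shows "A j \<subseteq> A i"
  using assms
proof (induction rule: int_ge_induct)
  case (step j)
  have "A (j + 1) \<subseteq> A j" using cube_A[OF _ one_A one_A] A_carrier by fastforce
  then show ?case using step by blast
qed simp

section \<open>Chains and their weights\<close>

text \<open>The number of links is recorded as the measure for the induction in
  \<open>chain_less_weight\<close>.\<close>

inductive chain :: "nat \<Rightarrow> 'a \<Rightarrow> real \<Rightarrow> 'a \<Rightarrow> bool" where
  chain_refl: "x \<in> carrier G \<Longrightarrow> chain 0 x 0 x"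
| chain_step: "chain n x r y \<Longrightarrow> z \<in> carrier G \<Longrightarrow> inv y \<otimes> z \<in> A i \<Longrightarrow> chain (Suc n) x (r + weight i) z"

lemma chain_carrier: "chain n x r y \<Longrightarrow> x \<in> carrier G \<and> y \<in> carrier G \<and> 0 \<le> r"
  by (induction rule: chain.induct) (auto simp: add_nonneg_nonneg less_imp_le)

lemma chain_single: "x \<in> carrier G \<Longrightarrow> y \<in> carrier G \<Longrightarrow> inv x \<otimes> y \<in> A i \<Longrightarrow> chain (Suc 0) x (weight i) y"
  using chain_step[OF chain_refl] by fastforce

lemma chain_trans: "chain m y s z \<Longrightarrow> chain n x r y \<Longrightarrow> chain (n + m) x (r + s) z"
proof (induction rule: chain.induct)
  case (chain_step m y s z v i)
  then have "chain (Suc (n + m)) x ((r + s) + weight i) v" by (intro chain.chain_step)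
  then show ?case by (simp add: add.assoc)
qed simp

lemma chain_sym: "chain n x r y \<Longrightarrow> chain n y r x"
proof (induction rule: chain.induct)
  case (chain_step n x r y z i)
  have c: "x \<in> carrier G" "y \<in> carrier G" "z \<in> carrier G"
    using chain_carrier chain_step by blast+
  have "inv (inv y \<otimes> z) \<in> A i" by (rule inv_A) (rule chain_step)
  then have "chain (Suc 0) z (weight i) y" using c by (intro chain_single) (auto simp: inv_mult_group)
  then show ?case using chain_trans[OF chain_step.IH] by (fastforce simp: add.commute)
qed (rule chain_refl)

lemma chain_left: "chain n x r y \<Longrightarrow> g \<in> carrier G \<Longrightarrow> chain n (g \<otimes> x) r (g \<otimes> y)"
proof (induction rule: chain.induct)
  case (chain_refl x)
  then show ?case by (intro chain.chain_refl) simp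
next
  case (chain_step n x r y z i)
  have c: "y \<in> carrier G" using chain_carrier chain_step by blast
  have "inv (g \<otimes> y) \<otimes> (g \<otimes> z) = inv y \<otimes> z"
    using c chain_step(2,5) by (simp add: inv_mult_group m_assoc) (simp add: m_assoc[symmetric])
  then show ?case using chain_step by (intro chain.chain_step) auto
qed

text \<open>The link singled out is the one whose addition first takes the partial weight above
  \<open>c\<close>.\<close>

lemma chain_split:
  assumes "chain n x r y" "0 \<le> c" "c < r"
  shows "\<exists>k r1 u i v k' r2. chain k x r1 u \<and> v \<in> carrier G \<and> inv u \<otimes> v \<in> A i \<and> chain k' v r2 y \<and>
    n = Suc (k + k') \<and> r1 \<le> c \<and> c < r1 + weight i \<and> r = r1 + weight i + r2"
  using assms
proof (induction rule: chain.induct)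
  case (chain_step n x r y z i)
  show ?case
  proof (cases "r \<le> c")
    case True
    then show ?thesis using chain_step chain_refl[of z]
      by (intro exI[of _ n] exI[of _ r] exI[of _ y] exI[of _ i] exI[of _ z] exI[of _ 0] exI[of _ "0::real"]) auto
  next
    case False
    then obtain k r1 u j v k' r2 where s: "chain k x r1 u" "v \<in> carrier G" "inv u \<otimes> v \<in> A j" "chain k' v r2 y"
        "n = Suc (k + k')" "r1 \<le> c" "c < r1 + weight j" "r = r1 + weight j + r2"
      using chain_step.IH chain_step.prems by auto
    have "chain (Suc k') v (r2 + weight i) z" using s(4) chain_step.hyps by (intro chain.chain_step)
    then show ?thesis using s
      by (intro exI[of _ k] exI[of _ r1] exI[of _ u] exI[of _ j] exI[of _ v] exI[of _ "Suc k'"]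
          exI[of _ "r2 + weight i"]) auto
  qed
qed simp

text \<open>The Birkhoff--Kakutani argument: the link of a chain that contains its midpoint in weight splits
  off two shorter chains of at most half the weight.\<close>

lemma chain_less_weight: "chain n x r y \<Longrightarrow> r < weight i \<Longrightarrow> inv x \<otimes> y \<in> A i"
proof (induction n arbitrary: x r y i rule: less_induct)
  case (less n)
  have c: "x \<in> carrier G" "y \<in> carrier G" using chain_carrier less.prems by blast+
  show ?case
  proof (cases n)
    case 0
    then have "x = y" using less.prems(1) by (auto elim: chain.cases)
    then show ?thesis using c one_A by simp
  next
    case (Suc m)
    then obtain r' y' j' where "chain m x r' y'" "r = r' + weight j'" using less.prems(1) by (auto elim: chain.cases)
    then have r: "0 < r" using chain_carrier weight_pos[of j'] by (metis add_nonneg_pos)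
    obtain k r1 u j v k' r2 where s: "chain k x r1 u" "v \<in> carrier G" "inv u \<otimes> v \<in> A j" "chain k' v r2 y"
        "n = Suc (k + k')" "r1 \<le> r / 2" "r / 2 < r1 + weight j" "r = r1 + weight j + r2"
      using chain_split[OF less.prems(1), of "r / 2"] r by auto
    have u: "u \<in> carrier G" "0 \<le> r1" "0 \<le> r2" using chain_carrier s by blast+
    \<comment> \<open>The link weighs at most \<open>r\<close>, hence strictly less than
      \<open>weight i\<close>, so it belongs to level \<open>i + 1\<close> at least. Each side
      weighs at most \<open>r / 2\<close>, which is less than \<open>weight (i + 1)\<close>, and has
      fewer links.\<close>
    have "weight j < weight i" using s(8) u less.prems(2) by linarith
    then have "A j \<subseteq> A (i + 1)" by (intro A_antimono) (simp add: weight_less_iff)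
    then have "inv u \<otimes> v \<in> A (i + 1)" using s(3) by blast
    moreover have "inv x \<otimes> u \<in> A (i + 1)"
      by (rule less.IH[OF _ s(1)]) (use s(5,6) less.prems(2) weight_Suc[of i] in auto)
    moreover have "inv v \<otimes> y \<in> A (i + 1)"
      by (rule less.IH[OF _ s(4)]) (use s(5,7,8) less.prems(2) weight_Suc[of i] in auto)
    ultimately have "(inv x \<otimes> u) \<otimes> (inv u \<otimes> v) \<otimes> (inv v \<otimes> y) \<in> A i" by (intro cube_A)
    moreover have "(inv x \<otimes> u) \<otimes> (inv u \<otimes> v) \<otimes> (inv v \<otimes> y) = inv x \<otimes> y"
      using c u(1) s(2) by (simp add: quotient_mult)
    ultimately show ?thesis by simp
  qed
qed

section \<open>The left-invariant chain metric\<close>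

text \<open>The value 0 off the carrier keeps the function symmetric and nonnegative on the whole
  type, as \<open>Metric_space\<close> demands.\<close>

definition chain_dist :: "'a \<Rightarrow> 'a \<Rightarrow> real" where
  "chain_dist x y = (if x \<in> carrier G \<and> y \<in> carrier G then Inf {r. \<exists>n. chain n x r y} else 0)"

lemma chain_exists: "x \<in> carrier G \<Longrightarrow> y \<in> carrier G \<Longrightarrow> \<exists>n r. chain n x r y"
  using A_cover[of "inv x \<otimes> y"] chain_single by blast

lemma chain_bdd_below: "bdd_below {r. \<exists>n. chain n x r y}"
  by (rule bdd_belowI[of _ 0]) (use chain_carrier in blast)

text \<open>A strict upper bound on an infimum is an existential statement; this is where the
  distance becomes right-c.e.\<close>

lemma chain_dist_less_iff:
  assumes "x \<in> carrier G" "y \<in> carrier G" shows "chain_dist x y < q \<longleftrightarrow> (\<exists>n r. chain n x r y \<and> r < q)"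
proof -
  have "{r. \<exists>n. chain n x r y} \<noteq> {}" using chain_exists[OF assms] by blast
  then have "Inf {r. \<exists>n. chain n x r y} < q \<longleftrightarrow> (\<exists>r\<in>{r. \<exists>n. chain n x r y}. r < q)"
    by (rule cInf_less_iff[OF _ chain_bdd_below])
  then show ?thesis using assms by (auto simp: chain_dist_def)
qed

lemma chain_dist_le: "chain n x r y \<Longrightarrow> chain_dist x y \<le> r"
  using chain_dist_less_iff[of x y] chain_carrier by (metis dense_le linorder_le_less_linear order.strict_trans1 order_less_irrefl)

lemma chain_dist_le_weight: "x \<in> carrier G \<Longrightarrow> y \<in> carrier G \<Longrightarrow> inv x \<otimes> y \<in> A i \<Longrightarrow> chain_dist x y \<le> weight i"
  by (rule chain_dist_le[OF chain_single])

lemma chain_dist_less_weight: "x \<in> carrier G \<Longrightarrow> y \<in> carrier G \<Longrightarrow> chain_dist x y < weight i \<Longrightarrow> inv x \<otimes> y \<in> A i"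
  using chain_dist_less_iff chain_less_weight by blast

lemma chain_dist_nonneg: "0 \<le> chain_dist x y"
proof (cases "x \<in> carrier G \<and> y \<in> carrier G")
  case True
  then have "\<not> chain_dist x y < 0" using chain_dist_less_iff chain_carrier by (metis not_less)
  then show ?thesis by simp
qed (auto simp: chain_dist_def)

lemma chain_dist_commute: "chain_dist x y = chain_dist y x"
proof -
  have "{r. \<exists>n. chain n x r y} = {r. \<exists>n. chain n y r x}" using chain_sym by blast
  then show ?thesis by (auto simp: chain_dist_def)
qed

lemma chain_dist_triangle:
  assumes "x \<in> carrier G" "y \<in> carrier G" "z \<in> carrier G" shows "chain_dist x z \<le> chain_dist x y + chain_dist y z"
proof (rule field_le_epsilon)
  fix e :: real assume e: "0 < e"
  obtain n r where r: "chain n x r y" "r < chain_dist x y + e / 2"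
    using chain_dist_less_iff[OF assms(1,2), of "chain_dist x y + e / 2"] e by auto
  obtain m s where s: "chain m y s z" "s < chain_dist y z + e / 2"
    using chain_dist_less_iff[OF assms(2,3), of "chain_dist y z + e / 2"] e by auto
  have "chain_dist x z \<le> r + s" by (rule chain_dist_le[OF chain_trans[OF s(1) r(1)]])
  then show "chain_dist x z \<le> chain_dist x y + chain_dist y z + e" using r(2) s(2) by linarith
qed

lemma Metric_space_dist: "Metric_space (carrier G) chain_dist"
proof
  show "chain_dist x y = 0 \<longleftrightarrow> x = y" if xy: "x \<in> carrier G" "y \<in> carrier G" for x y
  proof
    assume "chain_dist x y = 0"
    then have "inv x \<otimes> y \<in> A i" for i using chain_dist_less_weight[OF xy, of i] by simp
    then have "inv x \<otimes> y = \<one>" using A_separated[of "inv x \<otimes> y"] xy by simp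
    then show "x = y" using xy by (metis inv_closed inv_equality inv_inv)
  next
    assume "x = y"
    then show "chain_dist x y = 0" using chain_dist_le[OF chain_refl[OF xy(1)]] chain_dist_nonneg[of x x] by simp
  qed
qed (use chain_dist_nonneg chain_dist_commute chain_dist_triangle in auto)

lemma left_invariant_dist: "left_invariant G chain_dist"
  unfolding left_invariant_def
proof (intro ballI)
  fix x y g assume c: "x \<in> carrier G" "y \<in> carrier G" "g \<in> carrier G"
  have "chain n x r y \<longleftrightarrow> chain n (g \<otimes> x) r (g \<otimes> y)" for n r
    using chain_left[of n x r y g] chain_left[of n "g \<otimes> x" r "g \<otimes> y" "inv g"] c
    by (auto simp: m_assoc[symmetric])
  then show "chain_dist (g \<otimes> x) (g \<otimes> y) = chain_dist x y" using c by (simp add: chain_dist_def)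
qed

end

section \<open>Effectivity of the metric\<close>

text \<open>An integer is coded as a difference of two naturals, so that its weight is a quotient of
  two recursive powers of 2. Codes are not unique; surjectivity is what the coding has to
  provide.\<close>

definition level :: "nat \<Rightarrow> int" where "level u = int (psnd u) - int (pfst u)"

lemma level_surj: obtains u where "level u = i"
  by (rule that[of "prod_encode (nat (- i), nat i)"]) (simp add: level_def)

lemma pos_rat_eq: "pos_rat m = real (Suc (pfst m)) / real (Suc (psnd m))"
  by (simp add: pos_rat_def case_prod_beta)

lemma divide_less_divide_nat:
  assumes "0 < b" "0 < d"
  shows "real a / real b < real c / real d \<longleftrightarrow> a * d < c * b"
proof -
  have "real a / real b < real c / real d \<longleftrightarrow> real a * real d < real c * real b"
    using assms by (simp add: field_simps)
  then show ?thesis by (metis of_nat_less_iff of_nat_mult)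
qed

lemma real_of_nat_to_rat_surj:
  "real_of_rat (nat_to_rat_surj n) = real_of_int (int_decode (pfst n)) / real_of_int (int_decode (psnd n))"
  by (cases "int_decode (psnd n) = 0")
     (simp_all add: nat_to_rat_surj_def case_prod_beta rat_number_collapse of_rat_rat)

text \<open>Even numbers decode to nonnegative integers \<open>k div 2\<close>, odd ones to
  \<open>- (k div 2) - 1\<close>. The rational is positive only if numerator and denominator have
  the same sign and the denominator is not 0; then the inequality is cross-multiplied into one
  between naturals.\<close>

lemma pos_rat_less_rat_iff: "pos_rat m < real_of_rat (nat_to_rat_surj n) \<longleftrightarrow>
    even (pfst n) \<and> even (psnd n) \<and> 0 < psnd n div 2 \<and>
      Suc (pfst m) * (psnd n div 2) < pfst n div 2 * Suc (psnd m) \<or>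
    \<not> even (pfst n) \<and> \<not> even (psnd n) \<and>
      Suc (pfst m) * Suc (psnd n div 2) < Suc (pfst n div 2) * Suc (psnd m)"
proof -
  define a b where "a = pfst n div 2" and "b = psnd n div 2"
  have pos: "0 < pos_rat m" by (simp add: pos_rat_eq)
  have nonpos: "\<not> pos_rat m < r" if "r \<le> 0" for r using pos that by linarith
  have dec: "int_decode k = (if even k then int (k div 2) else - int (k div 2) - 1)" for k
    by (simp add: int_decode_def sum_decode_def)
  consider "even (pfst n)" "even (psnd n)" "0 < b" | "even (pfst n)" "even (psnd n)" "b = 0"
    | "even (pfst n)" "\<not> even (psnd n)" | "\<not> even (pfst n)" "even (psnd n)"
    | "\<not> even (pfst n)" "\<not> even (psnd n)" by blast
  then show ?thesis
  proof cases
    case 1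
    then have "real_of_rat (nat_to_rat_surj n) = real a / real b"
      by (simp add: real_of_nat_to_rat_surj dec a_def b_def)
    then show ?thesis unfolding pos_rat_eq using 1 by (simp add: divide_less_divide_nat a_def b_def del: of_nat_Suc)
  next
    case 2
    then have "real_of_rat (nat_to_rat_surj n) = 0"
      by (simp add: real_of_nat_to_rat_surj dec b_def)
    then show ?thesis using nonpos 2 by (simp add: b_def)
  next
    case 3
    then have "real_of_rat (nat_to_rat_surj n) = real a / (- real b - 1)"
      by (simp add: real_of_nat_to_rat_surj dec a_def b_def)
    moreover have "real a / (- real b - 1) \<le> 0" by (intro divide_nonneg_nonpos) auto
    ultimately show ?thesis using nonpos 3 by simp
  next
    case 4
    then have "real_of_rat (nat_to_rat_surj n) = (- real a - 1) / real b"
      by (simp add: real_of_nat_to_rat_surj dec a_def b_def)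
    moreover have "(- real a - 1) / real b \<le> 0" by (intro divide_nonpos_nonneg) auto
    ultimately show ?thesis using nonpos 4 by simp
  next
    case 5
    then have "real_of_rat (nat_to_rat_surj n) = (- real a - 1) / (- real b - 1)"
      by (simp add: real_of_nat_to_rat_surj dec a_def b_def)
    also have "\<dots> = - real (Suc a) / - real (Suc b)"
      by (rule arg_cong2[where f="(/)"]) simp_all
    also have "\<dots> = real (Suc a) / real (Suc b)" by (rule minus_divide_divide)
    finally show ?thesis unfolding pos_rat_eq using 5 by (simp add: divide_less_divide_nat a_def b_def del: of_nat_Suc)
  qed
qed

lemma semidecidable_pos_rat_less_rat:
  assumes "recursive f" "recursive g"
  shows "semidecidable (\<lambda>x. pos_rat (f x) < real_of_rat (nat_to_rat_surj (g x)))"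
  unfolding pos_rat_less_rat_iff
  by (intro semidecidable_decidable computability assms)

locale computable_scale = dense_sequence G T B U C \<alpha> + neighbourhood_scale G A
  for G (structure) and T B U C \<alpha> A +
  fixes K :: "int \<Rightarrow> 'a set"
  assumes open_A: "open_family (\<lambda>u. A (level u))" and compact_K: "compact_family (\<lambda>u. K (level u))"
    and A_subset_K: "A i \<subseteq> K i"
    and A_small: "A (int t) = U t" and K_small: "K (int t) = C t"
begin

abbreviation ball :: "nat \<Rightarrow> 'a set" where "ball \<equiv> basic_ball (carrier G) chain_dist \<alpha>"

sublocale metric: Metric_space "carrier G" chain_dist
  by (rule Metric_space_dist)

lemma weight_level: "weight (level u) = 2 ^ pfst u / 2 ^ psnd u"
  by (simp add: weight_def level_def power_int_diff)

lemma weight_archimedean: assumes "0 < (e::real)" obtains t where "weight (int t) < e"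
proof -
  obtain t where "(1 / 2) ^ t < e" using real_arch_pow_inv[OF assms, of "1 / 2"] by auto
  then show ?thesis by (intro that[of t]) (simp add: weight_def power_int_minus power_one_over inverse_eq_divide)
qed

lemma openin_A: "openin T (A i)"
proof -
  obtain u where "level u = i" by (rule level_surj)
  then show ?thesis using openin_open_family[OF open_A, of u] by simp
qed

text \<open>Balls and translates of the scale interleave: a quotient in \<open>A i\<close> bounds
  the distance by \<open>weight i\<close>, and a distance below \<open>weight i\<close> puts the
  quotient into \<open>A i\<close>.\<close>

lemma mtopology_eq: "metric.mtopology = T"
proof (rule topology_eq[THEN iffD2], intro allI iffI)
  fix V assume "openin metric.mtopology V"
  then have V: "V \<subseteq> carrier G" "\<And>x. x \<in> V \<Longrightarrow> \<exists>r>0. metric.mball x r \<subseteq> V"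
    unfolding metric.openin_mtopology by blast+
  show "openin T V"
  proof (subst openin_subopen, intro ballI)
    fix x assume x: "x \<in> V"
    then have xc: "x \<in> carrier G" using V(1) by blast
    obtain r where r: "0 < r" "metric.mball x r \<subseteq> V" using V(2)[OF x] by blast
    obtain t where t: "weight (int t) < r" using weight_archimedean[OF r(1)] .
    let ?W = "{y \<in> carrier G. inv x \<otimes> y \<in> A (int t)}"
    have "?W \<subseteq> metric.mball x r" using chain_dist_le_weight[OF xc] t xc by fastforce
    moreover have "x \<in> ?W" using xc one_A by simp
    moreover have "openin T ?W" by (rule openin_left[OF inv_closed[OF xc] openin_A])
    ultimately show "\<exists>W. openin T W \<and> x \<in> W \<and> W \<subseteq> V" using r(2) by blast
  qed
next
  fix V assume V: "openin T V"
  show "openin metric.mtopology V" unfolding metric.openin_mtopology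
  proof (intro conjI allI impI)
    show Vc: "V \<subseteq> carrier G" using openin_subset[OF V] by simp
    fix x assume x: "x \<in> V"
    obtain t where t: "\<And>c. c \<in> C t \<Longrightarrow> x \<otimes> c \<in> V" using V x by (rule neighbourhood_base_at) (rule that)
    have "y \<in> V" if y: "y \<in> metric.mball x (weight (int t))" for y
    proof -
      have c: "x \<in> carrier G" "y \<in> carrier G" "chain_dist x y < weight (int t)" using y by auto
      then have "inv x \<otimes> y \<in> C t" using chain_dist_less_weight A_small U_subset_C by blast
      then have "x \<otimes> (inv x \<otimes> y) \<in> V" by (rule t)
      then show ?thesis using c by (simp add: m_assoc[symmetric])
    qed
    then show "\<exists>r>0. metric.mball x r \<subseteq> V" by (intro exI[of _ "weight (int t)"]) auto
  qed
qed

lemma metric_dense: "metric_with_dense_seq (carrier G) chain_dist \<alpha>"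
  unfolding metric_with_dense_seq_def mtopology_eq
proof (intro conjI Metric_space_dist)
  show "range \<alpha> \<subseteq> carrier G" by auto
  show "T closure_of range \<alpha> = carrier G"
    unfolding closure_of_def using dense by fastforce
qed

section \<open>Chains through the dense points\<close>

text \<open>States are triples of a point index, a numerator and a denominator. A link of level
  \<open>u\<close> adds \<open>2 ^ pfst u / 2 ^ psnd u\<close> without reducing the fraction, so the
  weight stays exact and the denominator positive.\<close>

definition link :: "nat \<Rightarrow> nat \<Rightarrow> bool" where
  "link v w \<longleftrightarrow> (\<exists>u. inv (\<alpha> (pfst v)) \<otimes> \<alpha> (pfst w) \<in> A (level u) \<and>
     pfst (psnd w) = pfst (psnd v) * 2 ^ psnd u + 2 ^ pfst u * psnd (psnd v) \<and>
     psnd (psnd w) = psnd (psnd v) * 2 ^ psnd u)"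

text \<open>The code of the endpoint \<open>\<alpha> i\<close> of a chain of weight \<open>N / D\<close>.\<close>

definition state :: "nat \<Rightarrow> nat \<Rightarrow> nat \<Rightarrow> nat" where
  "state i N D = prod_encode (i, prod_encode (N, D))"

lemma semidecidable_link: "semidecidable (\<lambda>z. link (pfst z) (psnd z))"
proof -
  have "semidecidable (\<lambda>z. \<exists>u. \<alpha> (pfst (psnd z)) \<in> {y \<in> carrier G. inv (\<alpha> (pfst (pfst z))) \<otimes> y \<in> A (level u)} \<and>
     pfst (psnd (psnd z)) = pfst (psnd (pfst z)) * 2 ^ psnd u + 2 ^ pfst u * psnd (psnd (pfst z)) \<and>
     psnd (psnd (psnd z)) = psnd (psnd (pfst z)) * 2 ^ psnd u)"
    by (intro semidecidable_ex semidecidable_conj semidecidable_point_open open_family_translate point_family_inv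
        point_family_comp[OF points] open_family_comp[OF open_A] computability)
  then show ?thesis unfolding link_def by simp
qed

lemma link_sound: "link\<^sup>*\<^sup>* (state i 0 1) w \<Longrightarrow>
    0 < psnd (psnd w) \<and> (\<exists>n. chain n (\<alpha> i) (real (pfst (psnd w)) / real (psnd (psnd w))) (\<alpha> (pfst w)))"
proof (induction rule: rtranclp_induct)
  case base
  show ?case using chain_refl[of "\<alpha> i"] by (auto simp: state_def)
next
  case (step v w)
  obtain n where n: "0 < psnd (psnd v)"
      "chain n (\<alpha> i) (real (pfst (psnd v)) / real (psnd (psnd v))) (\<alpha> (pfst v))" using step.IH by blast
  obtain u where u: "inv (\<alpha> (pfst v)) \<otimes> \<alpha> (pfst w) \<in> A (level u)"
     "pfst (psnd w) = pfst (psnd v) * 2 ^ psnd u + 2 ^ pfst u * psnd (psnd v)"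
     "psnd (psnd w) = psnd (psnd v) * 2 ^ psnd u" using step.hyps(2) unfolding link_def by blast
  have "chain (Suc n) (\<alpha> i) (real (pfst (psnd v)) / real (psnd (psnd v)) + weight (level u)) (\<alpha> (pfst w))"
    by (rule chain_step[OF n(2) _ u(1)]) simp
  moreover have "real (pfst (psnd v)) / real (psnd (psnd v)) + weight (level u) =
      real (pfst (psnd w)) / real (psnd (psnd w))"
    using n(1) by (simp add: u(2,3) weight_level field_simps)
  ultimately show ?case using n(1) u(3) by auto
qed

text \<open>The vertices are moved to dense points without changing any level, hence without
  changing the weight. Requiring the endpoint to land in an arbitrary open \<open>V\<close> makes
  the induction work: being linked to the next vertex \<open>z\<close> is an open condition on the
  previous vertex, and being linked from the replaced vertex is an open condition on the replacement
  of \<open>z\<close>.\<close>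

lemma link_complete:
  assumes "chain n x r y" "x = \<alpha> i" "openin T V" "y \<in> V"
  shows "\<exists>j N D. \<alpha> j \<in> V \<and> 0 < D \<and> link\<^sup>*\<^sup>* (state i 0 1) (state j N D) \<and> r = real N / real D"
  using assms
proof (induction arbitrary: V rule: chain.induct)
  case (chain_refl x)
  then show ?case by (intro exI[of _ i] exI[of _ 0] exI[of _ 1]) auto
next
  case (chain_step n x r y z l)
  have y: "y \<in> carrier G" using chain_carrier chain_step.hyps by blast
  obtain j N D where j: "inv (\<alpha> j) \<otimes> z \<in> A l" "0 < D" "link\<^sup>*\<^sup>* (state i 0 1) (state j N D)" "r = real N / real D"
    using chain_step.IH[OF chain_step.prems(1) openin_quotient[OF chain_step.hyps(2) openin_A[of l]]]
      chain_step.hyps(3) y by blast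
  have "openin T ({a \<in> carrier G. inv (\<alpha> j) \<otimes> a \<in> A l} \<inter> V)"
    by (intro openin_Int openin_left openin_A chain_step.prems inv_closed point_carrier)
  moreover have "z \<in> {a \<in> carrier G. inv (\<alpha> j) \<otimes> a \<in> A l} \<inter> V"
    using j(1) chain_step.prems chain_step.hyps by blast
  ultimately obtain k where k: "inv (\<alpha> j) \<otimes> \<alpha> k \<in> A l" "\<alpha> k \<in> V"
    using dense by blast
  obtain u where u: "level u = l" by (rule level_surj)
  let ?N = "N * 2 ^ psnd u + 2 ^ pfst u * D" and ?D = "D * 2 ^ psnd u"
  have "link (state j N D) (state k ?N ?D)"
    unfolding link_def using k(1) u by (intro exI[of _ u]) (simp add: state_def)
  then have "link\<^sup>*\<^sup>* (state i 0 1) (state k ?N ?D)" by (rule rtranclp.rtrancl_into_rtrancl[OF j(3)])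
  moreover have "r + weight l = real ?N / real ?D"
    using j(2) by (simp add: j(4) u[symmetric] weight_level field_simps)
  ultimately show ?case using k(2) j(2) by (intro exI[of _ k] exI[of _ ?N] exI[of _ ?D]) simp
qed

text \<open>All vertices but the last are dense points, so for each choice of codes the condition on
  \<open>y\<close> is membership in a translate of a c.e. open set.\<close>

lemma chain_dist_less_iff_link:
  assumes y: "y \<in> carrier G" and q: "0 < q"
  shows "chain_dist (\<alpha> i) y < q \<longleftrightarrow> (\<exists>j N D u. 0 < D \<and> link\<^sup>*\<^sup>* (state i 0 1) (state j N D) \<and>
    inv (\<alpha> j) \<otimes> y \<in> A (level u) \<and> real N / real D + weight (level u) < q)"
proof
  assume "chain_dist (\<alpha> i) y < q"
  then obtain n r where r: "chain n (\<alpha> i) r y" "r < q" using chain_dist_less_iff[OF point_carrier y] by blast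
  from r(1) show "\<exists>j N D u. 0 < D \<and> link\<^sup>*\<^sup>* (state i 0 1) (state j N D) \<and>
    inv (\<alpha> j) \<otimes> y \<in> A (level u) \<and> real N / real D + weight (level u) < q"
  proof cases
    case chain_refl
    \<comment> \<open>The empty chain has no last link; as \<open>q\<close> is positive, a trivial
      link of weight below \<open>q\<close> is supplied.\<close>
    obtain t where t: "weight (int t) < q" using weight_archimedean[OF q] .
    obtain u where u: "level u = int t" by (rule level_surj)
    have "inv (\<alpha> i) \<otimes> y \<in> A (level u)" using chain_refl one_A by simp
    then show ?thesis using t u by (intro exI[of _ i] exI[of _ 0] exI[of _ 1] exI[of _ u]) auto
  next
    case (chain_step m r' y' l)
    have y': "y' \<in> carrier G" using chain_carrier chain_step by blast
    obtain j N D where j: "inv (\<alpha> j) \<otimes> y \<in> A l" "0 < D" "link\<^sup>*\<^sup>* (state i 0 1) (state j N D)" "r' = real N / real D"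
      using link_complete[OF chain_step(3) refl openin_quotient[OF y openin_A[of l]]] chain_step(5) y' by blast
    obtain u where "level u = l" by (rule level_surj)
    then show ?thesis using j r(2) chain_step(2)
      by (intro exI[of _ j] exI[of _ N] exI[of _ D] exI[of _ u]) simp
  qed
next
  assume "\<exists>j N D u. 0 < D \<and> link\<^sup>*\<^sup>* (state i 0 1) (state j N D) \<and>
    inv (\<alpha> j) \<otimes> y \<in> A (level u) \<and> real N / real D + weight (level u) < q"
  then obtain j N D u where *: "link\<^sup>*\<^sup>* (state i 0 1) (state j N D)" "inv (\<alpha> j) \<otimes> y \<in> A (level u)"
      "real N / real D + weight (level u) < q" by blast
  obtain n where "chain n (\<alpha> i) (real N / real D) (\<alpha> j)" using link_sound[OF *(1)] by (auto simp: state_def)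
  then have "chain (Suc n) (\<alpha> i) (real N / real D + weight (level u)) y" using y *(2) by (rule chain_step)
  then show "chain_dist (\<alpha> i) y < q" using chain_dist_less_iff[OF point_carrier y] *(3) by blast
qed

section \<open>Balls as c.e. open sets and the right-c.e. distance\<close>

lemma mem_ball: "y \<in> ball k \<longleftrightarrow> y \<in> carrier G \<and> chain_dist (\<alpha> (pfst k)) y < pos_rat (psnd k)"
  by (auto simp: basic_ball_def case_prod_beta)

lemma open_family_ball: "open_family ball"
proof -
  \<comment> \<open>\<open>v\<close> codes the last dense vertex, the numerator and denominator of
    the weight so far, and the level of the final link; the inequality is the comparison with the
    radius after cross-multiplication.\<close>
  define P where "P k v \<longleftrightarrow> 0 < pfst (psnd (psnd v)) \<and>
    link\<^sup>*\<^sup>* (prod_encode (pfst k, prod_encode (0, 1))) (prod_encode (pfst v, prod_encode (pfst (psnd v), pfst (psnd (psnd v))))) \<and>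
    (pfst (psnd v) * 2 ^ psnd (psnd (psnd (psnd v))) + 2 ^ pfst (psnd (psnd (psnd v))) * pfst (psnd (psnd v))) * Suc (psnd (psnd k)) <
      Suc (pfst (psnd k)) * (pfst (psnd (psnd v)) * 2 ^ psnd (psnd (psnd (psnd v))))" for k v
  have "semidecidable (\<lambda>z. P (pfst z) (psnd z))" unfolding P_def
    by (intro semidecidable_conj semidecidable_rtranclp[OF semidecidable_link] computability)
  then have family: "open_family (\<lambda>k. \<Union>v\<in>{v. P k v}. {y \<in> carrier G. inv (\<alpha> (pfst v)) \<otimes> y \<in> A (level (psnd (psnd (psnd v))))})"
    by (intro open_family_UN open_family_translate point_family_inv
        point_family_comp[OF points] open_family_comp[OF open_A] computability)
  have "ball k = (\<Union>v\<in>{v. P k v}. {y \<in> carrier G. inv (\<alpha> (pfst v)) \<otimes> y \<in> A (level (psnd (psnd (psnd v))))})" for k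
  proof (rule Set.set_eqI)
    fix y
    have sum: "real N / real D + weight (level u) < pos_rat m \<longleftrightarrow>
        (N * 2 ^ psnd u + 2 ^ pfst u * D) * Suc (psnd m) < Suc (pfst m) * (D * 2 ^ psnd u)" if "0 < D" for N D u m
    proof -
      have "real N / real D + weight (level u) = real (N * 2 ^ psnd u + 2 ^ pfst u * D) / real (D * 2 ^ psnd u)"
        using that by (simp add: weight_level field_simps)
      then show ?thesis unfolding pos_rat_eq using that
        by (simp add: divide_less_divide_nat del: of_nat_Suc of_nat_mult of_nat_add of_nat_power)
    qed
    have P_iff: "P k (prod_encode (j, prod_encode (N, prod_encode (D, u)))) \<longleftrightarrow> 0 < D \<and>
        link\<^sup>*\<^sup>* (state (pfst k) 0 1) (state j N D) \<and> real N / real D + weight (level u) < pos_rat (psnd k)" for j N D u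
      unfolding P_def state_def by (auto simp: sum)
    have "y \<in> ball k \<longleftrightarrow> y \<in> carrier G \<and> (\<exists>j N D u. P k (prod_encode (j, prod_encode (N, prod_encode (D, u)))) \<and>
        inv (\<alpha> j) \<otimes> y \<in> A (level u))"
      unfolding mem_ball P_iff using chain_dist_less_iff_link[of y "pos_rat (psnd k)" "pfst k"]
      by (auto simp: pos_rat_eq)
    also have "\<dots> \<longleftrightarrow> y \<in> carrier G \<and> (\<exists>v. P k v \<and> inv (\<alpha> (pfst v)) \<otimes> y \<in> A (level (psnd (psnd (psnd v)))))"
    proof -
      have ex: "(\<exists>v. Q v) \<longleftrightarrow> (\<exists>j N D u. Q (prod_encode (j, prod_encode (N, prod_encode (D, u)))))" for Q
        by (metis prod.collapse prod_decode_inverse)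
      show ?thesis using ex[of "\<lambda>v. P k v \<and> inv (\<alpha> (pfst v)) \<otimes> y \<in> A (level (psnd (psnd (psnd v))))"] by simp
    qed
    finally show "y \<in> ball k \<longleftrightarrow> y \<in> (\<Union>v\<in>{v. P k v}. {y \<in> carrier G. inv (\<alpha> (pfst v)) \<otimes> y \<in> A (level (psnd (psnd (psnd v))))})"
      by auto
  qed
  then have "ball = (\<lambda>k. \<Union>v\<in>{v. P k v}. {y \<in> carrier G. inv (\<alpha> (pfst v)) \<otimes> y \<in> A (level (psnd (psnd (psnd v))))})" by (rule ext)
  then show ?thesis using family by (simp only:)
qed

lemma right_ce_dist: "right_ce \<alpha> chain_dist"
proof -
  have "semidecidable (\<lambda>z. \<exists>m. \<alpha> (pfst (psnd z)) \<in> ball (prod_encode (pfst z, m)) \<and>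
      pos_rat m < real_of_rat (nat_to_rat_surj (psnd (psnd z))))"
    by (intro semidecidable_ex semidecidable_conj semidecidable_point_open semidecidable_pos_rat_less_rat
        point_family_comp[OF points] open_family_comp[OF open_family_ball] computability)
  \<comment> \<open>Distances are nonnegative, so a positive rational fits strictly between the
    distance and any larger bound; thus comparison with a rational reduces to membership in a
    ball.\<close>
  moreover have "(\<exists>m. \<alpha> j \<in> ball (prod_encode (i, m)) \<and> pos_rat m < r) \<longleftrightarrow> chain_dist (\<alpha> i) (\<alpha> j) < r" for i j r
    using pos_rat_less_witness[OF chain_dist_nonneg, of "\<alpha> i" "\<alpha> j" r] by (auto simp: mem_ball)
  ultimately have "semidecidable (\<lambda>z. chain_dist (\<alpha> (pfst z)) (\<alpha> (pfst (psnd z))) <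
      real_of_rat (nat_to_rat_surj (psnd (psnd z))))" by simp
  moreover have "z \<in> {prod_encode (i, prod_encode (j, n)) | i j n. chain_dist (\<alpha> i) (\<alpha> j) < real_of_rat (nat_to_rat_surj n)} \<longleftrightarrow>
      chain_dist (\<alpha> (pfst z)) (\<alpha> (pfst (psnd z))) < real_of_rat (nat_to_rat_surj (psnd (psnd z)))" (is "z \<in> ?S \<longleftrightarrow> ?R") for z
  proof
    assume ?R
    moreover have "z = prod_encode (pfst z, prod_encode (pfst (psnd z), psnd (psnd z)))" by simp
    ultimately show "z \<in> ?S" by blast
  qed auto
  ultimately show ?thesis unfolding right_ce_def ce_iff_semidecidable by simp
qed

lemma ball_subset_translate:
  assumes "pos_rat (psnd k) \<le> weight i"
  shows "ball k \<subseteq> (\<lambda>y. \<alpha> (pfst k) \<otimes> y) ` K i"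
proof
  fix y assume "y \<in> ball k"
  then have y: "y \<in> carrier G" "chain_dist (\<alpha> (pfst k)) y < weight i" using assms by (auto simp: mem_ball)
  then have "inv (\<alpha> (pfst k)) \<otimes> y \<in> K i" using chain_dist_less_weight[OF point_carrier] A_subset_K by blast
  moreover have "y = \<alpha> (pfst k) \<otimes> (inv (\<alpha> (pfst k)) \<otimes> y)" using y(1) by (simp add: m_assoc[symmetric])
  ultimately show "y \<in> (\<lambda>y. \<alpha> (pfst k) \<otimes> y) ` K i" by blast
qed

section \<open>Effective properness and compatibility of the bases\<close>

lemma effectively_proper_dist: "effectively_proper (carrier G) chain_dist \<alpha>"
proof -
  \<comment> \<open>With radius \<open>(a + 1) / (b + 1)\<close> the level is \<open>- a\<close>:
    its weight \<open>2 ^ a\<close> is at least \<open>a + 1\<close>, hence at least the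
    radius.\<close>
  define L where "L k = (\<lambda>y. \<alpha> (pfst k) \<otimes> y) ` K (level (prod_encode (pfst (psnd k), 0)))" for k
  \<comment> \<open>The first factor demands a non-empty prefix, whose head is the index of the
    ball; the second excludes the empty tuple, in agreement with
    \<open>compact_name\<close>.\<close>
  define \<Phi> where "\<Phi> = {z. pfst z \<noteq> 0 \<and> psnd z \<noteq> 0 \<and> L (code_nth (pfst z) 0) \<subseteq> (\<Union>i\<in>code_set (psnd z). ball i)}"
  have L: "compact_family L" unfolding L_def
    by (intro compact_family_translate point_family_comp[OF points] compact_family_comp[OF compact_K] computability)
  have ball_L: "ball k \<subseteq> L k" for k unfolding L_def
  proof (rule ball_subset_translate)
    have "pos_rat (psnd k) \<le> real (Suc (pfst (psnd k)))" by (simp add: pos_rat_eq divide_le_eq)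
    also have "\<dots> \<le> 2 ^ pfst (psnd k)"
      using less_exp[of "pfst (psnd k)"] by (metis Suc_leI of_nat_le_iff of_nat_numeral of_nat_power)
    finally show "pos_rat (psnd k) \<le> weight (level (prod_encode (pfst (psnd k), 0)))" by (simp add: weight_level)
  qed
  have "semidecidable (\<lambda>z. z \<in> \<Phi>)" unfolding \<Phi>_def mem_Collect_eq
    by (intro semidecidable_conj semidecidable_compact_open compact_family_comp[OF L] open_family_UN_code
        open_family_comp[OF open_family_ball] semidecidable_decidable[OF decidable_not] computability)
  then have "ce \<Phi>" unfolding ce_iff_semidecidable .
  moreover have "listed \<Phi> (case_nat k p) = compact_name ball (L k)" for k p
  proof (rule Set.set_eqI)
    fix n
    have "n \<in> compact_name ball (L k) \<longleftrightarrow> n \<noteq> 0 \<and> L k \<subseteq> (\<Union>i\<in>code_set n. ball i)"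
    proof
      assume "n \<in> compact_name ball (L k)"
      then obtain js where "n = list_encode js" "js \<noteq> []" "L k \<subseteq> \<Union> (ball ` set js)"
        unfolding compact_name_def by blast
      then show "n \<noteq> 0 \<and> L k \<subseteq> (\<Union>i\<in>code_set n. ball i)" by (cases js) auto
    next
      assume n: "n \<noteq> 0 \<and> L k \<subseteq> (\<Union>i\<in>code_set n. ball i)"
      then have "list_decode n \<noteq> []" by (metis list_decode_inverse list_encode.simps(1))
      then show "n \<in> compact_name ball (L k)"
        unfolding compact_name_def mem_Collect_eq using n by (intro exI[of _ "list_decode n"]) simp
    qed
    also have "\<dots> \<longleftrightarrow> (\<exists>c. (\<forall>l<code_length c. code_nth c l = case_nat k p l) \<and> c \<noteq> 0 \<and> n \<noteq> 0 \<and>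
        L (code_nth c 0) \<subseteq> (\<Union>i\<in>code_set n. ball i))" (is "?X \<longleftrightarrow> ?Y")
    proof
      assume ?X
      \<comment> \<open>A prefix of length one, the index of the ball, already triggers the
        output.\<close>
      then show ?Y by (intro exI[of _ "list_encode [k]"]) (simp add: code_nth_eq)
    next
      assume ?Y
      then obtain c where c: "\<forall>l<code_length c. code_nth c l = case_nat k p l" "c \<noteq> 0" "n \<noteq> 0"
          "L (code_nth c 0) \<subseteq> (\<Union>i\<in>code_set n. ball i)" by blast
      have "0 < code_length c" using c(2) by (metis length_greater_0_conv list_decode_inverse list_encode.simps(1))
      then have "code_nth c 0 = k" using c(1) by fastforce
      then show ?X using c by simp
    qed
    also have "\<dots> \<longleftrightarrow> n \<in> listed \<Phi> (case_nat k p)" unfolding listed_code \<Phi>_def by simp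
    finally show "n \<in> listed \<Phi> (case_nat k p) \<longleftrightarrow> n \<in> compact_name ball (L k)" by blast
  qed
  ultimately show ?thesis unfolding effectively_proper_def mtopology_eq
    using ball_L compact_familyD[OF L] by (intro exI[of _ \<Phi>]) blast
qed

text \<open>Inclusion of a ball in a basic set is replaced by inclusion of a compact translate that
  contains the ball, which can be tested. This stronger condition still selects enough balls to fill
  the basic set.\<close>

lemma effectively_compatible_dist: "effectively_compatible G B \<alpha> chain_dist"
proof -
  define P where "P i k \<longleftrightarrow> (\<exists>u. Suc (pfst (psnd k)) * 2 ^ psnd u < 2 ^ pfst u * Suc (psnd (psnd k)) \<and>
      (\<lambda>y. \<alpha> (pfst k) \<otimes> y) ` K (level u) \<subseteq> B i)" for i k
  have P: "semidecidable (\<lambda>z. P (pfst z) (psnd z))" unfolding P_def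
    by (intro semidecidable_ex semidecidable_conj semidecidable_compact_open compact_family_translate
        point_family_comp[OF points] compact_family_comp[OF compact_K] open_family_base computability)
  have weight_iff: "pos_rat m < weight (level u) \<longleftrightarrow> Suc (pfst m) * 2 ^ psnd u < 2 ^ pfst u * Suc (psnd m)" for m u
    unfolding pos_rat_eq weight_level using divide_less_divide_nat[of "Suc (psnd m)" "2 ^ psnd u" "Suc (pfst m)" "2 ^ pfst u"]
    by simp
  have B_eq: "B i = (\<Union>k\<in>{k. P i k}. ball k)" for i
  proof (intro subset_antisym subsetI)
    fix x assume "x \<in> (\<Union>k\<in>{k. P i k}. ball k)"
    then obtain k u where "x \<in> ball k" "pos_rat (psnd k) < weight (level u)" "(\<lambda>y. \<alpha> (pfst k) \<otimes> y) ` K (level u) \<subseteq> B i"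
      unfolding P_def weight_iff[symmetric] by blast
    then show "x \<in> B i" using ball_subset_translate[of k "level u"] by auto
  next
    fix x assume x: "x \<in> B i"
    have xc: "x \<in> carrier G" by (rule base_carrier[OF x])
    obtain t where t: "\<And>c. c \<in> C t \<Longrightarrow> x \<otimes> c \<in> B i" using openin_base x by (rule neighbourhood_base_at) (rule that)
    \<comment> \<open>The ball gets its compact translate at level \<open>t + 1\<close> and a centre
      within level \<open>t + 2\<close> of \<open>x\<close>. The radius lies strictly between the
      two weights, so that \<open>x\<close> is inside although its distance from the centre is
      bounded only non-strictly. Recentring the translate at \<open>x\<close> costs one level and
      ends in the translate of \<open>C t\<close> by \<open>x\<close>.\<close>
    obtain u where u: "level u = int (Suc t)" by (rule level_surj)
    obtain s where s: "inv (\<alpha> s) \<otimes> x \<in> U (Suc (Suc t))" using translates_cover[OF xc] by blast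
    obtain m where m: "weight (int (Suc (Suc t))) < pos_rat m" "pos_rat m < weight (level u)"
      using pos_rat_less_witness[of "weight (int (Suc (Suc t)))" "weight (level u)"] u
      by (auto simp: weight_less_iff less_imp_le)
    define k where "k = prod_encode (s, m)"
    have "inv (\<alpha> s) \<otimes> x \<in> A (int (Suc (Suc t)))" using s A_small by blast
    then have "chain_dist (\<alpha> s) x \<le> weight (int (Suc (Suc t)))" by (rule chain_dist_le_weight[OF point_carrier xc])
    then have "x \<in> ball k" using m(1) xc by (simp add: mem_ball k_def)
    moreover have "(\<lambda>y. \<alpha> s \<otimes> y) ` K (level u) \<subseteq> B i"
    proof
      fix y assume "y \<in> (\<lambda>y. \<alpha> s \<otimes> y) ` K (level u)"
      then obtain c where c: "y = \<alpha> s \<otimes> c" "c \<in> C (Suc t)" using u K_small[of "Suc t"] by auto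
      have "inv (\<alpha> s) \<otimes> x \<in> C (Suc t)" using s C_Suc_subset U_subset_C by blast
      then have "inv (inv (\<alpha> s) \<otimes> x) \<in> C (Suc t)" by (rule inv_C)
      then have "inv (inv (\<alpha> s) \<otimes> x) \<otimes> c \<in> C t" using square[OF _ c(2)] U_subset_C by blast
      then have "x \<otimes> (inv (inv (\<alpha> s) \<otimes> x) \<otimes> c) \<in> B i" by (rule t)
      moreover have "x \<otimes> (inv (inv (\<alpha> s) \<otimes> x) \<otimes> c) = y"
        using xc C_carrier[OF c(2)] by (simp add: c(1) inv_mult_group m_assoc[symmetric])
      ultimately show "y \<in> B i" by simp
    qed
    then have "P i k" unfolding P_def weight_iff[symmetric] using m(2) by (auto simp: k_def)
    ultimately show "x \<in> (\<Union>k\<in>{k. P i k}. ball k)" by blast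
  qed
  have "\<exists>W. ce W \<and> (\<forall>i. open_name ball (B i) {k. prod_encode (i, k) \<in> W})"
    unfolding open_name_def ce_iff_semidecidable using P B_eq by (intro exI[of _ "{z. P (pfst z) (psnd z)}"]) simp
  moreover have "\<exists>W. ce W \<and> (\<forall>k. open_name B (ball k) {i. prod_encode (k, i) \<in> W})"
  proof -
    obtain R where "semidecidable (\<lambda>z. R (pfst z) (psnd z))" "\<forall>k. ball k = (\<Union>i\<in>{i. R k i}. B i)"
      using open_family_ball unfolding open_family_def by blast
    then show ?thesis unfolding open_name_def ce_iff_semidecidable
      by (intro exI[of _ "{z. R (pfst z) (psnd z)}"]) simp
  qed
  ultimately show ?thesis
    unfolding effectively_compatible_def effectively_compatible_bases_def using metric_dense by blast
qed

end

section \<open>Joining the small and the large neighbourhoods\<close>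

theorem theorem5p2:
  fixes G :: "('a, 'm) monoid_scheme" and T :: "'a topology" and B :: "nat \<Rightarrow> 'a set"
  assumes "computable_topological_group G T B"
    and "effectively_locally_compact T B"
  shows "\<exists>(\<alpha> :: nat \<Rightarrow> 'a) (d :: 'a \<Rightarrow> 'a \<Rightarrow> real).
    Metric_space (carrier G) d \<and>
    right_ce \<alpha> d \<and>
    effectively_proper (carrier G) d \<alpha> \<and>
    effectively_compatible G B \<alpha> d \<and>
    left_invariant G d"
proof -
  have "group G" using assms(1) unfolding computable_topological_group_def by blast
  then interpret locally_compact_computable_group G T B
    using assms by (intro locally_compact_computable_group.intro computable_group.intro computable_group_axioms.intro
        locally_compact_computable_group_axioms.intro)
  obtain U C where UC: "open_family U" "compact_family C" "\<And>t. \<one>\<^bsub>G\<^esub> \<in> U t" "\<And>t. U t \<subseteq> C t"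
    "\<And>t x. x \<in> U t \<Longrightarrow> inv\<^bsub>G\<^esub> x \<in> U t" "\<And>t x. x \<in> C t \<Longrightarrow> inv\<^bsub>G\<^esub> x \<in> C t"
    "\<And>t x y z. x \<in> C (Suc t) \<Longrightarrow> y \<in> C (Suc t) \<Longrightarrow> z \<in> C (Suc t) \<Longrightarrow> x \<otimes>\<^bsub>G\<^esub> y \<otimes>\<^bsub>G\<^esub> z \<in> U t"
    "\<And>N. openin T N \<Longrightarrow> \<one>\<^bsub>G\<^esub> \<in> N \<Longrightarrow> \<exists>t. C t \<subseteq> N" by (rule small_neighbourhoods) (rule that)
  interpret neighbourhood_sequence G T B U C by unfold_locales (fact UC)+
  obtain \<alpha> where \<alpha>: "point_family \<alpha>" "\<And>N. openin T N \<Longrightarrow> N \<noteq> {} \<Longrightarrow> \<exists>n. \<alpha> n \<in> N"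
    by (rule dense_points) (rule that)
  interpret dense_sequence G T B U C \<alpha> by unfold_locales (fact \<alpha>)+
  obtain V H where VH: "open_family V" "compact_family H" "\<And>t. V t \<subseteq> H t"
    "\<And>t x. x \<in> V t \<Longrightarrow> inv\<^bsub>G\<^esub> x \<in> V t"
    "\<And>t x y z. x \<in> H t \<Longrightarrow> y \<in> H t \<Longrightarrow> z \<in> H t \<Longrightarrow> x \<otimes>\<^bsub>G\<^esub> y \<otimes>\<^bsub>G\<^esub> z \<in> V (Suc t)"
    "\<And>x y z. x \<in> C 0 \<Longrightarrow> y \<in> C 0 \<Longrightarrow> z \<in> C 0 \<Longrightarrow> x \<otimes>\<^bsub>G\<^esub> y \<otimes>\<^bsub>G\<^esub> z \<in> V 0"
    "\<And>x. x \<in> carrier G \<Longrightarrow> \<exists>t. x \<in> V t" by (rule large_neighbourhoods) (rule that)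
  \<comment> \<open>The shift by one lets the levels -1, -2 and so on correspond to
    \<open>V 0\<close>, \<open>V 1\<close> and so on, as level 0 is already
    \<open>U 0\<close>.\<close>
  define A where "A i = (if 0 \<le> i then U (nat i) else V (nat (- i) - 1))" for i
  define K where "K i = (if 0 \<le> i then C (nat i) else H (nat (- i) - 1))" for i
  have cube_K: "x \<otimes>\<^bsub>G\<^esub> y \<otimes>\<^bsub>G\<^esub> z \<in> A i" if "x \<in> K (i + 1)" "y \<in> K (i + 1)" "z \<in> K (i + 1)" for i x y z
  proof -
    \<comment> \<open>At \<open>i = -1\<close> the cube of \<open>C 0\<close> has to lie in
      \<open>V 0\<close>; this is the seam between the two sequences.\<close>
    consider "0 \<le> i" | "i = -1" | "i < -1" by linarith
    then show ?thesis
    proof cases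
      case 1
      then have "nat (i + 1) = Suc (nat i)" by simp
      then show ?thesis using that 1 UC(7) by (simp add: A_def K_def)
    next
      case 2
      then show ?thesis using that VH(6) by (simp add: A_def K_def)
    next
      case 3
      define a where "a = nat (- (i + 1)) - 1"
      have "nat (- i) - 1 = Suc a" using 3 by (simp add: a_def)
      then have "A i = V (Suc a)" "K (i + 1) = H a" using 3 by (simp_all add: A_def K_def a_def)
      then show ?thesis using that VH(5) by simp
    qed
  qed
  have AK: "A i \<subseteq> K i" for i using UC(4) VH(3) by (simp add: A_def K_def)
  have inv_A: "inv\<^bsub>G\<^esub> x \<in> A i" if "x \<in> A i" for i x
    using that UC(5) VH(4) by (simp add: A_def split: if_splits)
  have one_K: "\<one>\<^bsub>G\<^esub> \<in> K i" for i
  proof (cases "0 \<le> i")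
    case True
    then show ?thesis using one_C by (simp add: K_def)
  next
    case False
    \<comment> \<open>The identity is its own cube, so it passes from \<open>C 0\<close> to
      \<open>V 0\<close> and then from each \<open>H t\<close> to the next level.\<close>
    have "\<one>\<^bsub>G\<^esub> \<in> H t" for t
    proof (induction t)
      case 0
      show ?case using VH(6)[OF one_C one_C one_C] VH(3) by auto
    next
      case (Suc t)
      show ?case using VH(5)[OF Suc Suc Suc] VH(3) by auto
    qed
    then show ?thesis using False by (simp add: K_def)
  qed
  have rec: "recursive (\<lambda>u. psnd u - pfst u)" "recursive (\<lambda>u. pfst u - psnd u - 1)" by (intro computability)+
  \<comment> \<open>In terms of codes the sign of the level is a comparison of the two components,
    and truncated subtraction gives both indices, so the case distinction is decidable and its
    branches are recursive.\<close>
  have if_level: "(if 0 \<le> level u then X (nat (level u)) else Y (nat (- level u) - 1)) =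
      (if pfst u \<le> psnd u then X (psnd u - pfst u) else Y (pfst u - psnd u - 1))" for u and X Y :: "nat \<Rightarrow> 'a set"
  proof -
    have "nat (int a - int b) = a - b" for a b by arith
    then show ?thesis by (simp add: level_def)
  qed
  interpret computable_scale G T B U C \<alpha> A K
  proof unfold_locales
    show "x \<in> carrier G" if "x \<in> A i" for x i
      using that U_carrier open_family_carrier[OF VH(1)] by (auto simp: A_def split: if_splits)
    show "\<one>\<^bsub>G\<^esub> \<in> A i" for i using cube_K[OF one_K one_K one_K] by simp
    show "x \<otimes>\<^bsub>G\<^esub> y \<otimes>\<^bsub>G\<^esub> z \<in> A i" if "x \<in> A (i + 1)" "y \<in> A (i + 1)" "z \<in> A (i + 1)" for i x y z
      using cube_K that AK by blast
    show "\<exists>i. x \<in> A i" if x: "x \<in> carrier G" for x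
    proof -
      obtain t where "x \<in> V t" using VH(7)[OF x] by blast
      moreover have "nat (- (- int t - 1)) - 1 = t" by simp
      ultimately have "x \<in> A (- int t - 1)" unfolding A_def by simp
      then show ?thesis by blast
    qed
    show "x = \<one>\<^bsub>G\<^esub>" if x: "x \<in> carrier G" "\<And>i. x \<in> A i" for x
    proof (rule ccontr)
      assume "x \<noteq> \<one>\<^bsub>G\<^esub>"
      then obtain N N' where N: "openin T N" "\<one>\<^bsub>G\<^esub> \<in> N" "x \<in> N'" "disjnt N N'"
        using Hausdorff x(1) unfolding Hausdorff_space_def by (metis one_closed topspace_carrier)
      obtain t where "C t \<subseteq> N" using UC(8)[OF N(1,2)] by blast
      moreover have "x \<in> U t" using x(2)[of "int t"] by (simp add: A_def)
      ultimately show False using N(3,4) UC(4) unfolding disjnt_iff by blast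
    qed
    show "open_family (\<lambda>u. A (level u))" unfolding A_def if_level
      by (intro open_family_if open_family_comp[OF UC(1)] open_family_comp[OF VH(1)] computability)
    show "compact_family (\<lambda>u. K (level u))" unfolding K_def if_level
      by (intro compact_family_if compact_family_comp[OF UC(2)] compact_family_comp[OF VH(2)] computability)
    show "A (int t) = U t" "K (int t) = C t" for t by (simp_all add: A_def K_def)
  qed (use AK inv_A in auto)
  show ?thesis
    using Metric_space_dist right_ce_dist effectively_proper_dist effectively_compatible_dist left_invariant_dist
    by blast
qed

end
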